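(* There exists $Z_{XY} \in \mathfrak{X}^{S^1}_2$ (that is, with $X$ an affine vector field with a singularity of saddle type and $\operatorname{div}(X)=0$ inside $S^1$, and $Y$ an affine vector field with a singularity of center type outside $S^1$) that admits exactly one crossing limit cycle and one homoclinic orbit that intersect $S^1$ in two points.
   Context: Let $S^1=\{(x,y)\in\mathbb R^2: x^2+y^2=1\}$ and $h(x,y)=x^2+y^2-1$. For smooth vector fields $X,Y$ on $\mathbb R^2$, $Z_{XY}$ denotes the piecewise smooth vector field equal to $X$ where $h\le 0$ and to $Y$ where $h\ge 0$, with Filippov's convention on $S^1$. Write $Xh=\langle X,\nabla h\rangle$ and $Yh=\langle Y,\nabla h\rangle$. The crossing region is $\{z\in S^1: Xh(z)\,Yh(z)>0\}$; there, trajectories of $X$ and $Y$ are concatenated. A crossing periodic orbit is a closed nonconstant trajectory of $Z_{XY}$, obtained by concatenating arcs of $X$-trajectories in $h\le 0$ and arcs of $Y$-trajectories in $h\ge 0$, that meets $S^1$ only at points of the crossing region. A crossing limit cycle is a crossing periodic orbit having a neighbourhood that contains no other periodic orbit. A homoclinic orbit is a trajectory of $Z_{XY}$, obtained by concatenating such arcs at points of the crossing region, that tends to the saddle point of $X$ (a point of $\{h\le 0\}$, possibly on $S^1$) both as $t\to+\infty$ and as $t\to-\infty$. "Intersects $S^1$ in two points" means that the orbit (not counting the saddle point itself) meets $S^1$ in exactly two distinct points. "Linear vector field" means an affine vector field $z\mapsto Az+b$. Its singularity (possibly anywhere in the plane) is of center type if $A$ has nonzero purely imaginary eigenvalues, and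 of saddle type if $A$ has real eigenvalues of opposite signs. $\mathfrak{X}^{S^1}_2$ is the set of $Z_{XY}$ with $X$ linear with a singularity of saddle type and $\operatorname{div}(X)=0$, and $Y$ linear with a singularity of center type. *)

theory Defs
  imports "HOL-Analysis.Analysis"
begin

type_synonym plane = "real^2"
type_synonym field = "plane \<Rightarrow> plane"

section \<open>Affine vector fields of saddle and center type\<close>

definition complexify :: "real^2^2 \<Rightarrow> complex^2^2" where
  "complexify A = (\<chi> i j. complex_of_real (A $ i $ j))"

definition eigenvalue_of :: "real^2^2 \<Rightarrow> complex \<Rightarrow> bool" where
  "eigenvalue_of A l \<longleftrightarrow> (\<exists>v. v \<noteq> 0 \<and> complexify A *v v = l *s v)"

text \<open>In both definitions below the matrix is invertible, so the singularity exists and is unique;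
  its position in the plane is not restricted.\<close>

definition linear_saddle :: "field \<Rightarrow> bool" where
  "linear_saddle X \<longleftrightarrow> (\<exists>A b. X = (\<lambda>z. A *v z + b) \<and>
     (\<exists>l m::real. l < 0 \<and> 0 < m \<and>
        eigenvalue_of A (complex_of_real l) \<and> eigenvalue_of A (complex_of_real m)))"

definition linear_center :: "field \<Rightarrow> bool" where
  "linear_center Y \<longleftrightarrow> (\<exists>A b. Y = (\<lambda>z. A *v z + b) \<and>
     (\<exists>w::real. w \<noteq> 0 \<and>
        eigenvalue_of A (\<i> * complex_of_real w) \<and> eigenvalue_of A (- \<i> * complex_of_real w)))"

definition divergence :: "field \<Rightarrow> plane \<Rightarrow> real" where
  "divergence X z = trace (jacobian X (at z))"

text \<open>The piecewise field \<open>Z\<^bsub>XY\<^esub>\<close> is represented by the pair \<open>(X, Y)\<close>.\<close>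

definition X_S1_2 :: "(field \<times> field) set" where
  "X_S1_2 = {(X, Y). linear_saddle X \<and> (\<forall>z. divergence X z = 0) \<and> linear_center Y}"

section \<open>The switching circle\<close>

definition sw :: "plane \<Rightarrow> real" where
  "sw z = (z $ 1)\<^sup>2 + (z $ 2)\<^sup>2 - 1"

definition S1 :: "plane set" where
  "S1 = {z. sw z = 0}"

definition grad_sw :: "plane \<Rightarrow> plane" where
  "grad_sw z = 2 *\<^sub>R z"

lemma sw_eq_inner: "sw z = z \<bullet> z - 1"
  by (simp add: sw_def inner_vec_def sum_2 power2_eq_square)

lemma GDERIV_sw: "GDERIV sw z :> grad_sw z"
proof -
  have "((\<lambda>z. z \<bullet> z - 1) has_derivative (\<lambda>v. v \<bullet> grad_sw z)) (at z)"
    unfolding grad_sw_def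
    by (auto intro!: derivative_eq_intros simp: fun_eq_iff inner_commute)
  then show ?thesis
    by (simp add: gderiv_def sw_eq_inner[abs_def])
qed

definition lie_sw :: "field \<Rightarrow> plane \<Rightarrow> real" where
  "lie_sw X z = X z \<bullet> grad_sw z"

definition crossing_region :: "field \<Rightarrow> field \<Rightarrow> plane set" where
  "crossing_region X Y = {z \<in> S1. lie_sw X z * lie_sw Y z > 0}"

section \<open>Trajectories\<close>

text \<open>Break points of a locally finite subdivision of the time axis.\<close>

definition subdivision :: "(int \<Rightarrow> real) \<Rightarrow> bool" where
  "subdivision \<tau> \<longleftrightarrow>
     strict_mono \<tau> \<and> filterlim \<tau> at_top at_top \<and> filterlim \<tau> at_bot at_bot"

datatype side = Inside | Outside

fun side_arc :: "field \<Rightarrow> field \<Rightarrow> side \<Rightarrow> (real \<Rightarrow> plane) \<Rightarrow> real \<Rightarrow> real \<Rightarrow> bool" where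
  "side_arc X Y Inside \<gamma> a b \<longleftrightarrow>
     (\<forall>t\<in>{a..b}. sw (\<gamma> t) \<le> 0 \<and> (\<gamma> has_vector_derivative X (\<gamma> t)) (at t within {a..b}))"
| "side_arc X Y Outside \<gamma> a b \<longleftrightarrow>
     (\<forall>t\<in>{a..b}. sw (\<gamma> t) \<ge> 0 \<and> (\<gamma> has_vector_derivative Y (\<gamma> t)) (at t within {a..b}))"

text \<open>Consecutive arcs on the same side form one longer arc, so trajectories with finitely many
  switches, or none, are included; only a genuine switch has to take place in the crossing
  region.\<close>

definition crossing_trajectory :: "field \<Rightarrow> field \<Rightarrow> (real \<Rightarrow> plane) \<Rightarrow> bool" where
  "crossing_trajectory X Y \<gamma> \<longleftrightarrow> (\<exists>\<tau> \<kappa>. subdivision \<tau> \<and>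
     (\<forall>i. side_arc X Y (\<kappa> i) \<gamma> (\<tau> i) (\<tau> (i + 1))) \<and>
     (\<forall>i. \<kappa> i \<noteq> \<kappa> (i + 1) \<longrightarrow> \<gamma> (\<tau> (i + 1)) \<in> crossing_region X Y))"

definition filippov :: "field \<Rightarrow> field \<Rightarrow> plane \<Rightarrow> plane set" where
  "filippov X Y z =
     (if sw z < 0 then {X z} else if sw z > 0 then {Y z} else closed_segment (X z) (Y z))"

text \<open>Piecewise differentiable solutions of the Filippov inclusion. Along an arc contained in the
  circle the velocity is tangent to the circle, so where the normal components of \<open>X\<close> and \<open>Y\<close> have
  opposite signs it is the Filippov sliding vector field; hence all concatenations of arcs of \<open>X\<close>,
  arcs of \<open>Y\<close> and sliding arcs are covered.\<close>

definition filippov_trajectory :: "field \<Rightarrow> field \<Rightarrow> (real \<Rightarrow> plane) \<Rightarrow> bool" where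
  "filippov_trajectory X Y \<gamma> \<longleftrightarrow> (\<exists>\<tau>. subdivision \<tau> \<and>
     (\<forall>i. \<forall>t\<in>{\<tau> i..\<tau> (i + 1)}. \<exists>v\<in>filippov X Y (\<gamma> t).
        (\<gamma> has_vector_derivative v) (at t within {\<tau> i..\<tau> (i + 1)})))"

section \<open>Limit cycles and homoclinic orbits\<close>

text \<open>Orbits are point sets, so reparametrisations are identified.\<close>

definition closed_curve :: "(real \<Rightarrow> plane) \<Rightarrow> bool" where
  "closed_curve \<gamma> \<longleftrightarrow> (\<exists>T>0. \<forall>t. \<gamma> (t + T) = \<gamma> t) \<and> (\<exists>s t. \<gamma> s \<noteq> \<gamma> t)"

definition periodic_orbit :: "field \<Rightarrow> field \<Rightarrow> plane set \<Rightarrow> bool" where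
  "periodic_orbit X Y \<Gamma> \<longleftrightarrow>
     (\<exists>\<gamma>. filippov_trajectory X Y \<gamma> \<and> closed_curve \<gamma> \<and> \<Gamma> = range \<gamma>)"

definition crossing_periodic_orbit :: "field \<Rightarrow> field \<Rightarrow> plane set \<Rightarrow> bool" where
  "crossing_periodic_orbit X Y \<Gamma> \<longleftrightarrow>
     (\<exists>\<gamma>. crossing_trajectory X Y \<gamma> \<and> closed_curve \<gamma> \<and> \<Gamma> = range \<gamma>) \<and>
     \<Gamma> \<inter> S1 \<subseteq> crossing_region X Y"

definition crossing_limit_cycle :: "field \<Rightarrow> field \<Rightarrow> plane set \<Rightarrow> bool" where
  "crossing_limit_cycle X Y \<Gamma> \<longleftrightarrow> crossing_periodic_orbit X Y \<Gamma> \<and>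
     (\<exists>U. open U \<and> \<Gamma> \<subseteq> U \<and> (\<forall>\<Gamma>'. periodic_orbit X Y \<Gamma>' \<and> \<Gamma>' \<subseteq> U \<longrightarrow> \<Gamma>' = \<Gamma>))"

definition homoclinic_orbit :: "field \<Rightarrow> field \<Rightarrow> plane \<Rightarrow> plane set \<Rightarrow> bool" where
  "homoclinic_orbit X Y p \<Lambda> \<longleftrightarrow> X p = 0 \<and> sw p \<le> 0 \<and>
     (\<exists>\<gamma>. crossing_trajectory X Y \<gamma> \<and> (\<exists>s t. \<gamma> s \<noteq> \<gamma> t) \<and>
        (\<gamma> \<longlongrightarrow> p) at_top \<and> (\<gamma> \<longlongrightarrow> p) at_bot \<and> \<Lambda> = range \<gamma>)"

lemma side_arc_filippov:
  assumes "side_arc X Y s \<gamma> a b" "t \<in> {a..b}"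
  shows "\<exists>v\<in>filippov X Y (\<gamma> t). (\<gamma> has_vector_derivative v) (at t within {a..b})"
  using assms by (cases s) (force simp: filippov_def)+

lemma crossing_trajectory_imp_filippov_trajectory:
  "crossing_trajectory X Y \<gamma> \<Longrightarrow> filippov_trajectory X Y \<gamma>"
  unfolding crossing_trajectory_def filippov_trajectory_def by (meson side_arc_filippov)

lemma crossing_periodic_orbit_imp_periodic_orbit:
  "crossing_periodic_orbit X Y \<Gamma> \<Longrightarrow> periodic_orbit X Y \<Gamma>"
  unfolding crossing_periodic_orbit_def periodic_orbit_def
  by (auto dest: crossing_trajectory_imp_filippov_trajectory)

end

theory Submission
  imports Defs
begin

text \<open>
  The example is \<open>X(x, y) = (y, x + 1/5)\<close>, a saddle at \<open>p = (-1/5, 0)\<close> inside the disc, and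
  \<open>Y(x, y) = (10x - 26y + 57, 26x - 10y + 15)\<close>, a center at \<open>(5/16, 37/16)\<close>. Modulo the equation of the
  circle, the first integral \<open>(x + 1/5)\<^sup>2 - y\<^sup>2\<close> of \<open>X\<close> is a polynomial in \<open>x\<close>, so an arc of \<open>X\<close> that
  enters through the upper left of the circle leaves through the upper right at the point with
  \<open>x + x' = -1/5\<close>. Such a chord joins points on one level of the quadratic integral of \<open>Y\<close>
  exactly when the height of its midpoint is \<open>7/10\<close> or \<open>4/5\<close>; the coefficients of \<open>Y\<close> were chosen for this.
  The first chord is spanned by the separatrices of \<open>p\<close>, hence gives the homoclinic orbit, the second
  one gives the limit cycle.

  No other periodic orbit passes through the circle transversally: the map from one entry point to the
  next is increasing in \<open>x\<close>, so the entry point of a periodic orbit with the largest \<open>x\<close> is fixed, and a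
  trajectory that only crosses the circle is determined forward by one of its points. Periodic orbits
  of \<open>Y\<close> alone are never isolated, since they can be dilated slightly about the center.
\<close>

section \<open>Trajectories of piecewise smooth fields\<close>

text \<open>Given the saddle and the coefficient -10 of xy in \<open>HY\<close>, the coefficients 15
  and -57 are forced: if (d, e) is half the difference of the ends of a chord with midpoint (-1/10,
  h), the circle gives h e = d/10, and equality of \<open>HY\<close> at the ends, multiplied by h,
  reads d (-20 h^2 + 30 h - 56/5) = 0. The coefficient 13 of x^2 + y^2 has no effect on the circle;
  since 13^2 - 5^2 = 12^2, it makes the frequency of the center rational. The abscissa -1/5 makes
  the separatrices meet the circle in rational points.

  The obstacle is the breadth of the isolation condition, which compares with every Filippov
  periodic orbit, including sliding and grazing ones. An open set around the cycle that avoids the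
  circle outside the crossing region leaves only transversal competitors. For these, one-sided
  derivatives and closed formulas for both flows suffice, and a relation expressed by first
  integrals replaces times of flight. A homoclinic trajectory comes with no such open set, so its
  contacts with the circle are analysed backwards from the last one.\<close>

lemma subdivision_piece_right:
  assumes "subdivision \<tau>"
  shows "\<exists>i. \<tau> i \<le> t \<and> t < \<tau> (i + 1)"
proof -
  have mono: "strict_mono \<tau>" and top: "filterlim \<tau> at_top at_top" and bot: "filterlim \<tau> at_bot at_bot"
    using assms by (auto simp: subdivision_def)
  obtain N where N: "\<And>n. n \<ge> N \<Longrightarrow> \<tau> n \<ge> t + 1"
    using top by (metis (full_types) eventually_at_top_linorder filterlim_at_top)
  obtain M where M: "\<And>n. n \<le> M \<Longrightarrow> \<tau> n \<le> t"
    using bot by (metis (full_types) eventually_at_bot_linorder filterlim_at_bot)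
  have bound: "i < N" if "\<tau> i \<le> t" for i
    using N[of i] that by (cases "i < N") auto
  have MN: "M < N" using bound M by auto
  \<comment> \<open>The cut-off \<open>M\<close> makes the set finite; unboundedness of
    \<open>\<tau>\<close> below would otherwise put all very negative indices into it.\<close>
  define S where "S = {i. M \<le> i \<and> \<tau> i \<le> t}"
  have "S \<subseteq> {M..N}" using bound by (auto simp: S_def less_imp_le)
  then have fin: "finite S" using finite_subset by blast
  have ne: "M \<in> S" using M by (simp add: S_def)
  define i where "i = Max S"
  have i: "i \<in> S" unfolding i_def using fin ne by (intro Max_in) auto
  have "i + 1 \<notin> S" using Max_ge[OF fin, of "i + 1"] by (auto simp: i_def)
  with i show ?thesis by (intro exI[of _ i]) (auto simp: S_def)
qed

lemma subdivision_piece_left: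
  assumes "subdivision \<tau>"
  shows "\<exists>i. \<tau> i < t \<and> t \<le> \<tau> (i + 1)"
proof -
  obtain i where i: "\<tau> i \<le> t" "t < \<tau> (i + 1)" using subdivision_piece_right[OF assms] by blast
  show ?thesis
  proof (cases "\<tau> i = t")
    case True
    have "\<tau> (i - 1) < \<tau> i"
      using assms by (simp add: subdivision_def strict_mono_def)
    then show ?thesis using True by (intro exI[of _ "i - 1"]) auto
  next
    case False
    then show ?thesis using i by (intro exI[of _ i]) auto
  qed
qed

text \<open>Together with its mirror image for the left, this replaces the subdivision by one-sided
  derivatives at every time; what follows about a given Filippov trajectory uses only these.\<close>

lemma filippov_trajectory_right:
  assumes "filippov_trajectory X Y \<gamma>"
  obtains e v where "e > 0" "v \<in> filippov X Y (\<gamma> t)"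
    "(\<gamma> has_vector_derivative v) (at t within {t..t + e})"
proof -
  obtain \<tau> where sub: "subdivision \<tau>"
    and d: "\<And>i t. t \<in> {\<tau> i..\<tau> (i + 1)} \<Longrightarrow> \<exists>v\<in>filippov X Y (\<gamma> t).
        (\<gamma> has_vector_derivative v) (at t within {\<tau> i..\<tau> (i + 1)})"
    using assms unfolding filippov_trajectory_def by blast
  obtain i where i: "\<tau> i \<le> t" "t < \<tau> (i + 1)" using subdivision_piece_right[OF sub] by blast
  then obtain v where v: "v \<in> filippov X Y (\<gamma> t)"
    "(\<gamma> has_vector_derivative v) (at t within {\<tau> i..\<tau> (i + 1)})" using d[of t i] by auto
  show ?thesis
    by (rule that[of "\<tau> (i + 1) - t" v])
      (use i v in \<open>auto intro: has_vector_derivative_within_subset\<close>)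
qed

lemma filippov_trajectory_left:
  assumes "filippov_trajectory X Y \<gamma>"
  obtains e v where "e > 0" "v \<in> filippov X Y (\<gamma> t)"
    "(\<gamma> has_vector_derivative v) (at t within {t - e..t})"
proof -
  obtain \<tau> where sub: "subdivision \<tau>"
    and d: "\<And>i t. t \<in> {\<tau> i..\<tau> (i + 1)} \<Longrightarrow> \<exists>v\<in>filippov X Y (\<gamma> t).
        (\<gamma> has_vector_derivative v) (at t within {\<tau> i..\<tau> (i + 1)})"
    using assms unfolding filippov_trajectory_def by blast
  obtain i where i: "\<tau> i < t" "t \<le> \<tau> (i + 1)" using subdivision_piece_left[OF sub] by blast
  then obtain v where v: "v \<in> filippov X Y (\<gamma> t)"
    "(\<gamma> has_vector_derivative v) (at t within {\<tau> i..\<tau> (i + 1)})" using d[of t i] by auto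
  show ?thesis
    by (rule that[of "t - \<tau> i" v])
      (use i v in \<open>auto intro: has_vector_derivative_within_subset\<close>)
qed

lemma at_within_left_right_eq_at:
  fixes t :: real
  assumes "e > 0" "d > 0"
  shows "at t = sup (at t within {t - d..t}) (at t within {t..t + e})"
proof -
  have "{t - d..t} \<union> {t..t + e} = {t - d..t + e}" using assms by auto
  then have "sup (at t within {t - d..t}) (at t within {t..t + e}) = at t within {t - d..t + e}"
    by (metis at_within_union)
  moreover have "at t within {t - d..t + e} = at t"
    using assms by (intro at_within_interior) (auto simp: interior_atLeastAtMost_real)
  ultimately show ?thesis by simp
qed

lemma has_vector_derivative_left_right:
  fixes \<gamma> :: "real \<Rightarrow> 'a::real_normed_vector"
  assumes "e > 0" "d > 0"
    and "(\<gamma> has_vector_derivative v) (at t within {t - d..t})"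
    and "(\<gamma> has_vector_derivative v) (at t within {t..t + e})"
  shows "(\<gamma> has_vector_derivative v) (at t)"
  using assms(3,4) unfolding has_vector_derivative_def has_derivative_within
  by (subst at_within_left_right_eq_at[OF assms(1,2)])
     (auto simp: has_derivative_def intro: filterlim_sup)

lemma filippov_trajectory_isCont:
  assumes "filippov_trajectory X Y \<gamma>"
  shows "isCont \<gamma> t"
proof -
  obtain e v where 1: "e > 0" "(\<gamma> has_vector_derivative v) (at t within {t..t + e})"
    using filippov_trajectory_right[OF assms] by metis
  obtain d w where 2: "d > 0" "(\<gamma> has_vector_derivative w) (at t within {t - d..t})"
    using filippov_trajectory_left[OF assms] by metis
  have "continuous (at t within {t..t + e}) \<gamma>" "continuous (at t within {t - d..t}) \<gamma>"
    using 1 2 has_vector_derivative_continuous by blast+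
  then show ?thesis
    unfolding continuous_within isCont_def
    by (subst at_within_left_right_eq_at[OF 1(1) 2(1)]) (rule filterlim_sup)
qed

lemma filippov_trajectory_continuous_on:
  "filippov_trajectory X Y \<gamma> \<Longrightarrow> continuous_on S \<gamma>"
  by (simp add: continuous_at_imp_continuous_on filippov_trajectory_isCont)

lemma continuous_on_sw [continuous_intros]:
  "continuous_on S f \<Longrightarrow> continuous_on S (\<lambda>t. sw (f t))"
  unfolding sw_def by (intro continuous_intros)

lemma filippov_trajectory_sw_isCont:
  assumes "filippov_trajectory X Y \<gamma>"
  shows "isCont (\<lambda>t. sw (\<gamma> t)) t"
proof -
  have "continuous_on UNIV (\<lambda>t. sw (\<gamma> t))"
    by (intro continuous_intros filippov_trajectory_continuous_on[OF assms])
  then show ?thesis using continuous_on_eq_continuous_at by blast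
qed

text \<open>Where the inclusion is single-valued both one-sided derivatives agree, so break points
  off the circle leave no trace.\<close>

lemma filippov_trajectory_derivative:
  assumes "filippov_trajectory X Y \<gamma>" "filippov X Y (\<gamma> t) = {w}"
  shows "(\<gamma> has_vector_derivative w) (at t)"
proof -
  obtain e v where 1: "e > 0" "v \<in> filippov X Y (\<gamma> t)"
      "(\<gamma> has_vector_derivative v) (at t within {t..t + e})"
    using filippov_trajectory_right[OF assms(1)] by metis
  obtain d v' where 2: "d > 0" "v' \<in> filippov X Y (\<gamma> t)"
      "(\<gamma> has_vector_derivative v') (at t within {t - d..t})"
    using filippov_trajectory_left[OF assms(1)] by metis
  show ?thesis using 1 2 assms(2) has_vector_derivative_left_right by auto
qed

text \<open>The derivative is required only in the open interval: the ends usually lie on the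
  circle, where the inclusion allows a whole segment of velocities.\<close>

definition solution_on :: "field \<Rightarrow> (real \<Rightarrow> plane) \<Rightarrow> real \<Rightarrow> real \<Rightarrow> bool" where
  "solution_on X \<gamma> a b \<longleftrightarrow> continuous_on {a..b} \<gamma> \<and>
     (\<forall>t\<in>{a<..<b}. (\<gamma> has_vector_derivative X (\<gamma> t)) (at t))"

lemma solution_on_subset:
  "solution_on X \<gamma> a b \<Longrightarrow> a \<le> c \<Longrightarrow> d \<le> b \<Longrightarrow> solution_on X \<gamma> c d"
  unfolding solution_on_def by (auto intro: continuous_on_subset)

lemma filippov_trajectory_inside:
  assumes "filippov_trajectory X Y \<gamma>" "\<And>t. a < t \<Longrightarrow> t < b \<Longrightarrow> sw (\<gamma> t) < 0"
  shows "solution_on X \<gamma> a b"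
proof -
  have "filippov X Y (\<gamma> t) = {X (\<gamma> t)}" if "a < t" "t < b" for t
    using assms(2)[OF that] by (auto simp: filippov_def)
  then show ?thesis
    unfolding solution_on_def
    by (simp add: filippov_trajectory_derivative[OF assms(1)]
        filippov_trajectory_continuous_on[OF assms(1)])
qed

lemma filippov_trajectory_outside:
  assumes "filippov_trajectory X Y \<gamma>" "\<And>t. a < t \<Longrightarrow> t < b \<Longrightarrow> sw (\<gamma> t) > 0"
  shows "solution_on Y \<gamma> a b"
proof -
  have "filippov X Y (\<gamma> t) = {Y (\<gamma> t)}" if "a < t" "t < b" for t
    using assms(2)[OF that] by (auto simp: filippov_def)
  then show ?thesis
    unfolding solution_on_def
    by (simp add: filippov_trajectory_derivative[OF assms(1)]
        filippov_trajectory_continuous_on[OF assms(1)])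
qed

section \<open>The sign of \<open>sw\<close> near a crossing point\<close>

lemma has_real_derivative_sw:
  assumes "(\<gamma> has_vector_derivative v) (at t within S)"
  shows "((\<lambda>t. sw (\<gamma> t)) has_real_derivative v \<bullet> grad_sw (\<gamma> t)) (at t within S)"
proof -
  have "(sw has_derivative (\<lambda>h. h \<bullet> grad_sw (\<gamma> t))) (at (\<gamma> t))"
    using GDERIV_sw[of "\<gamma> t"] by (simp add: gderiv_def)
  then have "((\<lambda>t. sw (\<gamma> t)) has_derivative (\<lambda>h. (h *\<^sub>R v) \<bullet> grad_sw (\<gamma> t))) (at t within S)"
    using assms unfolding has_vector_derivative_def
    by (rule has_derivative_compose[rotated])
  then show ?thesis
    by (simp add: has_field_derivative_def mult.commute[of _ "v \<bullet> grad_sw (\<gamma> t)"])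
qed

lemma sw_increasing_right:
  assumes "(\<gamma> has_vector_derivative v) (at t within {t..t + e})" "e > 0"
    "v \<bullet> grad_sw (\<gamma> t) > 0"
  shows "\<exists>d>0. \<forall>s. 0 < s \<and> s < d \<longrightarrow> sw (\<gamma> (t + s)) > sw (\<gamma> t)"
proof -
  obtain d where "d > 0" "\<forall>h>0. t + h \<in> {t..t + e} \<longrightarrow> h < d \<longrightarrow> sw (\<gamma> t) < sw (\<gamma> (t + h))"
    using has_real_derivative_pos_inc_right[OF has_real_derivative_sw[OF assms(1)] assms(3)] by auto
  then show ?thesis using assms(2) by (intro exI[of _ "min d e"]) auto
qed

lemma sw_increasing_left:
  assumes "(\<gamma> has_vector_derivative v) (at t within {t - e..t})" "e > 0"
    "v \<bullet> grad_sw (\<gamma> t) > 0"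
  shows "\<exists>d>0. \<forall>s. 0 < s \<and> s < d \<longrightarrow> sw (\<gamma> (t - s)) < sw (\<gamma> t)"
proof -
  obtain d where "d > 0" "\<forall>h>0. t - h \<in> {t - e..t} \<longrightarrow> h < d \<longrightarrow> sw (\<gamma> (t - h)) < sw (\<gamma> t)"
    using has_real_derivative_pos_inc_left[OF has_real_derivative_sw[OF assms(1)] assms(3)] by auto
  then show ?thesis using assms(2) by (intro exI[of _ "min d e"]) auto
qed

lemma sw_decreasing_right:
  assumes "(\<gamma> has_vector_derivative v) (at t within {t..t + e})" "e > 0"
    "v \<bullet> grad_sw (\<gamma> t) < 0"
  shows "\<exists>d>0. \<forall>s. 0 < s \<and> s < d \<longrightarrow> sw (\<gamma> (t + s)) < sw (\<gamma> t)"
proof -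
  obtain d where "d > 0" "\<forall>h>0. t + h \<in> {t..t + e} \<longrightarrow> h < d \<longrightarrow> sw (\<gamma> (t + h)) < sw (\<gamma> t)"
    using has_real_derivative_neg_dec_right[OF has_real_derivative_sw[OF assms(1)] assms(3)] by auto
  then show ?thesis using assms(2) by (intro exI[of _ "min d e"]) auto
qed

lemma sw_decreasing_left:
  assumes "(\<gamma> has_vector_derivative v) (at t within {t - e..t})" "e > 0"
    "v \<bullet> grad_sw (\<gamma> t) < 0"
  shows "\<exists>d>0. \<forall>s. 0 < s \<and> s < d \<longrightarrow> sw (\<gamma> (t - s)) > sw (\<gamma> t)"
proof -
  obtain d where "d > 0" "\<forall>h>0. t - h \<in> {t - e..t} \<longrightarrow> h < d \<longrightarrow> sw (\<gamma> t) < sw (\<gamma> (t - h))"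
    using has_real_derivative_neg_dec_left[OF has_real_derivative_sw[OF assms(1)] assms(3)] by auto
  then show ?thesis using assms(2) by (intro exI[of _ "min d e"]) auto
qed

text \<open>The normal component is affine along the segment of admissible velocities, so equal
  signs at both ends exclude a tangent velocity, hence sliding.\<close>

lemma filippov_crossing_pos:
  assumes "z \<in> S1" "v \<in> filippov X Y z" "lie_sw X z > 0" "lie_sw Y z > 0"
  shows "v \<bullet> grad_sw z > 0"
proof -
  obtain u where u: "0 \<le> u" "u \<le> 1" "v = (1 - u) *\<^sub>R X z + u *\<^sub>R Y z"
    using assms(1,2) by (auto simp: S1_def filippov_def closed_segment_def)
  have "v \<bullet> grad_sw z = (1 - u) * lie_sw X z + u * lie_sw Y z"
    by (simp add: u(3) lie_sw_def inner_add_left)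
  also have "\<dots> > 0"
    using u assms(3,4) by (cases "u = 0") (auto intro: add_nonneg_pos)
  finally show ?thesis .
qed

lemma filippov_crossing_neg:
  assumes "z \<in> S1" "v \<in> filippov X Y z" "lie_sw X z < 0" "lie_sw Y z < 0"
  shows "v \<bullet> grad_sw z < 0"
proof -
  obtain u where u: "0 \<le> u" "u \<le> 1" "v = (1 - u) *\<^sub>R X z + u *\<^sub>R Y z"
    using assms(1,2) by (auto simp: S1_def filippov_def closed_segment_def)
  have "v \<bullet> grad_sw z = (1 - u) * lie_sw X z + u * lie_sw Y z"
    by (simp add: u(3) lie_sw_def inner_add_left)
  also have "\<dots> < 0"
    using u assms(3,4) mult_nonneg_nonpos[of u "lie_sw Y z"] mult_nonneg_nonpos[of "1 - u" "lie_sw X z"]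
    by (cases "u = 0") (auto intro!: add_nonpos_neg simp: mult_pos_neg)
  finally show ?thesis .
qed

lemma filippov_exit:
  assumes "filippov_trajectory X Y \<gamma>" "\<gamma> t \<in> S1" "lie_sw X (\<gamma> t) > 0" "lie_sw Y (\<gamma> t) > 0"
  shows "\<exists>d>0. \<forall>s. 0 < s \<and> s < d \<longrightarrow> sw (\<gamma> (t - s)) < 0 \<and> sw (\<gamma> (t + s)) > 0"
proof -
  obtain e v where 1: "e > 0" "v \<in> filippov X Y (\<gamma> t)"
      "(\<gamma> has_vector_derivative v) (at t within {t..t + e})"
    using filippov_trajectory_right[OF assms(1)] by metis
  obtain e' v' where 2: "e' > 0" "v' \<in> filippov X Y (\<gamma> t)"
      "(\<gamma> has_vector_derivative v') (at t within {t - e'..t})"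
    using filippov_trajectory_left[OF assms(1)] by metis
  obtain d1 where "d1 > 0" "\<forall>s. 0 < s \<and> s < d1 \<longrightarrow> sw (\<gamma> (t + s)) > sw (\<gamma> t)"
    using sw_increasing_right[OF 1(3,1)] filippov_crossing_pos[OF assms(2) 1(2) assms(3,4)] by blast
  moreover obtain d2 where "d2 > 0" "\<forall>s. 0 < s \<and> s < d2 \<longrightarrow> sw (\<gamma> (t - s)) < sw (\<gamma> t)"
    using sw_increasing_left[OF 2(3,1)] filippov_crossing_pos[OF assms(2) 2(2) assms(3,4)] by blast
  ultimately show ?thesis using assms(2) by (intro exI[of _ "min d1 d2"]) (auto simp: S1_def)
qed

lemma filippov_entry:
  assumes "filippov_trajectory X Y \<gamma>" "\<gamma> t \<in> S1" "lie_sw X (\<gamma> t) < 0" "lie_sw Y (\<gamma> t) < 0"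
  shows "\<exists>d>0. \<forall>s. 0 < s \<and> s < d \<longrightarrow> sw (\<gamma> (t - s)) > 0 \<and> sw (\<gamma> (t + s)) < 0"
proof -
  obtain e v where 1: "e > 0" "v \<in> filippov X Y (\<gamma> t)"
      "(\<gamma> has_vector_derivative v) (at t within {t..t + e})"
    using filippov_trajectory_right[OF assms(1)] by metis
  obtain e' v' where 2: "e' > 0" "v' \<in> filippov X Y (\<gamma> t)"
      "(\<gamma> has_vector_derivative v') (at t within {t - e'..t})"
    using filippov_trajectory_left[OF assms(1)] by metis
  obtain d1 where "d1 > 0" "\<forall>s. 0 < s \<and> s < d1 \<longrightarrow> sw (\<gamma> (t + s)) < sw (\<gamma> t)"
    using sw_decreasing_right[OF 1(3,1)] filippov_crossing_neg[OF assms(2) 1(2) assms(3,4)] by blast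
  moreover obtain d2 where "d2 > 0" "\<forall>s. 0 < s \<and> s < d2 \<longrightarrow> sw (\<gamma> (t - s)) > sw (\<gamma> t)"
    using sw_decreasing_left[OF 2(3,1)] filippov_crossing_neg[OF assms(2) 2(2) assms(3,4)] by blast
  ultimately show ?thesis using assms(2) by (intro exI[of _ "min d1 d2"]) (auto simp: S1_def)
qed

text \<open>Serves the homoclinic orbit, which may a priori touch the circle outside the crossing
  region; there the Filippov inclusion does not tell which field is followed, but the two adjacent
  arcs do.\<close>

lemma crossing_trajectory_local:
  assumes "crossing_trajectory X Y \<gamma>"
  obtains e l r where "e > 0" "side_arc X Y l \<gamma> (t - e) t" "side_arc X Y r \<gamma> t (t + e)"
    "l \<noteq> r \<Longrightarrow> \<gamma> t \<in> crossing_region X Y"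
proof -
  obtain \<tau> \<kappa> where sub: "subdivision \<tau>"
    and arc: "\<And>i. side_arc X Y (\<kappa> i) \<gamma> (\<tau> i) (\<tau> (i + 1))"
    and sw: "\<And>i. \<kappa> i \<noteq> \<kappa> (i + 1) \<Longrightarrow> \<gamma> (\<tau> (i + 1)) \<in> crossing_region X Y"
    using assms unfolding crossing_trajectory_def by blast
  have sub_arc: "side_arc X Y s \<gamma> c d" if "side_arc X Y s \<gamma> a b" "a \<le> c" "d \<le> b" for s a b c d
    using that by (cases s) (force intro: has_vector_derivative_within_subset[of _ _ _ "{a..b}"])+
  obtain i where i: "\<tau> i \<le> t" "t < \<tau> (i + 1)" using subdivision_piece_right[OF sub] by blast
  show ?thesis
  proof (cases "\<tau> i = t")
    case True
    define j where "j = i - 1"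
    have j: "i = j + 1" by (simp add: j_def)
    have jt: "\<tau> j < t" using sub True by (auto simp: subdivision_def strict_mono_def j_def)
    define e where "e = min (t - \<tau> j) (\<tau> (i + 1) - t)"
    show ?thesis
    proof (rule that[of e "\<kappa> j" "\<kappa> i"])
      show "e > 0" using jt i by (auto simp: e_def)
      show "side_arc X Y (\<kappa> j) \<gamma> (t - e) t"
        by (rule sub_arc[OF arc[of j]]) (auto simp: e_def True j[symmetric])
      show "side_arc X Y (\<kappa> i) \<gamma> t (t + e)"
        by (rule sub_arc[OF arc[of i]]) (auto simp: e_def True)
      show "\<gamma> t \<in> crossing_region X Y" if "\<kappa> j \<noteq> \<kappa> i"
        using sw[of j] that True j by auto
    qed
  next
    case False
    define e where "e = min (t - \<tau> i) (\<tau> (i + 1) - t)"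
    show ?thesis
    proof (rule that[of e "\<kappa> i" "\<kappa> i"])
      show "e > 0" using False i by (auto simp: e_def)
      show "side_arc X Y (\<kappa> i) \<gamma> (t - e) t"
        by (rule sub_arc[OF arc[of i]]) (use i in \<open>auto simp: e_def\<close>)
      show "side_arc X Y (\<kappa> i) \<gamma> t (t + e)"
        by (rule sub_arc[OF arc[of i]]) (use i in \<open>auto simp: e_def\<close>)
    qed auto
  qed
qed

section \<open>First and last zeros of a continuous function\<close>

lemma next_zero:
  fixes f :: "real \<Rightarrow> real"
  assumes cont: "continuous_on UNIV f" and d: "d > 0" "\<And>s. 0 < s \<Longrightarrow> s < d \<Longrightarrow> f (t + s) > 0"
    and u: "u > t" "f u \<le> 0"
  obtains t' where "t < t'" "t' \<le> u" "f t' = 0" "\<And>s. t < s \<Longrightarrow> s < t' \<Longrightarrow> f s > 0"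
proof -
  have ud: "u \<ge> t + d"
    using d(2)[of "u - t"] u by force
  \<comment> \<open>Starting at \<open>t + d/2\<close> keeps the closed set away from
    \<open>t\<close>, where \<open>f\<close> typically vanishes.\<close>
  define S where "S = {t + d/2..u} \<inter> f -` {..0}"
  have "closed S"
    unfolding S_def using cont by (intro closed_Int closed_vimage) auto
  moreover have bdd: "bdd_below S" by (auto simp: S_def)
  moreover have "u \<in> S" using u ud d(1) by (simp add: S_def)
  ultimately have mem: "Inf S \<in> S" using closed_contains_Inf by blast
  define t' where "t' = Inf S"
  have t': "t + d/2 \<le> t'" "t' \<le> u" "f t' \<le> 0" using mem by (auto simp: S_def t'_def)
  have pos: "f s > 0" if s: "t < s" "s < t'" for s
  proof (cases "s < t + d/2")
    case True
    then show ?thesis using d(2)[of "s - t"] d(1) s by auto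
  next
    case False
    have "s \<notin> S" using cInf_lower[OF _ bdd, of s] s by (auto simp: t'_def)
    then show ?thesis using False t' s by (auto simp: S_def)
  qed
  have "f t' = 0"
  proof (rule ccontr)
    assume "f t' \<noteq> 0"
    then have neg: "f t' < 0" using t'(3) by simp
    have p: "f (t + d/4) \<ge> 0" using d(2)[of "d/4"] d(1) by auto
    \<comment> \<open>A negative value at the first nonpositive time would force an earlier
      zero.\<close>
    have "\<exists>x. t + d/4 \<le> x \<and> x \<le> t' \<and> f x = 0"
      using p neg t'(1) d(1) by (intro IVT2' continuous_on_subset[OF cont]) auto
    then obtain x where x: "t + d/4 \<le> x" "x \<le> t'" "f x = 0" by blast
    then have "x < t'" using neg by (cases "x = t'") auto
    then show False using pos[of x] x d by auto
  qed
  then show ?thesis using that t' pos d by force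
qed

lemma previous_zero:
  fixes f :: "real \<Rightarrow> real"
  assumes cont: "continuous_on UNIV f" and d: "d > 0" "\<And>s. 0 < s \<Longrightarrow> s < d \<Longrightarrow> f (t - s) > 0"
    and u: "u < t" "f u \<le> 0"
  obtains t' where "t' < t" "u \<le> t'" "f t' = 0" "\<And>s. t' < s \<Longrightarrow> s < t \<Longrightarrow> f s > 0"
proof -
  have c: "continuous_on UNIV (\<lambda>s. f (- s))"
    by (rule continuous_on_compose2[OF cont]) (auto intro: continuous_intros)
  obtain t' where t': "- t < t'" "t' \<le> - u" "f (- t') = 0" "\<And>s. - t < s \<Longrightarrow> s < t' \<Longrightarrow> f (- s) > 0"
    by (rule next_zero[OF c d(1), of "- t" "- u"]) (use d(2) u in auto)
  show ?thesis
    by (rule that[of "- t'"]) (use t' t'(4)[of "- s" for s] in auto)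
qed

section \<open>The two affine fields\<close>

definition X0 :: field where
  "X0 z = vector [z$2, z$1 + 1/5]"

definition Y0 :: field where
  "Y0 z = vector [10 * z$1 - 26 * z$2 + 57, 26 * z$1 - 10 * z$2 + 15]"

definition p0 :: plane where
  "p0 = vector [-1/5, 0]"

text \<open>Coordinates centered at the saddle in which the linear part of \<open>X0\<close> is diagonal.\<close>

definition uu :: "plane \<Rightarrow> real" where "uu z = z$1 + z$2 + 1/5"
definition vv :: "plane \<Rightarrow> real" where "vv z = z$1 - z$2 + 1/5"

text \<open>The Hamiltonian of the center: \<open>Y0\<close> is its gradient turned by a quarter
  turn.\<close>

definition HY :: "plane \<Rightarrow> real" where
  "HY z = 13 * ((z$1)\<^sup>2 + (z$2)\<^sup>2) - 10 * z$1 * z$2 + 15 * z$1 - 57 * z$2"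

text \<open>\<open>gg\<close> is the derivative of \<open>HY\<close> with respect to the angle along the circle.\<close>

definition gg :: "plane \<Rightarrow> real" where
  "gg z = 10 * ((z$2)\<^sup>2 - (z$1)\<^sup>2) - 15 * z$2 - 57 * z$1"

lemma X0_nth [simp]: "X0 z $ 1 = z$2" "X0 z $ 2 = z$1 + 1/5"
  by (simp_all add: X0_def)

lemma Y0_nth [simp]:
  "Y0 z $ 1 = 10 * z$1 - 26 * z$2 + 57" "Y0 z $ 2 = 26 * z$1 - 10 * z$2 + 15"
  by (simp_all add: Y0_def)

lemma p0_nth [simp]: "p0 $ 1 = -1/5" "p0 $ 2 = 0"
  by (simp_all add: p0_def)

lemma plane_eq_iff: "(z :: plane) = w \<longleftrightarrow> z$1 = w$1 \<and> z$2 = w$2"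
  by (simp add: vec_eq_iff forall_2)

lemma plane_eq_iff_uu_vv: "z = w \<longleftrightarrow> uu z = uu w \<and> vv z = vv w"
  by (auto simp: plane_eq_iff uu_def vv_def)

lemma uu_p0 [simp]: "uu p0 = 0" and vv_p0 [simp]: "vv p0 = 0"
  by (simp_all add: uu_def vv_def)

lemma X0_p0: "X0 p0 = 0"
  by (simp add: plane_eq_iff)

text \<open>The tangency line x = -1/10 is also the axis about which the ends of an arc of
  \<open>X0\<close> lie symmetrically in x.\<close>

lemma lie_X0: "lie_sw X0 z = 4 * z$2 * (z$1 + 1/10)"
  by (simp add: lie_sw_def grad_sw_def inner_vec_def sum_2 algebra_simps)

text \<open>Turning a gradient by a quarter turn makes the radial component of the field minus the
  angular derivative of the function.\<close>

lemma lie_Y0: "lie_sw Y0 z = - 2 * gg z"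
  by (simp add: lie_sw_def grad_sw_def gg_def inner_vec_def sum_2 algebra_simps power2_eq_square)

section \<open>Saddle type, center type and divergence of the example\<close>

lemma jacobian_affine:
  fixes A :: "real^2^2"
  shows "jacobian (\<lambda>z. A *v z + b) (at z) = A"
proof -
  have "((\<lambda>z. A *v z + b) has_derivative (*v) A) (at z)"
    by (auto intro!: derivative_eq_intros bounded_linear_imp_has_derivative)
  then have "frechet_derivative (\<lambda>z. A *v z + b) (at z) = (*v) A"
    by (simp add: frechet_derivative_at[symmetric])
  then show ?thesis by (simp add: jacobian_def)
qed

lemma X0_affine: "X0 = (\<lambda>z. vector [vector [0, 1], vector [1, 0]] *v z + vector [0, 1/5])"
  by (auto simp: fun_eq_iff plane_eq_iff matrix_vector_mult_def sum_2)

lemma Y0_affine: "Y0 = (\<lambda>z. vector [vector [10, -26], vector [26, -10]] *v z + vector [57, 15])"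
  by (auto simp: fun_eq_iff plane_eq_iff matrix_vector_mult_def sum_2)

lemma complex2_eq_iff: "(v :: complex^2) = w \<longleftrightarrow> v$1 = w$1 \<and> v$2 = w$2"
  by (simp add: vec_eq_iff forall_2)

lemma linear_saddle_X0: "linear_saddle X0"
  unfolding linear_saddle_def
proof (intro exI conjI)
  show "X0 = (\<lambda>z. vector [vector [0, 1], vector [1, 0]] *v z + vector [0, 1/5])"
    by (rule X0_affine)
  show "eigenvalue_of (vector [vector [0, 1], vector [1, 0]]) (complex_of_real (- 1))"
    unfolding eigenvalue_of_def
    by (rule exI[of _ "vector [1, -1]"])
       (simp add: complex2_eq_iff complexify_def matrix_vector_mult_def sum_2)
  show "eigenvalue_of (vector [vector [0, 1], vector [1, 0]]) (complex_of_real 1)"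
    unfolding eigenvalue_of_def
    by (rule exI[of _ "vector [1, 1]"])
       (simp add: complex2_eq_iff complexify_def matrix_vector_mult_def sum_2)
qed simp_all

lemma linear_center_Y0: "linear_center Y0"
  unfolding linear_center_def
proof (intro exI conjI)
  show "Y0 = (\<lambda>z. vector [vector [10, -26], vector [26, -10]] *v z + vector [57, 15])"
    by (rule Y0_affine)
  show "eigenvalue_of (vector [vector [10, -26], vector [26, -10]]) (\<i> * complex_of_real 24)"
    unfolding eigenvalue_of_def
    by (rule exI[of _ "vector [26, 10 - 24 * \<i>]"])
       (simp add: complex2_eq_iff complexify_def matrix_vector_mult_def sum_2 complex_eq_iff)
  show "eigenvalue_of (vector [vector [10, -26], vector [26, -10]]) (- \<i> * complex_of_real 24)"
    unfolding eigenvalue_of_def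
    by (rule exI[of _ "vector [26, 10 + 24 * \<i>]"])
       (simp add: complex2_eq_iff complexify_def matrix_vector_mult_def sum_2 complex_eq_iff)
qed simp_all

lemma X0_Y0_mem: "(X0, Y0) \<in> X_S1_2"
proof -
  have "divergence X0 z = 0" for z
    unfolding divergence_def X0_affine jacobian_affine by (simp add: trace_def sum_2)
  then show ?thesis by (simp add: X_S1_2_def linear_saddle_X0 linear_center_Y0)
qed

section \<open>Explicit flows\<close>

definition flowX :: "real \<Rightarrow> plane \<Rightarrow> plane" where
  "flowX t z = vector [(uu z * exp t + vv z * exp (- t)) / 2 - 1/5,
                       (uu z * exp t - vv z * exp (- t)) / 2]"

text \<open>With A the linear part and q the displacement from the center, A^2 = -576 I, so the
  exponential is cos(24 t) q + sin(24 t) A q / 24.\<close>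

definition flowY :: "real \<Rightarrow> plane \<Rightarrow> plane" where
  "flowY t z = vector
    [5/16 + (z$1 - 5/16) * cos (24 * t) + (5 * (z$1 - 5/16) - 13 * (z$2 - 37/16)) / 12 * sin (24 * t),
     37/16 + (z$2 - 37/16) * cos (24 * t) + (13 * (z$1 - 5/16) - 5 * (z$2 - 37/16)) / 12 * sin (24 * t)]"

lemma flowX_nth:
  "flowX t z $ 1 = (uu z * exp t + vv z * exp (- t)) / 2 - 1/5"
  "flowX t z $ 2 = (uu z * exp t - vv z * exp (- t)) / 2"
  by (simp_all add: flowX_def)

lemma flowY_nth:
  "flowY t z $ 1 = 5/16 + (z$1 - 5/16) * cos (24 * t)
     + (5 * (z$1 - 5/16) - 13 * (z$2 - 37/16)) / 12 * sin (24 * t)"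
  "flowY t z $ 2 = 37/16 + (z$2 - 37/16) * cos (24 * t)
     + (13 * (z$1 - 5/16) - 5 * (z$2 - 37/16)) / 12 * sin (24 * t)"
  by (simp_all add: flowY_def)

lemma uu_flowX [simp]: "uu (flowX t z) = uu z * exp t"
  and vv_flowX [simp]: "vv (flowX t z) = vv z * exp (- t)"
  by (simp_all add: uu_def vv_def flowX_nth field_simps)

lemma flowX_0 [simp]: "flowX 0 z = z"
  by (simp add: plane_eq_iff_uu_vv)

lemma flowY_0 [simp]: "flowY 0 z = z"
  by (simp add: plane_eq_iff flowY_nth)

lemma has_vector_derivative_plane:
  fixes \<gamma> :: "real \<Rightarrow> plane"
  shows "(\<gamma> has_vector_derivative v) (at t within S) \<longleftrightarrow>
    ((\<lambda>t. \<gamma> t $ 1) has_real_derivative v$1) (at t within S) \<and>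
    ((\<lambda>t. \<gamma> t $ 2) has_real_derivative v$2) (at t within S)"
proof
  assume "(\<gamma> has_vector_derivative v) (at t within S)"
  then show "((\<lambda>t. \<gamma> t $ 1) has_real_derivative v$1) (at t within S) \<and>
    ((\<lambda>t. \<gamma> t $ 2) has_real_derivative v$2) (at t within S)"
    using bounded_linear.has_vector_derivative[OF bounded_linear_vec_nth]
    by (auto simp: has_real_derivative_iff_has_vector_derivative)
next
  assume *: "((\<lambda>t. \<gamma> t $ 1) has_real_derivative v$1) (at t within S) \<and>
    ((\<lambda>t. \<gamma> t $ 2) has_real_derivative v$2) (at t within S)"
  have eq: "z = z$1 *\<^sub>R axis 1 1 + z$2 *\<^sub>R axis 2 1" for z :: plane
    by (simp add: plane_eq_iff axis_def)
  have "((\<lambda>t. \<gamma> t $ 1 *\<^sub>R axis 1 1 + \<gamma> t $ 2 *\<^sub>R axis 2 1) has_vector_derivative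
     (v$1 *\<^sub>R axis 1 1 + v$2 *\<^sub>R (axis 2 1 :: plane))) (at t within S)"
    using * by (auto intro!: derivative_eq_intros)
  then show "(\<gamma> has_vector_derivative v) (at t within S)"
    by (simp add: eq[symmetric])
qed

lemma flowY_derivative:
  "((\<lambda>t. flowY t z) has_vector_derivative Y0 (flowY t z)) (at t within S)"
  unfolding has_vector_derivative_plane flowY_nth Y0_nth
  by (auto intro!: derivative_eq_intros simp: field_simps)

text \<open>In the diagonal coordinates the exponential growth of \<open>uu\<close> and decay of
  \<open>vv\<close> can be divided out, leaving two constants.\<close>

lemma solution_X0:
  assumes "solution_on X0 \<gamma> a b" "a \<le> t" "t \<le> b"
  shows "\<gamma> t = flowX (t - a) (\<gamma> a)"
proof (cases "a = t")
  case False
  have cont: "continuous_on {a..t} \<gamma>" and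
    der: "\<And>s. a < s \<Longrightarrow> s < t \<Longrightarrow> (\<gamma> has_vector_derivative X0 (\<gamma> s)) (at s)"
    using solution_on_subset[OF assms(1), of a t] assms by (auto simp: solution_on_def)
  have 1: "uu (\<gamma> t) * exp (- (t - a)) = uu (\<gamma> a) * exp (- (a - a))"
    unfolding uu_def
    by (rule DERIV_isconst_end[of a t "\<lambda>s. (\<gamma> s $ 1 + \<gamma> s $ 2 + 1/5) * exp (- (s - a))"])
       (use False assms cont der[unfolded has_vector_derivative_plane] in
        \<open>auto intro!: continuous_intros derivative_eq_intros simp: algebra_simps\<close>)
  have 2: "vv (\<gamma> t) * exp (t - a) = vv (\<gamma> a) * exp (a - a)"
    unfolding vv_def
    by (rule DERIV_isconst_end[of a t "\<lambda>s. (\<gamma> s $ 1 - \<gamma> s $ 2 + 1/5) * exp (s - a)"])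
       (use False assms cont der[unfolded has_vector_derivative_plane] in
        \<open>auto intro!: continuous_intros derivative_eq_intros simp: algebra_simps\<close>)
  have "uu (\<gamma> t) = uu (\<gamma> t) * exp (- (t - a)) * exp (t - a)"
    "vv (\<gamma> t) = vv (\<gamma> t) * exp (t - a) * exp (- (t - a))"
    by (simp_all only: mult.assoc mult_exp_exp) simp_all
  then show ?thesis
    unfolding 1 2 by (simp add: plane_eq_iff_uu_vv)
qed simp

text \<open>The difference from the explicit flow solves the homogeneous equation, along which the
  quadratic part of \<open>HY\<close> is constant. It vanishes initially and is positive definite,
  so the difference is zero.\<close>

lemma solution_Y0:
  assumes "solution_on Y0 \<gamma> a b" "a \<le> t" "t \<le> b"
  shows "\<gamma> t = flowY (t - a) (\<gamma> a)"
proof (cases "a = t")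
  case False
  have cont: "continuous_on {a..t} \<gamma>" and
    der: "\<And>s. a < s \<Longrightarrow> s < t \<Longrightarrow> (\<gamma> has_vector_derivative Y0 (\<gamma> s)) (at s)"
    using solution_on_subset[OF assms(1), of a t] assms by (auto simp: solution_on_def)
  define \<delta> where "\<delta> s = \<gamma> s - flowY (s - a) (\<gamma> a)" for s
  define Q where "Q s = 13 * (\<delta> s $ 1)\<^sup>2 - 10 * \<delta> s $ 1 * \<delta> s $ 2 + 13 * (\<delta> s $ 2)\<^sup>2" for s
  have fd: "((\<lambda>s. flowY (s - a) (\<gamma> a)) has_vector_derivative Y0 (flowY (s - a) (\<gamma> a))) (at s within S)" for s S
    unfolding has_vector_derivative_plane flowY_nth Y0_nth
    by (auto intro!: derivative_eq_intros simp: field_simps)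
  have c\<delta>: "continuous_on {a..t} \<delta>"
    unfolding \<delta>_def using cont fd
    by (intro continuous_intros)
       (auto simp: continuous_on_eq_continuous_within intro!: has_vector_derivative_continuous)
  have d\<delta>: "((\<lambda>s. \<delta> s $ 1) has_real_derivative 10 * \<delta> s $ 1 - 26 * \<delta> s $ 2) (at s)"
           "((\<lambda>s. \<delta> s $ 2) has_real_derivative 26 * \<delta> s $ 1 - 10 * \<delta> s $ 2) (at s)"
    if "a < s" "s < t" for s
    using has_vector_derivative_diff[OF der[OF that] fd]
    by (auto simp: \<delta>_def has_vector_derivative_plane algebra_simps)
  have "(Q has_real_derivative 0) (at s)" if "a < s" "s < t" for s
    unfolding Q_def[abs_def]
    by (rule derivative_eq_intros d\<delta>[OF that] refl)+ (simp add: power2_eq_square algebra_simps)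
  moreover have "continuous_on {a..t} Q"
    unfolding Q_def[abs_def] by (intro continuous_intros c\<delta>)
  ultimately have "Q t = Q a"
    using False assms by (intro DERIV_isconst_end) auto
  then have "Q t = 0" by (simp add: Q_def \<delta>_def)
  moreover have "Q t = 5 * (\<delta> t $ 1 - \<delta> t $ 2)\<^sup>2 + 8 * (\<delta> t $ 1)\<^sup>2 + 8 * (\<delta> t $ 2)\<^sup>2"
    by (simp add: Q_def power2_eq_square algebra_simps)
  ultimately have "(\<delta> t $ 1)\<^sup>2 = 0" "(\<delta> t $ 2)\<^sup>2 = 0"
    by (smt (verit) zero_le_power2)+
  then show ?thesis by (simp add: \<delta>_def plane_eq_iff)
qed simp

lemma HY_center: "HY z = 13 * (z$1 - 5/16)\<^sup>2 - 10 * (z$1 - 5/16) * (z$2 - 37/16)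
    + 13 * (z$2 - 37/16)\<^sup>2 + HY (vector [5/16, 37/16])"
  by (simp add: HY_def power2_eq_square algebra_simps)

lemma HY_flowY [simp]: "HY (flowY t z) = HY z"
proof -
  have eq: "13 * (a * c + (5 * a - 13 * b) / 12 * s)\<^sup>2
      - 10 * (a * c + (5 * a - 13 * b) / 12 * s) * (b * c + (13 * a - 5 * b) / 12 * s)
      + 13 * (b * c + (13 * a - 5 * b) / 12 * s)\<^sup>2
      = (13 * a\<^sup>2 - 10 * a * b + 13 * b\<^sup>2) * (s\<^sup>2 + c\<^sup>2)" for a b c s :: real
    by (simp add: power2_eq_square field_simps)
  show ?thesis
    unfolding HY_center[of "flowY t z"] HY_center[of z]
    using eq[of "z$1 - 5/16" "cos (24 * t)" "z$2 - 37/16" "sin (24 * t)"]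
    by (simp add: flowY_nth algebra_simps)
qed

lemma flowY_period: "flowY (t + pi / 12) z = flowY t z"
  by (simp add: plane_eq_iff flowY_nth distrib_left)

lemma flowY_transitive:
  assumes "HY z = HY w"
  shows "\<exists>t\<ge>0. flowY t z = w"
proof -
  define a b c d where "a = z$1 - 5/16" and "b = z$2 - 37/16" and "c = w$1 - 5/16" and "d = w$2 - 37/16"
  define q where "q = 13 * a\<^sup>2 - 10 * a * b + 13 * b\<^sup>2"
  have q2: "q = 13 * c\<^sup>2 - 10 * c * d + 13 * d\<^sup>2"
    using assms HY_center[of z] HY_center[of w] by (simp add: q_def a_def b_def c_def d_def)
  have sos: "13 * x\<^sup>2 - 10 * x * y + 13 * y\<^sup>2 = 5 * (x - y)\<^sup>2 + 8 * x\<^sup>2 + 8 * y\<^sup>2" for x y :: real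
    by (simp add: power2_eq_square algebra_simps)
  show ?thesis
  proof (cases "q = 0")
    case True
    have "a\<^sup>2 = 0" "b\<^sup>2 = 0" using True sos[of a b] unfolding q_def by (smt (verit) zero_le_power2)+
    moreover have "c\<^sup>2 = 0" "d\<^sup>2 = 0" using True sos[of c d] unfolding q2 by (smt (verit) zero_le_power2)+
    ultimately have "z = w" by (simp add: plane_eq_iff a_def b_def c_def d_def)
    then show ?thesis by (intro exI[of _ 0]) simp
  next
    case False
    \<comment> \<open>Cramer's rule, with determinant \<open>q / 12\<close>, for the coordinates of
      w in the basis that \<open>flowY\<close> uses for z (both relative to the center). Equality of
      \<open>HY\<close> puts \<open>(x, y)\<close> on the unit circle, so they are the cosine and
      sine of an angle.\<close>
    define x where "x = (c * (13 * a - 5 * b) - d * (5 * a - 13 * b)) / q"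
    define y where "y = 12 * (a * d - b * c) / q"
    have "x\<^sup>2 + y\<^sup>2 = ((c * (13 * a - 5 * b) - d * (5 * a - 13 * b))\<^sup>2 + (12 * (a * d - b * c))\<^sup>2) / q\<^sup>2"
      by (simp add: x_def y_def power_divide add_divide_distrib)
    also have "(c * (13 * a - 5 * b) - d * (5 * a - 13 * b))\<^sup>2 + (12 * (a * d - b * c))\<^sup>2 = q * q"
      by (subst (2) q2, unfold q_def) (simp add: power2_eq_square algebra_simps)
    finally have "x\<^sup>2 + y\<^sup>2 = 1" using False by (simp add: power2_eq_square)
    then obtain t where t: "0 \<le> t" "x = cos t" "y = sin t"
      using sincos_total_2pi by metis
    have xq: "x * q = c * (13 * a - 5 * b) - d * (5 * a - 13 * b)" and yq: "y * q = 12 * (a * d - b * c)"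
      using False by (simp_all add: x_def y_def)
    have "(a * x + (5 * a - 13 * b) / 12 * y) * q = a * (x * q) + (5 * a - 13 * b) / 12 * (y * q)"
      by (simp add: algebra_simps)
    also have "\<dots> = c * q"
      unfolding xq yq by (simp add: q_def power2_eq_square field_simps)
    finally have 1: "a * x + (5 * a - 13 * b) / 12 * y = c" using False by simp
    have "(b * x + (13 * a - 5 * b) / 12 * y) * q = b * (x * q) + (13 * a - 5 * b) / 12 * (y * q)"
      by (simp add: algebra_simps)
    also have "\<dots> = d * q"
      unfolding xq yq by (simp add: q_def power2_eq_square field_simps)
    finally have 2: "b * x + (13 * a - 5 * b) / 12 * y = d" using False by simp
    have "flowY (t / 24) z = w"
      using 1 2 t by (simp add: plane_eq_iff flowY_nth a_def b_def c_def d_def)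
    then show ?thesis using t by (intro exI[of _ "t / 24"]) simp
  qed
qed

section \<open>First integrals on the circle\<close>

text \<open>Eliminating the second coordinate is possible off the circle as well: along an arc of
  \<open>X0\<close>, \<open>sw\<close> is a quadratic polynomial in the first coordinate, which
  controls its sign between the ends.\<close>

lemma sw_uu_vv: "sw z = 2 * (z$1)\<^sup>2 + 2/5 * z$1 - 24/25 - uu z * vv z"
  by (simp add: sw_def uu_def vv_def power2_eq_square algebra_simps)

lemma S1_level_uu_vv:
  assumes "z \<in> S1" "w \<in> S1" "uu z * vv z = uu w * vv w"
  shows "w$1 = z$1 \<or> z$1 + w$1 = - 1/5"
proof -
  have "(w$1 - z$1) * (z$1 + w$1 + 1/5) = 0"
    using assms sw_uu_vv[of z] sw_uu_vv[of w]
    by (simp add: S1_def power2_eq_square algebra_simps)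
  then show ?thesis by auto
qed

text \<open>Write the two points as \<open>c (a, b) \<plusminus> s (-b, a)\<close> with a unit vector \<open>(a, b)\<close>. Equality of \<open>HY\<close>
  turns the values of \<open>gg\<close> into \<open>s (\<plusminus> W - 10 s k)\<close>, and the term \<open>57 b - 15 a\<close> makes \<open>W\<close> dominant.\<close>

lemma HY_level_circle:
  assumes "z \<in> S1" "w \<in> S1" "HY z = HY w" "z \<noteq> w"
  shows "gg z * gg w < 0"
proof -
  obtain x y x' y' where xy: "x = z$1" "y = z$2" "x' = w$1" "y' = w$2" by blast
  have circ: "x\<^sup>2 + y\<^sup>2 = 1" "x'\<^sup>2 + y'\<^sup>2 = 1"
    using assms(1,2) by (auto simp: S1_def sw_def xy)
  define s where "s = sqrt ((x - x')\<^sup>2 + (y - y')\<^sup>2) / 2"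
  have pos: "(x - x')\<^sup>2 + (y - y')\<^sup>2 > 0"
    using assms(4) by (auto simp: plane_eq_iff xy sum_power2_gt_zero_iff)
  then have s: "s > 0" by (simp add: s_def)
  have s2: "4 * s\<^sup>2 = (x - x')\<^sup>2 + (y - y')\<^sup>2"
    using pos by (simp add: s_def power_divide)
  \<comment> \<open>The unit vector comes from the direction of the chord rather than from its
    midpoint, which would be zero for antipodal points.\<close>
  define a b where "a = (y - y') / (2 * s)" and "b = (x' - x) / (2 * s)"
  define c where "c = (x + x') / 2 * a + (y + y') / 2 * b"
  have d: "y - y' = 2 * s * a" "x - x' = - 2 * s * b"
    using s by (simp_all add: a_def b_def)
  have ab: "a\<^sup>2 + b\<^sup>2 = 1"
  proof -
    have "4 * s\<^sup>2 * (a\<^sup>2 + b\<^sup>2) = 4 * s\<^sup>2"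
      by (subst (2) s2, subst d, subst d) (simp add: power2_eq_square algebra_simps)
    then show ?thesis using s by simp
  qed
  have orth: "(x + x') * b = (y + y') * a"
  proof -
    have "2 * s * ((y + y') * a - (x + x') * b) = (y + y') * (y - y') + (x + x') * (x - x')"
      by (simp add: d algebra_simps)
    also have "\<dots> = 0" using circ by (simp add: power2_eq_square algebra_simps)
    finally show ?thesis using s by simp
  qed
  have m: "x + x' = 2 * c * a" "y + y' = 2 * c * b"
  proof -
    have c2: "2 * c = (x + x') * a + (y + y') * b"
      by (simp add: c_def field_simps)
    have "2 * c * a = (x + x') * a\<^sup>2 + ((y + y') * a) * b"
      unfolding c2 by (simp add: power2_eq_square algebra_simps)
    also have "\<dots> = (x + x') * (a\<^sup>2 + b\<^sup>2)"
      unfolding orth[symmetric] by (simp add: power2_eq_square algebra_simps)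
    finally show "x + x' = 2 * c * a" by (simp add: ab)
    have "2 * c * b = ((x + x') * b) * a + (y + y') * b\<^sup>2"
      unfolding c2 by (simp add: power2_eq_square algebra_simps)
    also have "\<dots> = (y + y') * (a\<^sup>2 + b\<^sup>2)"
      unfolding orth by (simp add: power2_eq_square algebra_simps)
    finally show "y + y' = 2 * c * b" by (simp add: ab)
  qed
  have e: "x = c * a - s * b" "x' = c * a + s * b" "y = c * b + s * a" "y' = c * b - s * a"
    using m d by linarith+
  have cs: "c\<^sup>2 + s\<^sup>2 = 1"
  proof -
    have "x\<^sup>2 + y\<^sup>2 = (c\<^sup>2 + s\<^sup>2) * (a\<^sup>2 + b\<^sup>2)"
      by (simp add: e power2_eq_square algebra_simps)
    then show ?thesis by (simp add: circ ab)
  qed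
  define k where "k = b\<^sup>2 - a\<^sup>2"
  have K: "15 * b + 57 * a = 10 * c * k"
  proof -
    have "HY z - HY w = 13 * ((x\<^sup>2 + y\<^sup>2) - (x'\<^sup>2 + y'\<^sup>2)) - 10 * (x * y - x' * y')
        + 15 * (x - x') - 57 * (y - y')"
      by (simp add: HY_def xy algebra_simps)
    also have "\<dots> = 2 * s * (10 * c * k - 15 * b - 57 * a)"
      unfolding circ by (simp add: e k_def power2_eq_square algebra_simps)
    finally show ?thesis using assms(3) s by simp
  qed
  define W where "W = 40 * c * a * b + 57 * b - 15 * a"
  have gz: "gg z = s * (W - 10 * s * k)"
  proof -
    have "gg z = 10 * (c\<^sup>2 - s\<^sup>2) * k + 40 * c * s * a * b - c * (15 * b + 57 * a) + s * (57 * b - 15 * a)"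
      by (simp add: gg_def xy[symmetric] e k_def power2_eq_square algebra_simps)
    then show ?thesis unfolding K by (simp add: W_def power2_eq_square algebra_simps)
  qed
  have gw: "gg w = s * (- W - 10 * s * k)"
  proof -
    have "gg w = 10 * (c\<^sup>2 - s\<^sup>2) * k - 40 * c * s * a * b - c * (15 * b + 57 * a) - s * (57 * b - 15 * a)"
      by (simp add: gg_def xy[symmetric] e k_def power2_eq_square algebra_simps)
    then show ?thesis unfolding K by (simp add: W_def power2_eq_square algebra_simps)
  qed
  have k1: "\<bar>k\<bar> \<le> 1" using ab zero_le_power2[of a] zero_le_power2[of b] unfolding k_def by linarith
  have c1: "\<bar>c\<bar> \<le> 1" using cs zero_le_power2[of s] unfolding abs_square_le_1[symmetric] by linarith
  have s1: "\<bar>s\<bar> \<le> 1" using cs zero_le_power2[of c] unfolding abs_square_le_1[symmetric] by linarith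
  have ab1: "\<bar>2 * a * b\<bar> \<le> 1"
    using ab sum_squares_bound[of a b] sum_squares_bound[of a "- b"] by (simp add: abs_le_iff)
  have ck: "\<bar>c * k\<bar> \<le> 1" using mult_mono[OF c1 k1] by (simp add: abs_mult)
  have sk: "\<bar>s * k\<bar> \<le> 1" using mult_mono[OF s1 k1] by (simp add: abs_mult)
  have cab: "\<bar>c * (2 * a * b)\<bar> \<le> 1" using mult_mono[OF c1 ab1] by (simp add: abs_mult)
  \<comment> \<open>Since 15^2 + 57^2 = 3474, the two linear forms in (a, b) share a fixed sum of
    squares; \<open>K\<close> makes one small, so the other exceeds 50. Against it stand at most 20
    from \<open>40 * c * a * b\<close> and 10 from \<open>10 * s * k\<close>.\<close>
  have "(57 * b - 15 * a)\<^sup>2 = 3474 * (a\<^sup>2 + b\<^sup>2) - (15 * b + 57 * a)\<^sup>2"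
    by (simp add: power2_eq_square algebra_simps)
  also have "\<dots> = 3474 - 100 * (c * k)\<^sup>2"
    by (simp add: ab K power_mult_distrib)
  also have "\<dots> \<ge> 3374"
    using ck abs_le_square_iff[of "c * k" 1] by simp
  finally have "50\<^sup>2 < (57 * b - 15 * a)\<^sup>2" by simp
  then have big: "\<bar>57 * b - 15 * a\<bar> > 50"
    using abs_le_square_iff[of "57 * b - 15 * a" 50] by linarith
  have W: "\<bar>W\<bar> > 10" using big cab unfolding W_def by linarith
  have "gg z * gg w = s\<^sup>2 * ((10 * (s * k))\<^sup>2 - W\<^sup>2)"
    by (simp add: gz gw power2_eq_square algebra_simps)
  moreover have "(10 * (s * k))\<^sup>2 < W\<^sup>2"
    using W sk abs_le_square_iff[of W "10 * (s * k)"] by linarith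
  ultimately show ?thesis using s by (simp add: mult_pos_neg)
qed

lemma gg_left:
  assumes "z \<in> S1" "z$1 \<le> - 1/10"
  shows "gg z > 0"
proof -
  have circ: "(z$1)\<^sup>2 + (z$2)\<^sup>2 = 1" using assms(1) by (simp add: S1_def sw_def)
  then have "(z$2)\<^sup>2 \<le> 1" "(z$1)\<^sup>2 \<le> 1"
    using zero_le_power2[of "z$1"] zero_le_power2[of "z$2"] by linarith+
  then have y: "z$2 \<le> 1" and x: "z$1 \<ge> -1"
    by (auto simp: abs_square_le_1)
  have "gg z = 10 - 20 * (z$1)\<^sup>2 - 15 * z$2 - 57 * z$1"
    using circ by (simp add: gg_def)
  \<comment> \<open>Between -1 and -1/10 this bounds the square by its chord and leaves gg >= -3 -
    35 x, which is positive.\<close>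
  moreover have "(z$1 + 1/10) * (z$1 + 1) \<le> 0"
    using assms(2) x by (intro mult_nonpos_nonneg) auto
  moreover have "(z$1 + 1/10) * (z$1 + 1) = (z$1)\<^sup>2 + 11/10 * z$1 + 1/10"
    by (simp add: power2_eq_square field_simps)
  ultimately show ?thesis using y assms(2) by linarith
qed

section \<open>Monotonicity of \<open>HY\<close> on the upper half circle\<close>

definition upper :: "real \<Rightarrow> plane" where
  "upper x = vector [x, sqrt (1 - x\<^sup>2)]"

lemma upper_nth [simp]: "upper x $ 1 = x" "upper x $ 2 = sqrt (1 - x\<^sup>2)"
  by (simp_all add: upper_def)

lemma upper_in_S1: "\<bar>x\<bar> \<le> 1 \<Longrightarrow> upper x \<in> S1"
  by (simp add: S1_def sw_def abs_square_le_1)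

lemma S1_upper:
  assumes "z \<in> S1" "z$2 > 0"
  shows "z = upper (z$1)" "\<bar>z$1\<bar> < 1"
proof -
  have circ: "(z$2)\<^sup>2 = 1 - (z$1)\<^sup>2" using assms(1) by (simp add: S1_def sw_def)
  then show "z = upper (z$1)" using assms(2) by (simp add: plane_eq_iff circ[symmetric])
  have "(z$2)\<^sup>2 > 0" using assms(2) by simp
  with circ show "\<bar>z$1\<bar> < 1" by (simp add: abs_square_less_1[symmetric])
qed

text \<open>Chain rule through the angle, whose derivative in x on the upper half circle is -1 /
  sqrt(1 - x^2).\<close>

lemma HY_upper_derivative:
  assumes "\<bar>x\<bar> < 1"
  shows "((\<lambda>x. HY (upper x)) has_real_derivative - gg (upper x) / sqrt (1 - x\<^sup>2)) (at x)"
proof -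
  have pos: "1 - x\<^sup>2 > 0" using assms by (simp add: abs_square_less_1)
  define s where "s = sqrt (1 - x\<^sup>2)"
  have s: "s > 0" "s * s = 1 - x\<^sup>2" using pos by (simp_all add: s_def)
  define r where "r = x / s"
  have rs: "r * s = x" using s by (simp add: r_def)
  define f where "f x = sqrt (1 - x\<^sup>2)" for x :: real
  have "f x = s" by (simp add: f_def s_def)
  have f: "(f has_real_derivative (- r)) (at x)"
    unfolding f_def[abs_def] using pos by (auto intro!: derivative_eq_intros simp: r_def s_def field_simps)
  have "((\<lambda>x. 13 * (x\<^sup>2 + (f x)\<^sup>2) - 10 * x * f x + 15 * x - 57 * f x) has_real_derivative
      13 * (2 * x + 2 * s * (- r)) - (10 * s + 10 * x * (- r)) + 15 - 57 * (- r)) (at x)"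
    by (rule derivative_eq_intros f refl)+ (simp add: \<open>f x = s\<close>)
  moreover have "(\<lambda>x. HY (upper x)) = (\<lambda>x. 13 * (x\<^sup>2 + (f x)\<^sup>2) - 10 * x * f x + 15 * x - 57 * f x)"
    by (simp add: HY_def f_def fun_eq_iff)
  ultimately have D: "((\<lambda>x. HY (upper x)) has_real_derivative
      13 * (2 * x + 2 * s * (- r)) - (10 * s + 10 * x * (- r)) + 15 - 57 * (- r)) (at x)"
    by simp
  have "(13 * (2 * x + 2 * s * (- r)) - (10 * s + 10 * x * (- r)) + 15 - 57 * (- r)) * s
     = 26 * x * s - 26 * s * (r * s) - 10 * (s * s) + 10 * x * (r * s) + 15 * s + 57 * (r * s)"
    by (simp add: algebra_simps)
  moreover have "gg (upper x) = 10 * (s * s - x * x) - 15 * s - 57 * x"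
    by (simp only: gg_def upper_nth s_def power2_eq_square)
  ultimately have "(13 * (2 * x + 2 * s * (- r)) - (10 * s + 10 * x * (- r)) + 15 - 57 * (- r)) * s = - gg (upper x)"
    unfolding rs by (simp add: algebra_simps)
  then have "13 * (2 * x + 2 * s * (- r)) - (10 * s + 10 * x * (- r)) + 15 - 57 * (- r) = - gg (upper x) / s"
    using s(1) by (intro nonzero_eq_divide_eq[THEN iffD2]) auto
  then show ?thesis using D by (simp add: s_def)
qed

lemma HY_decreasing_left:
  assumes "z \<in> S1" "w \<in> S1" "z$2 > 0" "w$2 > 0" "z$1 < w$1" "w$1 \<le> - 1/10"
  shows "HY z > HY w"
proof -
  have "HY (upper (z$1)) > HY (upper (w$1))"
  proof (rule DERIV_neg_imp_decreasing[OF assms(5)])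
    fix x assume x: "z$1 \<le> x" "x \<le> w$1"
    then have x1: "\<bar>x\<bar> < 1" using S1_upper(2)[OF assms(1,3)] S1_upper(2)[OF assms(2,4)] by linarith
    then have "gg (upper x) > 0" using x assms(6) by (intro gg_left upper_in_S1) auto
    moreover have "1 - x\<^sup>2 > 0" using x1 by (simp add: abs_square_less_1)
    ultimately show "\<exists>y. ((\<lambda>x. HY (upper x)) has_real_derivative y) (at x) \<and> y < 0"
      using HY_upper_derivative[OF x1] by (intro exI conjI) auto
  qed
  then show ?thesis using S1_upper(1) assms by metis
qed

text \<open>Makes every point to the right of an exit point on the upper half circle an exit point
  too. For nonnegative abscissa \<open>gg\<close> is negative outright; for abscissae in (-1/10, 0)
  the term -57 x outweighs any growth of -20 x^2, and the root term only helps.\<close>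

lemma gg_upper_neg_mono:
  assumes "-1/10 < x" "x \<le> y" "y < 1" "gg (upper x) < 0"
  shows "gg (upper y) < 0"
proof -
  have gg: "gg (upper t) = 10 - 20 * t\<^sup>2 - 15 * sqrt (1 - t\<^sup>2) - 57 * t" if "\<bar>t\<bar> < 1" for t
  proof -
    have "t\<^sup>2 \<le> 1" using that by (simp add: abs_square_le_1)
    then show ?thesis by (simp add: gg_def)
  qed
  show ?thesis
  proof (cases "y \<ge> 0")
    case True
    have "y\<^sup>2 \<le> y" using True assms(3) by (simp add: power2_eq_square mult_left_le)
    then have "(1 - y)\<^sup>2 \<le> 1 - y\<^sup>2" by (simp add: power2_eq_square algebra_simps)
    then have "1 - y \<le> sqrt (1 - y\<^sup>2)" by (rule real_le_rsqrt)
    moreover have "gg (upper y) = 10 - 20 * y\<^sup>2 - 15 * sqrt (1 - y\<^sup>2) - 57 * y"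
      using gg[of y] True assms(3) by simp
    moreover have "y\<^sup>2 \<ge> 0" by simp
    ultimately show ?thesis using True by linarith
  next
    case False
    have "0 \<le> (y - x) * (- x - y)" using False assms by (intro mult_nonneg_nonneg) auto
    then have yx: "y\<^sup>2 \<le> x\<^sup>2" by (simp add: power2_eq_square algebra_simps)
    have "(y - x) * (- x - y) \<le> (y - x) * 1" using False assms by (intro mult_left_mono) auto
    then have "x\<^sup>2 - y\<^sup>2 \<le> y - x" by (simp add: power2_eq_square algebra_simps)
    moreover have "sqrt (1 - x\<^sup>2) \<le> sqrt (1 - y\<^sup>2)" using yx by simp
    moreover have "gg (upper x) = 10 - 20 * x\<^sup>2 - 15 * sqrt (1 - x\<^sup>2) - 57 * x"
      "gg (upper y) = 10 - 20 * y\<^sup>2 - 15 * sqrt (1 - y\<^sup>2) - 57 * y"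
      using gg[of x] gg[of y] False assms by simp_all
    ultimately show ?thesis using assms(2,4) by linarith
  qed
qed

lemma HY_increasing_right:
  assumes "z \<in> S1" "w \<in> S1" "z$2 > 0" "w$2 > 0" "-1/10 < z$1" "z$1 < w$1" "gg z < 0"
  shows "HY z < HY w"
proof -
  have "HY (upper (z$1)) < HY (upper (w$1))"
  proof (rule DERIV_pos_imp_increasing[OF assms(6)])
    fix x assume x: "z$1 \<le> x" "x \<le> w$1"
    then have x1: "\<bar>x\<bar> < 1" using S1_upper(2)[OF assms(1,3)] S1_upper(2)[OF assms(2,4)] by linarith
    have "gg (upper x) < 0"
      using gg_upper_neg_mono[of "z$1" x] S1_upper(1)[OF assms(1,3)] x x1 assms(5,7) by simp
    moreover have "1 - x\<^sup>2 > 0" using x1 by (simp add: abs_square_less_1)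
    ultimately have "- gg (upper x) / sqrt (1 - x\<^sup>2) > 0" by (intro divide_pos_pos) auto
    then show "\<exists>y. ((\<lambda>x. HY (upper x)) has_real_derivative y) (at x) \<and> y > 0"
      using HY_upper_derivative[OF x1] by blast
  qed
  then show ?thesis using S1_upper(1) assms by metis
qed

section \<open>Passages through the circle\<close>

text \<open>Up to positive factors the two inequalities say that \<open>lie_sw X0\<close> and
  \<open>lie_sw Y0\<close> are negative; the sign of \<open>gg\<close> is opposite to that of
  \<open>lie_sw Y0\<close>.\<close>

definition entry_point :: "plane \<Rightarrow> bool" where
  "entry_point z \<longleftrightarrow> z \<in> S1 \<and> z$2 * (z$1 + 1/10) < 0 \<and> gg z > 0"

definition exit_point :: "plane \<Rightarrow> bool" where
  "exit_point z \<longleftrightarrow> z \<in> S1 \<and> z$2 * (z$1 + 1/10) > 0 \<and> gg z < 0"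

lemma crossing_region_iff: "z \<in> crossing_region X0 Y0 \<longleftrightarrow> entry_point z \<or> exit_point z"
  by (auto simp: crossing_region_def lie_X0 lie_Y0 entry_point_def exit_point_def
      mult_less_0_iff zero_less_mult_iff mult.assoc)

lemma entry_not_exit: "entry_point z \<Longrightarrow> \<not> exit_point z"
  by (simp add: entry_point_def exit_point_def)

lemma filippov_entry_point:
  assumes "filippov_trajectory X0 Y0 \<gamma>" "entry_point (\<gamma> t)"
  shows "\<exists>d>0. \<forall>s. 0 < s \<and> s < d \<longrightarrow> sw (\<gamma> (t - s)) > 0 \<and> sw (\<gamma> (t + s)) < 0"
  by (rule filippov_entry[OF assms(1)])
     (use assms(2) in \<open>auto simp: entry_point_def lie_X0 lie_Y0 mult.assoc\<close>)

lemma filippov_exit_point: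
  assumes "filippov_trajectory X0 Y0 \<gamma>" "exit_point (\<gamma> t)"
  shows "\<exists>d>0. \<forall>s. 0 < s \<and> s < d \<longrightarrow> sw (\<gamma> (t - s)) < 0 \<and> sw (\<gamma> (t + s)) > 0"
  by (rule filippov_exit[OF assms(1)])
     (use assms(2) in \<open>auto simp: exit_point_def lie_X0 lie_Y0 mult.assoc\<close>)

text \<open>Built on the Filippov inclusion rather than on \<open>crossing_trajectory\<close>,
  because the competitors in the isolation condition are only known to satisfy the former.\<close>

definition transversal :: "(real \<Rightarrow> plane) \<Rightarrow> bool" where
  "transversal \<gamma> \<longleftrightarrow> filippov_trajectory X0 Y0 \<gamma> \<and>
     (\<forall>t. \<gamma> t \<in> S1 \<longrightarrow> \<gamma> t \<in> crossing_region X0 Y0)"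

lemma transversal_filippov: "transversal \<gamma> \<Longrightarrow> filippov_trajectory X0 Y0 \<gamma>"
  by (simp add: transversal_def)

lemma transversal_cases:
  assumes "transversal \<gamma>" "sw (\<gamma> t) = 0"
  shows "entry_point (\<gamma> t) \<or> exit_point (\<gamma> t)"
  using assms by (auto simp: transversal_def crossing_region_iff S1_def)

lemma filippov_sw_continuous:
  "filippov_trajectory X Y \<gamma> \<Longrightarrow> continuous_on UNIV (\<lambda>t. sw (\<gamma> t))"
  by (intro continuous_intros filippov_trajectory_continuous_on)

lemma outside_before_imp_entry:
  assumes "transversal \<gamma>" "a < b" "sw (\<gamma> b) = 0" "\<And>s. a < s \<Longrightarrow> s < b \<Longrightarrow> sw (\<gamma> s) > 0"
  shows "entry_point (\<gamma> b)"
proof (rule ccontr)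
  assume "\<not> entry_point (\<gamma> b)"
  then have "exit_point (\<gamma> b)" using transversal_cases[OF assms(1,3)] by blast
  then obtain d where d: "d > 0" "\<forall>s. 0 < s \<and> s < d \<longrightarrow> sw (\<gamma> (b - s)) < 0"
    using filippov_exit_point transversal_filippov[OF assms(1)] by metis
  obtain s where s: "0 < s" "s < d" "s < b - a" using d(1) assms(2) dense[of 0 "min d (b - a)"] by auto
  then show False using d(2) assms(4)[of "b - s"] by force
qed

lemma inside_before_imp_exit:
  assumes "transversal \<gamma>" "a < b" "sw (\<gamma> b) = 0" "\<And>s. a < s \<Longrightarrow> s < b \<Longrightarrow> sw (\<gamma> s) < 0"
  shows "exit_point (\<gamma> b)"
proof (rule ccontr)
  assume "\<not> exit_point (\<gamma> b)"
  then have "entry_point (\<gamma> b)" using transversal_cases[OF assms(1,3)] by blast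
  then obtain d where d: "d > 0" "\<forall>s. 0 < s \<and> s < d \<longrightarrow> sw (\<gamma> (b - s)) > 0"
    using filippov_entry_point transversal_filippov[OF assms(1)] by metis
  obtain s where s: "0 < s" "s < d" "s < b - a" using d(1) assms(2) dense[of 0 "min d (b - a)"] by auto
  then show False using d(2) assms(4)[of "b - s"] by force
qed

lemma outside_after_imp_exit:
  assumes "transversal \<gamma>" "a < b" "sw (\<gamma> a) = 0" "\<And>s. a < s \<Longrightarrow> s < b \<Longrightarrow> sw (\<gamma> s) > 0"
  shows "exit_point (\<gamma> a)"
proof (rule ccontr)
  assume "\<not> exit_point (\<gamma> a)"
  then have "entry_point (\<gamma> a)" using transversal_cases[OF assms(1,3)] by blast
  then obtain d where d: "d > 0" "\<forall>s. 0 < s \<and> s < d \<longrightarrow> sw (\<gamma> (a + s)) < 0"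
    using filippov_entry_point transversal_filippov[OF assms(1)] by metis
  obtain s where s: "0 < s" "s < d" "s < b - a" using d(1) assms(2) dense[of 0 "min d (b - a)"] by auto
  then show False using d(2) assms(4)[of "a + s"] by force
qed

lemma inside_after_imp_entry:
  assumes "transversal \<gamma>" "a < b" "sw (\<gamma> a) = 0" "\<And>s. a < s \<Longrightarrow> s < b \<Longrightarrow> sw (\<gamma> s) < 0"
  shows "entry_point (\<gamma> a)"
proof (rule ccontr)
  assume "\<not> entry_point (\<gamma> a)"
  then have "exit_point (\<gamma> a)" using transversal_cases[OF assms(1,3)] by blast
  then obtain d where d: "d > 0" "\<forall>s. 0 < s \<and> s < d \<longrightarrow> sw (\<gamma> (a + s)) > 0"
    using filippov_exit_point transversal_filippov[OF assms(1)] by metis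
  obtain s where s: "0 < s" "s < d" "s < b - a" using d(1) assms(2) dense[of 0 "min d (b - a)"] by auto
  then show False using d(2) assms(4)[of "a + s"] by force
qed

lemma outside_arc:
  assumes "filippov_trajectory X0 Y0 \<gamma>" "a \<le> t" "t \<le> b" "\<And>s. a < s \<Longrightarrow> s < b \<Longrightarrow> sw (\<gamma> s) > 0"
  shows "\<gamma> t = flowY (t - a) (\<gamma> a)"
  using solution_Y0[OF filippov_trajectory_outside[OF assms(1,4)] assms(2,3)] by blast

lemma inside_arc:
  assumes "filippov_trajectory X0 Y0 \<gamma>" "a \<le> t" "t \<le> b" "\<And>s. a < s \<Longrightarrow> s < b \<Longrightarrow> sw (\<gamma> s) < 0"
  shows "\<gamma> t = flowX (t - a) (\<gamma> a)"
  using solution_X0[OF filippov_trajectory_inside[OF assms(1,4)] assms(2,3)] by blast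

lemma next_entry:
  assumes "transversal \<gamma>" "exit_point (\<gamma> t)" "u > t" "sw (\<gamma> u) \<le> 0"
  obtains t' where "t < t'" "entry_point (\<gamma> t')" "HY (\<gamma> t') = HY (\<gamma> t)"
proof -
  note fil = transversal_filippov[OF assms(1)]
  obtain d where d: "d > 0" "\<forall>s. 0 < s \<and> s < d \<longrightarrow> sw (\<gamma> (t - s)) < 0 \<and> sw (\<gamma> (t + s)) > 0"
    using filippov_exit_point[OF fil assms(2)] by blast
  obtain t' where t': "t < t'" "sw (\<gamma> t') = 0" "\<And>s. t < s \<Longrightarrow> s < t' \<Longrightarrow> sw (\<gamma> s) > 0"
    by (rule next_zero[OF filippov_sw_continuous[OF fil] d(1) _ assms(3,4)]) (use d(2) in auto)
  have "\<gamma> t' = flowY (t' - t) (\<gamma> t)" by (rule outside_arc[OF fil _ order_refl]) (use t' in auto)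
  then show ?thesis using that[OF t'(1) outside_before_imp_entry[OF assms(1) t']] by simp
qed

lemma previous_exit:
  assumes "transversal \<gamma>" "entry_point (\<gamma> t)" "u < t" "sw (\<gamma> u) \<le> 0"
  obtains t' where "t' < t" "exit_point (\<gamma> t')" "HY (\<gamma> t') = HY (\<gamma> t)"
proof -
  note fil = transversal_filippov[OF assms(1)]
  obtain d where d: "d > 0" "\<forall>s. 0 < s \<and> s < d \<longrightarrow> sw (\<gamma> (t - s)) > 0 \<and> sw (\<gamma> (t + s)) < 0"
    using filippov_entry_point[OF fil assms(2)] by blast
  obtain t' where t': "t' < t" "sw (\<gamma> t') = 0" "\<And>s. t' < s \<Longrightarrow> s < t \<Longrightarrow> sw (\<gamma> s) > 0"
    by (rule previous_zero[OF filippov_sw_continuous[OF fil] d(1) _ assms(3,4)]) (use d(2) in auto)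
  have "\<gamma> t = flowY (t - t') (\<gamma> t')" by (rule outside_arc[OF fil _ order_refl]) (use t' in auto)
  then show ?thesis using that[OF t'(1) outside_after_imp_exit[OF assms(1) t']] by simp
qed

lemma next_exit:
  assumes "transversal \<gamma>" "entry_point (\<gamma> t)" "u > t" "sw (\<gamma> u) \<ge> 0"
  obtains t' where "t < t'" "exit_point (\<gamma> t')" "\<gamma> t' = flowX (t' - t) (\<gamma> t)"
proof -
  note fil = transversal_filippov[OF assms(1)]
  obtain d where d: "d > 0" "\<forall>s. 0 < s \<and> s < d \<longrightarrow> sw (\<gamma> (t - s)) > 0 \<and> sw (\<gamma> (t + s)) < 0"
    using filippov_entry_point[OF fil assms(2)] by blast
  have c: "continuous_on UNIV (\<lambda>t. - sw (\<gamma> t))"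
    by (intro continuous_intros filippov_trajectory_continuous_on[OF fil])
  obtain t' where t': "t < t'" "- sw (\<gamma> t') = 0" "\<And>s. t < s \<Longrightarrow> s < t' \<Longrightarrow> - sw (\<gamma> s) > 0"
    by (rule next_zero[OF c d(1) _ assms(3)]) (use d(2) assms(4) in auto)
  then have t'': "sw (\<gamma> t') = 0" "\<And>s. t < s \<Longrightarrow> s < t' \<Longrightarrow> sw (\<gamma> s) < 0" by auto
  have "\<gamma> t' = flowX (t' - t) (\<gamma> t)" by (rule inside_arc[OF fil _ order_refl]) (use t' t'' in auto)
  then show ?thesis using that[OF t'(1) inside_before_imp_exit[OF assms(1) t'(1) t'']] by simp
qed

lemma previous_entry:
  assumes "transversal \<gamma>" "exit_point (\<gamma> t)" "u < t" "sw (\<gamma> u) \<ge> 0"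
  obtains t' where "t' < t" "entry_point (\<gamma> t')" "\<gamma> t = flowX (t - t') (\<gamma> t')"
proof -
  note fil = transversal_filippov[OF assms(1)]
  obtain d where d: "d > 0" "\<forall>s. 0 < s \<and> s < d \<longrightarrow> sw (\<gamma> (t - s)) < 0 \<and> sw (\<gamma> (t + s)) > 0"
    using filippov_exit_point[OF fil assms(2)] by blast
  have c: "continuous_on UNIV (\<lambda>t. - sw (\<gamma> t))"
    by (intro continuous_intros filippov_trajectory_continuous_on[OF fil])
  obtain t' where t': "t' < t" "- sw (\<gamma> t') = 0" "\<And>s. t' < s \<Longrightarrow> s < t \<Longrightarrow> - sw (\<gamma> s) > 0"
    by (rule previous_zero[OF c d(1) _ assms(3)]) (use d(2) assms(4) in auto)
  then have t'': "sw (\<gamma> t') = 0" "\<And>s. t' < s \<Longrightarrow> s < t \<Longrightarrow> sw (\<gamma> s) < 0" by auto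
  have "\<gamma> t = flowX (t - t') (\<gamma> t')" by (rule inside_arc[OF fil _ order_refl]) (use t' t'' in auto)
  then show ?thesis using that[OF t'(1) inside_after_imp_entry[OF assms(1) t'(1) t'']] by simp
qed

section \<open>The return map\<close>

lemma S1_coords: "z \<in> S1 \<Longrightarrow> (z$1)\<^sup>2 + (z$2)\<^sup>2 = 1"
  by (simp add: S1_def sw_def)

lemma exit_point_right: "exit_point z \<Longrightarrow> z$1 > - 1/10"
  using gg_left[of z] by (force simp: exit_point_def)

lemma exit_point_upper: "exit_point z \<Longrightarrow> z$2 > 0"
  using exit_point_right[of z] by (auto simp: exit_point_def zero_less_mult_iff)

text \<open>The value 3/5 is the abscissa of the lower point of the circle on the stable line of the
  saddle; the sign of \<open>gg\<close> keeps lower entry points to its left.\<close>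

lemma entry_point_lower:
  assumes "entry_point z" "z$2 < 0"
  shows "z$1 > - 1/10" "z$1 < 3/5"
proof -
  show x: "z$1 > - 1/10" using assms by (auto simp: entry_point_def mult_less_0_iff)
  show "z$1 < 3/5"
  proof (rule ccontr)
    assume "\<not> z$1 < 3/5"
    then have x: "z$1 \<ge> 3/5" by simp
    have circ: "(z$1)\<^sup>2 + (z$2)\<^sup>2 = 1" using assms(1) S1_coords by (simp add: entry_point_def)
    have x2: "(z$1)\<^sup>2 \<ge> (3/5)\<^sup>2" using x by (intro power_mono) auto
    then have "(z$2)\<^sup>2 \<le> (4/5)\<^sup>2" using circ by (simp add: power2_eq_square)
    then have "\<bar>z$2\<bar> \<le> 4/5" using abs_le_square_iff[of "z$2" "4/5"] by simp
    moreover have "gg z = 10 - 20 * (z$1)\<^sup>2 - 15 * z$2 - 57 * z$1"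
      using circ by (simp add: gg_def)
    ultimately have "gg z < 0" using x x2 by (simp add: power2_eq_square)
    then show False using assms(1) by (simp add: entry_point_def)
  qed
qed

text \<open>An arc that enters from below stays in the sector \<open>uu < 0 < vv\<close>, where the
  second coordinate is negative, whereas exits lie on the upper half circle. For an arc from above,
  the alternative of equal abscissae fails because -1/10 separates entry from exit.\<close>

lemma X_arc_geometry:
  assumes "entry_point z" "exit_point (flowX t z)"
  shows "z$2 > 0" "z$1 < - 1/10" "flowX t z $ 1 = - 1/5 - z$1" "uu z > 0"
proof -
  define w where "w = flowX t z"
  have w: "w$1 > - 1/10" "w$2 > 0" "w \<in> S1"
    using assms(2) exit_point_right exit_point_upper by (auto simp: w_def exit_point_def)
  have z: "z \<in> S1" "z$2 \<noteq> 0" using assms(1) by (auto simp: entry_point_def)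
  have uv: "uu w * vv w = uu z * vv z" by (simp add: w_def exp_minus)
  have level: "w$1 = z$1 \<or> z$1 + w$1 = - 1/5"
    by (rule S1_level_uu_vv[OF z(1) w(3) uv[symmetric]])
  show up: "z$2 > 0"
  proof (rule ccontr)
    assume "\<not> z$2 > 0"
    then have neg: "z$2 < 0" using z(2) by simp
    note x = entry_point_lower[OF assms(1) neg]
    \<comment> \<open>On the circle, twice this product is \<open>uu z * vv z\<close>; its roots are
      abscissae of points on the separatrix lines.\<close>
    have "(z$1 - 3/5) * (z$1 + 4/5) < 0" using x by (intro mult_neg_pos) auto
    then have "uu z * vv z < 0"
      using sw_uu_vv[of z] z(1) by (simp add: S1_def power2_eq_square algebra_simps)
    moreover have "uu z < vv z" using neg by (simp add: uu_def vv_def)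
    ultimately have "uu z < 0" "vv z > 0" by (auto simp: mult_less_0_iff)
    then have "uu w < 0" "vv w > 0" by (simp_all add: w_def mult_neg_pos)
    then show False using w(2) by (simp add: uu_def vv_def)
  qed
  show left: "z$1 < - 1/10"
    using assms(1) up by (auto simp: entry_point_def mult_less_0_iff)
  show "flowX t z $ 1 = - 1/5 - z$1"
    using level left w(1) by (auto simp: w_def)
  have "uu w > 0" using w by (simp add: uu_def)
  then show "uu z > 0" by (simp add: w_def zero_less_mult_iff)
qed

text \<open>One arc of \<open>X0\<close> from \<open>z\<close> to \<open>w\<close> followed by one
  arc of \<open>Y0\<close> from \<open>w\<close> to \<open>z'\<close>, recorded through first
  integrals without times. The condition \<open>uu z > 0\<close> puts \<open>z\<close> on the side
  of the stable line from which the arc leaves to the right, and so excludes the homoclinic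
  chord.\<close>

definition return_step :: "plane \<Rightarrow> plane \<Rightarrow> bool" where
  "return_step z z' \<longleftrightarrow> z \<in> S1 \<and> z$2 > 0 \<and> z$1 < - 1/10 \<and> uu z > 0 \<and>
     z' \<in> S1 \<and> z'$2 > 0 \<and> z'$1 < - 1/10 \<and>
     (\<exists>w. exit_point w \<and> w$1 = - 1/5 - z$1 \<and> HY w = HY z')"

lemma S1_upper_eqI:
  assumes "z \<in> S1" "w \<in> S1" "z$2 > 0" "w$2 > 0" "z$1 = w$1"
  shows "z = w"
  using S1_upper(1)[OF assms(1,3)] S1_upper(1)[OF assms(2,4)] assms(5) by simp

text \<open>The reflection x -> -1/5 - x reverses the order, \<open>HY\<close> increases along exit
  points, and \<open>HY\<close> decreases along the left arc where \<open>z'\<close> lies: two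
  reversals cancel.\<close>

lemma return_step_mono:
  assumes "return_step z z'" "return_step y y'" "z$1 \<le> y$1"
  shows "z'$1 \<le> y'$1"
proof (rule ccontr)
  assume "\<not> z'$1 \<le> y'$1"
  then have "HY y' > HY z'"
    using assms by (intro HY_decreasing_left) (auto simp: return_step_def)
  moreover obtain w v where wv: "exit_point w" "w$1 = - 1/5 - z$1" "HY w = HY z'"
    "exit_point v" "v$1 = - 1/5 - y$1" "HY v = HY y'"
    using assms(1,2) unfolding return_step_def by blast
  moreover have "HY v \<le> HY w"
  proof (cases "v$1 = w$1")
    case True
    then have "v = w"
      using wv exit_point_upper by (intro S1_upper_eqI) (auto simp: exit_point_def)
    then show ?thesis by simp
  next
    case False
    then have "HY v < HY w"
      using wv assms(3) exit_point_upper[of v] exit_point_upper[of w] exit_point_right[of v]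
      by (intro HY_increasing_right) (auto simp: exit_point_def)
    then show ?thesis by simp
  qed
  ultimately show False by simp
qed

text \<open>Half the width of the chord at midpoint height 4/5: its half height difference is
  \<open>dc / 8\<close>, and the circle demands (1 + 1/64) dc^2 = 1 - 1/100 - 16/25.\<close>

definition dc :: real where "dc = sqrt (112 / 325)"

definition zc :: plane where "zc = vector [- 1/10 - dc, 4/5 - dc/8]"
definition wc :: plane where "wc = vector [- 1/10 + dc, 4/5 + dc/8]"

lemma dc_sq: "dc\<^sup>2 = 112/325" and dc_pos: "dc > 0"
  by (simp_all add: dc_def)

text \<open>For a chord whose midpoint is \<open>(-1/10, h)\<close>, equality of \<open>HY\<close> at the endpoints becomes
  \<open>(h - 7/10) (h - 4/5) = 0\<close>, and \<open>h = 7/10\<close> is the chord of the separatrices, where \<open>uu z = 0\<close>.\<close>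

lemma return_step_fixed:
  assumes "return_step z z"
  shows "z = zc"
proof -
  obtain w where w: "exit_point w" "w$1 = - 1/5 - z$1" "HY w = HY z"
    using assms by (auto simp: return_step_def)
  have z: "z \<in> S1" "z$2 > 0" "z$1 < - 1/10" "uu z > 0"
    using assms by (auto simp: return_step_def)
  define d h e where "d = - 1/10 - z$1" and "h = (z$2 + w$2) / 2" and "e = (w$2 - z$2) / 2"
  have d: "d > 0" using z by (simp add: d_def)
  have zw: "z$1 = - 1/10 - d" "w$1 = - 1/10 + d" "z$2 = h - e" "w$2 = h + e"
    using w(2) by (simp_all add: d_def h_def e_def field_simps)
  have h: "h > 0" using z(2) exit_point_upper[OF w(1)] by (simp add: h_def)
  have c1: "(- 1/10 - d)\<^sup>2 + (h - e)\<^sup>2 = 1" "(- 1/10 + d)\<^sup>2 + (h + e)\<^sup>2 = 1"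
    using S1_coords[OF z(1)] S1_coords[of w] w(1) by (simp_all add: zw exit_point_def)
  have he: "h * e = d / 10"
    using c1 by (simp add: power2_eq_square field_simps)
  have sum: "1/100 + d\<^sup>2 + h\<^sup>2 + e\<^sup>2 = 1"
    using c1 by (simp add: power2_eq_square field_simps)
  have "HY w - HY z = 13 * (((- 1/10 + d)\<^sup>2 + (h + e)\<^sup>2) - ((- 1/10 - d)\<^sup>2 + (h - e)\<^sup>2))
      - 20 * d * h + 30 * d - 112 * e"
    by (simp add: HY_def zw power2_eq_square field_simps)
  then have "- 20 * d * h + 30 * d - 112 * e = 0" using w(3) c1 by simp
  \<comment> \<open>The factor \<open>h\<close> turns the term in \<open>e\<close> into a multiple
    of \<open>h * e = d / 10\<close>, after which \<open>d\<close> factors out.\<close>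
  then have "h * (- 20 * d * h + 30 * d - 112 * e) = 0" by simp
  then have "- 20 * d * h\<^sup>2 + 30 * d * h - 112 * (h * e) = 0"
    by (simp add: power2_eq_square algebra_simps)
  then have "d * ((h - 7/10) * (h - 4/5)) = 0"
    unfolding he by (simp add: power2_eq_square field_simps)
  then have "h = 7/10 \<or> h = 4/5" using d by simp
  then show ?thesis
  proof
    assume h7: "h = 7/10"
    have e: "e = d / 7" using he[unfolded h7] by simp
    have "d\<^sup>2 = (7/10)\<^sup>2" using sum by (simp add: h7 e power2_eq_square field_simps)
    then have "d = 7/10" using d by (simp add: power2_eq_iff)
    then have "uu z = 0" by (simp add: uu_def zw e h7)
    then show ?thesis using z(4) by simp
  next
    assume h8: "h = 4/5"
    have e: "e = d / 8" using he[unfolded h8] by simp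
    have "d\<^sup>2 = 112/325" using sum by (simp add: h8 e power2_eq_square field_simps)
    then have "d\<^sup>2 = dc\<^sup>2" by (simp add: dc_sq)
    then have "d = dc" using d dc_pos by (simp add: power2_eq_iff)
    then show ?thesis by (simp add: plane_eq_iff zc_def zw e h8)
  qed
qed

section \<open>Periodic orbits\<close>

lemma periodic_int:
  fixes \<gamma> :: "real \<Rightarrow> 'a"
  assumes "\<And>t. \<gamma> (t + T) = \<gamma> t"
  shows "\<gamma> (t + of_int n * T) = \<gamma> t"
proof (induction n arbitrary: t rule: int_induct[of _ 0])
  case (step1 i)
  have "\<gamma> (t + of_int (i + 1) * T) = \<gamma> ((t + of_int i * T) + T)"
    by (simp add: algebra_simps)
  then show ?case using assms step1 by metis
next
  case (step2 i)
  have "\<gamma> (t + of_int (i - 1) * T) = \<gamma> ((t + of_int (i - 1) * T) + T)"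
    using assms by metis
  also have "\<dots> = \<gamma> (t + of_int i * T)" by (simp add: algebra_simps)
  finally show ?case using step2 by simp
qed simp

lemma periodic_shift:
  fixes \<gamma> :: "real \<Rightarrow> 'a"
  assumes "T > 0" "\<And>t. \<gamma> (t + T) = \<gamma> t"
  obtains s where "s > a" "\<gamma> s = \<gamma> t"
proof -
  obtain n :: int where "of_int n > (a - t) / T" using ex_less_of_int by blast
  then have "t + of_int n * T > a" using assms(1) by (simp add: pos_divide_less_eq)
  then show ?thesis using that periodic_int[of \<gamma> T] assms(2) by blast
qed

lemma periodic_shift_neg:
  fixes \<gamma> :: "real \<Rightarrow> 'a"
  assumes "T > 0" "\<And>t. \<gamma> (t + T) = \<gamma> t"
  obtains s where "s < a" "\<gamma> s = \<gamma> t"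
proof -
  obtain n :: int where "of_int n < (a - t) / T" using ex_of_int_less by blast
  then have "t + of_int n * T < a" using assms(1) by (simp add: pos_less_divide_eq)
  then show ?thesis using that periodic_int[of \<gamma> T] assms(2) by blast
qed

context
  fixes \<gamma> :: "real \<Rightarrow> plane" and T :: real
  assumes trans: "transversal \<gamma>" and T: "T > 0" and per: "\<And>t. \<gamma> (t + T) = \<gamma> t"
begin

text \<open>Just before an entry the curve is outside; periodicity brings that position back later,
  so the curve has to leave the disc again. The three companions below argue alike.\<close>

lemma periodic_next_exit:
  assumes "entry_point (\<gamma> t)"
  obtains t' where "t < t'" "exit_point (\<gamma> t')" "\<gamma> t' = flowX (t' - t) (\<gamma> t)"
proof -
  obtain d where "d > 0" "\<forall>s. 0 < s \<and> s < d \<longrightarrow> sw (\<gamma> (t - s)) > 0"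
    using filippov_entry_point[OF transversal_filippov[OF trans] assms] by blast
  then have "sw (\<gamma> (t - d/2)) > 0" by simp
  moreover obtain u where "u > t" "\<gamma> u = \<gamma> (t - d/2)" by (rule periodic_shift[of T \<gamma>, OF T per])
  ultimately show ?thesis using next_exit[OF trans assms] that by (metis less_imp_le)
qed

lemma periodic_next_entry:
  assumes "exit_point (\<gamma> t)"
  obtains t' where "t < t'" "entry_point (\<gamma> t')" "HY (\<gamma> t') = HY (\<gamma> t)"
proof -
  obtain d where "d > 0" "\<forall>s. 0 < s \<and> s < d \<longrightarrow> sw (\<gamma> (t - s)) < 0"
    using filippov_exit_point[OF transversal_filippov[OF trans] assms] by blast
  then have "sw (\<gamma> (t - d/2)) < 0" by simp
  moreover obtain u where "u > t" "\<gamma> u = \<gamma> (t - d/2)" by (rule periodic_shift[of T \<gamma>, OF T per])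
  ultimately show ?thesis using next_entry[OF trans assms] that by (metis less_imp_le)
qed

lemma periodic_previous_exit:
  assumes "entry_point (\<gamma> t)"
  obtains t' where "t' < t" "exit_point (\<gamma> t')" "HY (\<gamma> t') = HY (\<gamma> t)"
proof -
  obtain d where "d > 0" "\<forall>s. 0 < s \<and> s < d \<longrightarrow> sw (\<gamma> (t + s)) < 0"
    using filippov_entry_point[OF transversal_filippov[OF trans] assms] by blast
  then have "sw (\<gamma> (t + d/2)) < 0" by simp
  moreover obtain u where "u < t" "\<gamma> u = \<gamma> (t + d/2)" by (rule periodic_shift_neg[of T \<gamma>, OF T per])
  ultimately show ?thesis using previous_exit[OF trans assms] that by (metis less_imp_le)
qed

lemma periodic_previous_entry:
  assumes "exit_point (\<gamma> t)"
  obtains t' where "t' < t" "entry_point (\<gamma> t')" "\<gamma> t = flowX (t - t') (\<gamma> t')"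
proof -
  obtain d where "d > 0" "\<forall>s. 0 < s \<and> s < d \<longrightarrow> sw (\<gamma> (t + s)) > 0"
    using filippov_exit_point[OF transversal_filippov[OF trans] assms] by blast
  then have "sw (\<gamma> (t + d/2)) > 0" by simp
  moreover obtain u where "u < t" "\<gamma> u = \<gamma> (t + d/2)" by (rule periodic_shift_neg[of T \<gamma>, OF T per])
  ultimately show ?thesis using previous_entry[OF trans assms] that by (metis less_imp_le)
qed

lemma periodic_entry_upper:
  assumes "entry_point (\<gamma> t)"
  shows "\<gamma> t \<in> S1" "\<gamma> t $ 2 > 0" "\<gamma> t $ 1 < - 1/10" "uu (\<gamma> t) > 0"
proof -
  obtain t' where "exit_point (\<gamma> t')" "\<gamma> t' = flowX (t' - t) (\<gamma> t)"
    using periodic_next_exit[OF assms] by blast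
  then show "\<gamma> t $ 2 > 0" "\<gamma> t $ 1 < - 1/10" "uu (\<gamma> t) > 0"
    using X_arc_geometry[OF assms] by metis+
  show "\<gamma> t \<in> S1" using assms by (simp add: entry_point_def)
qed

lemma periodic_next_step:
  assumes "entry_point (\<gamma> t)"
  obtains t' where "entry_point (\<gamma> t')" "return_step (\<gamma> t) (\<gamma> t')"
proof -
  obtain s where s: "exit_point (\<gamma> s)" "\<gamma> s = flowX (s - t) (\<gamma> t)"
    using periodic_next_exit[OF assms] by blast
  obtain t' where t': "entry_point (\<gamma> t')" "HY (\<gamma> t') = HY (\<gamma> s)"
    using periodic_next_entry[OF s(1)] by blast
  have "\<gamma> s $ 1 = - 1/5 - \<gamma> t $ 1"
    using X_arc_geometry(3)[OF assms] s by metis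
  then have "return_step (\<gamma> t) (\<gamma> t')"
    using s(1) t' periodic_entry_upper[OF assms] periodic_entry_upper[OF t'(1)]
    unfolding return_step_def by (metis)
  then show ?thesis using that t' by blast
qed

lemma periodic_previous_step:
  assumes "entry_point (\<gamma> t)"
  obtains t' where "entry_point (\<gamma> t')" "return_step (\<gamma> t') (\<gamma> t)"
proof -
  obtain s where s: "exit_point (\<gamma> s)" "HY (\<gamma> s) = HY (\<gamma> t)"
    using periodic_previous_exit[OF assms] by blast
  obtain t' where t': "entry_point (\<gamma> t')" "\<gamma> s = flowX (s - t') (\<gamma> t')"
    using periodic_previous_entry[OF s(1)] by blast
  have "\<gamma> s $ 1 = - 1/5 - \<gamma> t' $ 1"
    using X_arc_geometry(3)[OF t'(1)] s(1) t'(2) by metis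
  then have "return_step (\<gamma> t') (\<gamma> t)"
    using s periodic_entry_upper[OF assms] periodic_entry_upper[OF t'(1)]
    unfolding return_step_def by metis
  then show ?thesis using that t' by blast
qed

lemma periodic_rightmost_entry:
  assumes "\<gamma> t0 \<in> S1"
  obtains t where "entry_point (\<gamma> t)" "\<And>s. entry_point (\<gamma> s) \<Longrightarrow> \<gamma> s $ 1 \<le> \<gamma> t $ 1"
proof -
  note fil = transversal_filippov[OF trans]
  \<comment> \<open>The weak inequality keeps the set closed, yet still selects only entries: exits
    satisfy the strict opposite one, and by transversality no circle point on the curve gives
    equality. One period makes it compact.\<close>
  define K where "K = {0..T} \<inter> {t. sw (\<gamma> t) = 0 \<and> \<gamma> t $ 2 * (\<gamma> t $ 1 + 1/10) \<le> 0}"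
  have cont: "continuous_on UNIV \<gamma>" by (rule filippov_trajectory_continuous_on[OF fil])
  have "closed {t. sw (\<gamma> t) = 0 \<and> \<gamma> t $ 2 * (\<gamma> t $ 1 + 1/10) \<le> 0}"
    by (intro closed_Collect_conj closed_Collect_eq closed_Collect_le continuous_intros cont)
  then have comp: "compact K" unfolding K_def by (intro compact_Int_closed) auto
  have inK: "\<exists>s'\<in>K. \<gamma> s' = \<gamma> s" if "entry_point (\<gamma> s)" for s
  proof
    have eq: "\<gamma> (s + of_int (- \<lfloor>s / T\<rfloor>) * T) = \<gamma> s" by (rule periodic_int[of \<gamma> T, OF per])
    show "\<gamma> (s + of_int (- \<lfloor>s / T\<rfloor>) * T) = \<gamma> s" by (rule eq)
    have "of_int \<lfloor>s / T\<rfloor> * T \<le> s" "s < (of_int \<lfloor>s / T\<rfloor> + 1) * T"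
      using T floor_divide_lower floor_divide_upper by blast+
    then show "s + of_int (- \<lfloor>s / T\<rfloor>) * T \<in> K"
      unfolding K_def using that eq by (auto simp: entry_point_def S1_def algebra_simps)
  qed
  have K_entry: "entry_point (\<gamma> t)" if "t \<in> K" for t
    using transversal_cases[OF trans, of t] that by (auto simp: K_def exit_point_def)
  have "\<exists>s. entry_point (\<gamma> s)"
    using transversal_cases[OF trans, of t0] assms periodic_next_entry by (metis S1_def mem_Collect_eq)
  then have "K \<noteq> {}" using inK by blast
  moreover have "continuous_on K (\<lambda>t. \<gamma> t $ 1)"
    by (intro continuous_intros continuous_on_subset[OF cont]) auto
  ultimately obtain t where t: "t \<in> K" "\<forall>s\<in>K. \<gamma> s $ 1 \<le> \<gamma> t $ 1"
    using continuous_attains_sup[OF comp] by blast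
  show ?thesis
  proof (rule that[OF K_entry[OF t(1)]])
    fix s assume "entry_point (\<gamma> s)"
    then show "\<gamma> s $ 1 \<le> \<gamma> t $ 1" using inK t(2) by metis
  qed
qed

lemma periodic_through_zc:
  assumes "\<gamma> t0 \<in> S1"
  obtains t where "\<gamma> t = zc"
proof -
  obtain t where t: "entry_point (\<gamma> t)" and max: "\<And>s. entry_point (\<gamma> s) \<Longrightarrow> \<gamma> s $ 1 \<le> \<gamma> t $ 1"
    using periodic_rightmost_entry[OF assms] by blast
  obtain a where a: "entry_point (\<gamma> a)" "return_step (\<gamma> a) (\<gamma> t)" using periodic_previous_step[OF t] by blast
  obtain b where b: "entry_point (\<gamma> b)" "return_step (\<gamma> t) (\<gamma> b)" using periodic_next_step[OF t] by blast
  \<comment> \<open>The step from a to t is compared with the step from t to b; maximality of t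
    supplies both the hypothesis and the reverse inequality.\<close>
  have "\<gamma> t $ 1 \<le> \<gamma> b $ 1" by (rule return_step_mono[OF a(2) b(2) max[OF a(1)]])
  with max[OF b(1)] have eq: "\<gamma> b $ 1 = \<gamma> t $ 1" by simp
  have "\<gamma> b = \<gamma> t"
    by (rule S1_upper_eqI) (use periodic_entry_upper[OF t] periodic_entry_upper[OF b(1)] eq in auto)
  then show ?thesis using return_step_fixed b(2) that by metis
qed

end

text \<open>A period T would give \<open>uu = uu * exp T\<close> and
  \<open>vv = vv * exp (- T)\<close>, which leaves only the equilibrium.\<close>

lemma periodic_not_inside:
  assumes "filippov_trajectory X0 Y0 \<gamma>" "closed_curve \<gamma>"
  shows "\<exists>t. sw (\<gamma> t) \<ge> 0"
proof (rule ccontr)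
  assume "\<not> (\<exists>t. sw (\<gamma> t) \<ge> 0)"
  then have neg: "sw (\<gamma> t) < 0" for t by (simp add: not_le)
  obtain T where T: "T > 0" "\<And>t. \<gamma> (t + T) = \<gamma> t" using assms(2) by (auto simp: closed_curve_def)
  have "\<gamma> t = p0" for t
  proof -
    have "\<gamma> t = flowX T (\<gamma> t)"
      using inside_arc[OF assms(1), of t "t + T" "t + T"] neg T by simp
    then have "uu (\<gamma> t) = uu (\<gamma> t) * exp T" "vv (\<gamma> t) = vv (\<gamma> t) * exp (- T)"
      using uu_flowX vv_flowX by metis+
    then show ?thesis using T(1) by (simp add: plane_eq_iff_uu_vv)
  qed
  then show False using assms(2) by (auto simp: closed_curve_def)
qed

section \<open>Forward uniqueness\<close>

lemma isCont_sw_pos: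
  assumes "filippov_trajectory X Y \<gamma>" "sw (\<gamma> t) > 0"
  shows "\<exists>d>0. \<forall>s. \<bar>s - t\<bar> < d \<longrightarrow> sw (\<gamma> s) > 0"
  using filippov_trajectory_sw_isCont[OF assms(1), of t] assms(2)
  unfolding continuous_at_eps_delta by (force simp: dist_real_def)

lemma isCont_sw_neg:
  assumes "filippov_trajectory X Y \<gamma>" "sw (\<gamma> t) < 0"
  shows "\<exists>d>0. \<forall>s. \<bar>s - t\<bar> < d \<longrightarrow> sw (\<gamma> s) < 0"
proof -
  have "\<exists>d>0. \<forall>s. dist s t < d \<longrightarrow> dist (sw (\<gamma> s)) (sw (\<gamma> t)) < - sw (\<gamma> t)"
    using filippov_trajectory_sw_isCont[OF assms(1), of t] assms(2)
    unfolding continuous_at_eps_delta by (metis neg_0_less_iff_less)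
  then show ?thesis by (force simp: dist_real_def)
qed

text \<open>For a transversal trajectory the present position alone decides which field is followed
  next; at tangencies and sliding points it need not.\<close>

lemma local_flow:
  assumes "transversal \<gamma>"
  shows "\<exists>e>0. \<forall>t\<in>{0..e}. \<gamma> (a + t) =
     (if sw (\<gamma> a) > 0 \<or> exit_point (\<gamma> a) then flowY t (\<gamma> a) else flowX t (\<gamma> a))"
proof -
  note fil = transversal_filippov[OF assms]
  consider (out) "\<exists>e>0. \<forall>s. a < s \<and> s < a + e \<longrightarrow> sw (\<gamma> s) > 0" "sw (\<gamma> a) > 0 \<or> exit_point (\<gamma> a)"
    | (ins) "\<exists>e>0. \<forall>s. a < s \<and> s < a + e \<longrightarrow> sw (\<gamma> s) < 0" "\<not> (sw (\<gamma> a) > 0 \<or> exit_point (\<gamma> a))"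
  proof -
    consider "sw (\<gamma> a) > 0" | "sw (\<gamma> a) < 0" | "exit_point (\<gamma> a)" | "entry_point (\<gamma> a)"
      using transversal_cases[OF assms, of a] by linarith
    then show ?thesis
    proof cases
      case 1
      then obtain d where "d > 0" "\<forall>s. \<bar>s - a\<bar> < d \<longrightarrow> sw (\<gamma> s) > 0" using isCont_sw_pos[OF fil] by blast
      then show ?thesis using 1 by (intro out exI[of _ d]) auto
    next
      case 2
      then obtain d where d: "d > 0" "\<forall>s. \<bar>s - a\<bar> < d \<longrightarrow> sw (\<gamma> s) < 0" using isCont_sw_neg[OF fil] by blast
      have "\<not> (sw (\<gamma> a) > 0 \<or> exit_point (\<gamma> a))" using 2 by (auto simp: exit_point_def S1_def)
      then show ?thesis by (rule ins[rotated]) (use d in \<open>auto intro!: exI[of _ d]\<close>)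
    next
      case 3
      then obtain d where d: "d > 0" "\<forall>s. 0 < s \<and> s < d \<longrightarrow> sw (\<gamma> (a + s)) > 0"
        using filippov_exit_point[OF fil] by blast
      then have "sw (\<gamma> s) > 0" if "a < s" "s < a + d" for s
        using d(2)[rule_format, of "s - a"] that by simp
      then show ?thesis using 3 d(1) by (intro out) auto
    next
      case 4
      then obtain d where d: "d > 0" "\<forall>s. 0 < s \<and> s < d \<longrightarrow> sw (\<gamma> (a + s)) < 0"
        using filippov_entry_point[OF fil] by blast
      then have "sw (\<gamma> s) < 0" if "a < s" "s < a + d" for s
        using d(2)[rule_format, of "s - a"] that by simp
      then show ?thesis using 4 d(1) entry_not_exit[OF 4] by (intro ins) (auto simp: entry_point_def S1_def)
    qed
  qed
  then show ?thesis
  proof cases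
    case out
    then obtain e where e: "e > 0" "\<And>s. a < s \<Longrightarrow> s < a + e \<Longrightarrow> sw (\<gamma> s) > 0" by blast
    have "\<gamma> (a + t) = flowY t (\<gamma> a)" if "t \<in> {0..e}" for t
      using outside_arc[OF fil, of a "a + t" "a + e"] e(2) that by simp
    then show ?thesis using out(2) e(1) by auto
  next
    case ins
    then obtain e where e: "e > 0" "\<And>s. a < s \<Longrightarrow> s < a + e \<Longrightarrow> sw (\<gamma> s) < 0" by blast
    have "\<gamma> (a + t) = flowX t (\<gamma> a)" if "t \<in> {0..e}" for t
      using inside_arc[OF fil, of a "a + t" "a + e"] e(2) that by simp
    then show ?thesis using ins(2) e(1) by auto
  qed
qed

text \<open>At the infimum of the times of disagreement the curves still agree by continuity, and
  \<open>local_flow\<close> continues both past it by the same formula.\<close>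

lemma forward_unique:
  assumes "transversal \<gamma>" "transversal \<eta>" "\<gamma> a = \<eta> b" "t \<ge> 0"
  shows "\<gamma> (a + t) = \<eta> (b + t)"
proof (rule ccontr)
  assume ne: "\<gamma> (a + t) \<noteq> \<eta> (b + t)"
  define D where "D s = \<gamma> (a + s) - \<eta> (b + s)" for s
  define S where "S = {s. 0 \<le> s \<and> D s \<noteq> 0}"
  have "t \<in> S" using ne assms(4) by (simp add: S_def D_def)
  have bdd: "bdd_below S" by (auto simp: S_def)
  define m where "m = Inf S"
  have m0: "m \<ge> 0" unfolding m_def using \<open>t \<in> S\<close> by (intro cInf_greatest) (auto simp: S_def)
  have before: "D s = 0" if "0 \<le> s" "s < m" for s
    using cInf_lower[OF _ bdd, of s] that by (force simp: S_def m_def)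
  have cont: "continuous_on UNIV D"
    unfolding D_def
    by (intro continuous_intros
      continuous_on_compose2[OF filippov_trajectory_continuous_on[OF transversal_filippov[OF assms(1)], of UNIV]]
      continuous_on_compose2[OF filippov_trajectory_continuous_on[OF transversal_filippov[OF assms(2)], of UNIV]])
      auto
  have Dm: "D m = 0"
  proof (cases "m = 0")
    case True
    then show ?thesis using assms(3) by (simp add: D_def)
  next
    case False
    then have "m > 0" using m0 by simp
    have "closed (D -` {0})" using cont by (intro closed_vimage) auto
    moreover have "{0<..<m} \<subseteq> D -` {0}" using before by auto
    ultimately have "closure {0<..<m} \<subseteq> D -` {0}" by (intro closure_minimal)
    moreover have "m \<in> closure {0<..<m}" using \<open>m > 0\<close> by simp
    ultimately show ?thesis by blast
  qed
  have eq: "\<gamma> (a + m) = \<eta> (b + m)" using Dm by (simp add: D_def)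
  obtain e where e: "e > 0" "\<forall>t\<in>{0..e}. \<gamma> (a + m + t) =
     (if sw (\<gamma> (a + m)) > 0 \<or> exit_point (\<gamma> (a + m)) then flowY t (\<gamma> (a + m)) else flowX t (\<gamma> (a + m)))"
    using local_flow[OF assms(1)] by blast
  obtain e' where e': "e' > 0" "\<forall>t\<in>{0..e'}. \<eta> (b + m + t) =
     (if sw (\<eta> (b + m)) > 0 \<or> exit_point (\<eta> (b + m)) then flowY t (\<eta> (b + m)) else flowX t (\<eta> (b + m)))"
    using local_flow[OF assms(2)] by blast
  have after: "D s = 0" if "m \<le> s" "s < m + min e e'" for s
    using e(2)[rule_format, of "s - m"] e'(2)[rule_format, of "s - m"] that
    by (simp add: D_def eq algebra_simps)
  have "m + min e e' \<le> Inf S"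
  proof (rule cInf_greatest)
    show "S \<noteq> {}" using \<open>t \<in> S\<close> by blast
    fix s assume s: "s \<in> S"
    show "m + min e e' \<le> s"
      using before[of s] after[of s] s by (force simp: S_def)
  qed
  then show False using e(1) e'(1) by (simp add: m_def[symmetric])
qed

text \<open>Forward uniqueness suffices, since every point of a periodic curve is attained again
  after the common point.\<close>

lemma periodic_range_eq:
  assumes "transversal \<gamma>" "transversal \<eta>" "T > 0" "\<And>t. \<gamma> (t + T) = \<gamma> t"
    "U > 0" "\<And>t. \<eta> (t + U) = \<eta> t" "\<gamma> a = \<eta> b"
  shows "range \<gamma> = range \<eta>"
proof -
  have incl: "range \<gamma> \<subseteq> range \<eta>"
    if asm: "transversal \<gamma>" "transversal \<eta>" "T > 0" "\<And>t. \<gamma> (t + T) = \<gamma> t" "\<gamma> a = \<eta> b"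
    for \<gamma> \<eta> T a b
  proof
    fix z assume "z \<in> range \<gamma>"
    then obtain t where "z = \<gamma> t" by blast
    then obtain s where s: "s > a" "z = \<gamma> s" using periodic_shift[of T \<gamma>, OF asm(3,4)] by metis
    then have "z = \<eta> (b + (s - a))" using forward_unique[OF asm(1,2,5), of "s - a"] by simp
    then show "z \<in> range \<eta>" by blast
  qed
  then show ?thesis using incl[OF assms(1,2,3,4,7)] incl[OF assms(2,1,5,6) assms(7)[symmetric]] by blast
qed

section \<open>The limit cycle\<close>

lemma subdivision_of_steps:
  fixes \<tau> :: "int \<Rightarrow> real"
  assumes m: "m > 0" and step: "\<And>i. \<tau> (i + 1) \<ge> \<tau> i + m"
  shows "subdivision \<tau>"
proof -
  have gap: "\<tau> j \<ge> \<tau> i + of_int (j - i) * m" if "i \<le> j" for i j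
    using that
  proof (induction j rule: int_ge_induct)
    case (step j)
    then show ?case using assms(2)[of j] by (simp add: algebra_simps)
  qed simp
  have "strict_mono \<tau>"
  proof (rule strict_monoI)
    fix i j :: int assume "i < j"
    then have "of_int (j - i) * m > 0" using m by simp
    then show "\<tau> i < \<tau> j" using gap[of i j] \<open>i < j\<close> by simp
  qed
  moreover have "filterlim \<tau> at_top at_top"
    unfolding filterlim_at_top eventually_at_top_linorder
  proof
    fix Z :: real
    obtain N :: int where N: "of_int N > (Z - \<tau> 0) / m" using ex_less_of_int by blast
    have "\<tau> n \<ge> Z" if "n \<ge> max 0 N" for n
    proof -
      have "(Z - \<tau> 0) / m \<le> of_int n" using N that by linarith
      then have "Z - \<tau> 0 \<le> of_int n * m" using m by (simp add: pos_divide_le_eq)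
      then show ?thesis using gap[of 0 n] that by simp
    qed
    then show "\<exists>N. \<forall>n\<ge>N. Z \<le> \<tau> n" by blast
  qed
  moreover have "filterlim \<tau> at_bot at_bot"
    unfolding filterlim_at_bot eventually_at_bot_linorder
  proof
    fix Z :: real
    obtain N :: int where N: "of_int N < (Z - \<tau> 0) / m" using ex_of_int_less by blast
    have "\<tau> n \<le> Z" if "n \<le> min 0 N" for n
    proof -
      have "of_int n \<le> (Z - \<tau> 0) / m" using N that by linarith
      then have "of_int n * m \<le> Z - \<tau> 0" using m by (simp add: pos_le_divide_eq)
      then show ?thesis using gap[of n 0] that by simp
    qed
    then show "\<exists>N. \<forall>n\<le>N. \<tau> n \<le> Z" by blast
  qed
  ultimately show ?thesis by (simp add: subdivision_def)
qed

lemma flowX_shift_derivative: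
  "((\<lambda>t. flowX (t - a) z) has_vector_derivative X0 (flowX (t - a) z)) (at t within S)"
  unfolding has_vector_derivative_plane flowX_nth X0_nth
  by (auto intro!: derivative_eq_intros simp: field_simps)

lemma flowY_shift_derivative:
  "((\<lambda>t. flowY (t - a) z) has_vector_derivative Y0 (flowY (t - a) z)) (at t within S)"
  unfolding has_vector_derivative_plane flowY_nth Y0_nth
  by (auto intro!: derivative_eq_intros simp: field_simps)

lemma side_arc_Inside_flowX:
  assumes "\<And>t. t \<in> {a..b} \<Longrightarrow> \<gamma> t = flowX (t - c) z" "\<And>t. t \<in> {a..b} \<Longrightarrow> sw (flowX (t - c) z) \<le> 0"
  shows "side_arc X0 Y Inside \<gamma> a b"
proof -
  have "(\<gamma> has_vector_derivative X0 (\<gamma> t)) (at t within {a..b})" if "t \<in> {a..b}" for t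
    unfolding assms(1)[OF that]
    by (rule has_vector_derivative_transform[OF that _ flowX_shift_derivative]) (simp add: assms(1))
  then show ?thesis using assms by simp
qed

lemma side_arc_Outside_flowY:
  assumes "\<And>t. t \<in> {a..b} \<Longrightarrow> \<gamma> t = flowY (t - c) z" "\<And>t. t \<in> {a..b} \<Longrightarrow> sw (flowY (t - c) z) \<ge> 0"
  shows "side_arc X Y0 Outside \<gamma> a b"
proof -
  have "(\<gamma> has_vector_derivative Y0 (\<gamma> t)) (at t within {a..b})" if "t \<in> {a..b}" for t
    unfolding assms(1)[OF that]
    by (rule has_vector_derivative_transform[OF that _ flowY_shift_derivative]) (simp add: assms(1))
  then show ?thesis using assms by simp
qed

lemma continuous_flowY: "continuous_on S (\<lambda>t. flowY t z)"
  unfolding continuous_on_eq_continuous_within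
  by (intro ballI has_vector_derivative_continuous[OF flowY_derivative])

text \<open>The first return of the orbit to the circle lies on the same level as \<open>z\<close>
  and cannot have \<open>gg\<close> negative, as it comes from outside. By
  \<open>HY_level_circle\<close>, distinct circle points on one level have opposite signs of
  \<open>gg\<close>, so the return point is \<open>z\<close>.\<close>

lemma Y_arc_exists:
  assumes "w \<in> S1" "gg w < 0" "z \<in> S1" "gg z > 0" "HY w = HY z"
  obtains T where "T > 0" "flowY T w = z" "\<And>t. 0 < t \<Longrightarrow> t < T \<Longrightarrow> sw (flowY t w) > 0"
proof -
  have lie: "Y0 (flowY 0 w) \<bullet> grad_sw (flowY 0 w) > 0"
    using lie_Y0[of w] assms(2) by (simp add: lie_sw_def)
  obtain d where d: "d > 0" "\<forall>s. 0 < s \<and> s < d \<longrightarrow> sw (flowY (0 + s) w) > sw (flowY 0 w)"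
    using sw_increasing_right[of "\<lambda>t. flowY t w", OF flowY_derivative zero_less_one lie] by blast
  obtain d' where d': "d' > 0" "\<forall>s. 0 < s \<and> s < d' \<longrightarrow> sw (flowY (0 - s) w) < sw (flowY 0 w)"
    using sw_increasing_left[of "\<lambda>t. flowY t w", OF flowY_derivative zero_less_one lie] by blast
  have w0: "sw w = 0" using assms(1) by (simp add: S1_def)
  \<comment> \<open>The orbit has period \<open>pi / 12\<close> and reaches \<open>w\<close> from
    inside, so it is inside the disc shortly before a full period; a return must have
    occurred.\<close>
  obtain s where s: "0 < s" "s < d'" "s < pi / 12" using d'(1) dense[of 0 "min d' (pi / 12)"] by auto
  have u: "sw (flowY (pi / 12 - s) w) \<le> 0"
    using d'(2)[rule_format, of s] s w0 flowY_period[of "- s" w] by simp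
  have c: "continuous_on UNIV (\<lambda>t. sw (flowY t w))" by (intro continuous_intros continuous_flowY)
  obtain T where T: "0 < T" "sw (flowY T w) = 0" "\<And>t. 0 < t \<Longrightarrow> t < T \<Longrightarrow> sw (flowY t w) > 0"
    by (rule next_zero[OF c d(1), of 0 "pi / 12 - s"]) (use d(2) s u w0 in auto)
  define q where "q = flowY T w"
  have q: "q \<in> S1" using T(2) by (simp add: S1_def q_def)
  have "gg q \<ge> 0"
  proof (rule ccontr)
    assume "\<not> gg q \<ge> 0"
    then have "Y0 (flowY T w) \<bullet> grad_sw (flowY T w) > 0"
      using lie_Y0[of q] by (simp add: lie_sw_def q_def)
    then obtain e where e: "e > 0" "\<forall>s. 0 < s \<and> s < e \<longrightarrow> sw (flowY (T - s) w) < sw (flowY T w)"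
      using sw_increasing_left[of "\<lambda>t. flowY t w", OF flowY_derivative zero_less_one] by blast
    obtain s where "0 < s" "s < e" "s < T" using e(1) T(1) dense[of 0 "min e T"] by auto
    then show False using e(2) T(2) T(3)[of "T - s"] by force
  qed
  then have "\<not> gg q * gg z < 0" using assms(4) by (simp add: mult_less_0_iff)
  then have "q = z" using HY_level_circle[OF q assms(3)] assms(5) by (auto simp: q_def)
  then show ?thesis using that T by (simp add: q_def)
qed

lemma dc_less: "dc < 3/5"
proof -
  have "dc\<^sup>2 < (3/5)\<^sup>2" unfolding dc_sq by (simp add: power2_eq_square)
  then show ?thesis by (rule power2_less_imp_less) simp
qed

lemma zc_nth: "zc $ 1 = - 1/10 - dc" "zc $ 2 = 4/5 - dc/8"
  and wc_nth: "wc $ 1 = - 1/10 + dc" "wc $ 2 = 4/5 + dc/8"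
  by (simp_all add: zc_def wc_def)

lemma zc_S1: "zc \<in> S1" and wc_S1: "wc \<in> S1"
  using dc_sq by (simp_all add: S1_def sw_def zc_nth wc_nth power2_eq_square field_simps)

lemma zc_neq_wc: "zc \<noteq> wc"
  using dc_pos by (simp add: plane_eq_iff zc_nth wc_nth)

lemma HY_zc_wc: "HY zc = HY wc"
  by (simp add: HY_def zc_nth wc_nth power2_eq_square field_simps)

lemma entry_zc: "entry_point zc"
  unfolding entry_point_def
proof (intro conjI)
  show "gg zc > 0" using dc_pos by (intro gg_left zc_S1) (simp add: zc_nth)
  show "zc $ 2 * (zc $ 1 + 1/10) < 0" using dc_pos dc_less by (simp add: zc_nth mult_pos_neg)
qed (rule zc_S1)

lemma exit_wc: "exit_point wc"
  unfolding exit_point_def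
proof (intro conjI)
  show "gg wc < 0"
    using HY_level_circle[OF zc_S1 wc_S1 HY_zc_wc zc_neq_wc] entry_zc
    by (simp add: entry_point_def mult_less_0_iff)
  show "wc $ 2 * (wc $ 1 + 1/10) > 0" using dc_pos by (simp add: wc_nth add_pos_pos)
qed (rule wc_S1)

lemma X_arc_exists:
  obtains T where "T > 0" "flowX T zc = wc" "\<And>t. 0 < t \<Longrightarrow> t < T \<Longrightarrow> sw (flowX t zc) < 0"
proof -
  \<comment> \<open>In diagonal coordinates the step from \<open>zc\<close> to \<open>wc\<close>
    exchanges \<open>1 - q\<close> and \<open>1 + q\<close>, so their quotient is
    \<open>exp T\<close>.\<close>
  define q where "q = 5/4 * dc"
  have q: "0 < q" "q < 1" using dc_pos dc_less by (simp_all add: q_def)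
  have uv: "uu zc = 9/10 * (1 - q)" "vv zc = - (7/10 * (1 + q))"
    "uu wc = 9/10 * (1 + q)" "vv wc = - (7/10 * (1 - q))"
    by (simp_all add: uu_def vv_def zc_nth wc_nth q_def field_simps)
  define T where "T = ln ((1 + q) / (1 - q))"
  have "(1 + q) / (1 - q) > 1" using q by (simp add: field_simps)
  then have T: "T > 0" by (simp add: T_def)
  have eT: "exp T = (1 + q) / (1 - q)" "exp (- T) = (1 - q) / (1 + q)"
    using q by (simp_all add: T_def exp_minus)
  have fT: "flowX T zc = wc"
    using q by (simp add: plane_eq_iff_uu_vv uv eT field_simps)
  \<comment> \<open>As \<open>uu zc > 0 > vv zc\<close>, both terms of the first coordinate
    increase. On this level \<open>sw\<close> vanishes exactly at the abscissae of the two ends, so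
    monotonicity keeps the arc inside.\<close>
  have mono: "flowX s zc $ 1 < flowX t zc $ 1" if "s < t" for s t
  proof -
    have "uu zc * exp s < uu zc * exp t" using that q by (simp add: uv)
    moreover have "vv zc * exp (- s) < vv zc * exp (- t)" using that q by (simp add: uv)
    ultimately show ?thesis by (simp add: flowX_nth)
  qed
  have "sw (flowX t zc) < 0" if "0 < t" "t < T" for t
  proof -
    define x where "x = flowX t zc $ 1"
    have x: "zc $ 1 < x" "x < wc $ 1" using mono[OF that(1)] mono[OF that(2)] fT by (simp_all add: x_def)
    have "uu (flowX t zc) * vv (flowX t zc) = uu zc * vv zc" by (simp add: exp_minus)
    then have "sw (flowX t zc) = 2 * x\<^sup>2 + 2/5 * x - 24/25 - uu zc * vv zc"
      by (simp only: sw_uu_vv[of "flowX t zc"] x_def)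
    moreover have "uu zc * vv zc = 2 * (zc $ 1)\<^sup>2 + 2/5 * zc $ 1 - 24/25"
      using sw_uu_vv[of zc] zc_S1 by (simp add: S1_def)
    moreover have w: "wc $ 1 = - 1/5 - zc $ 1" by (simp add: zc_nth wc_nth)
    ultimately have "sw (flowX t zc) = 2 * ((x - zc $ 1) * (x - wc $ 1))"
      unfolding w by (simp add: power2_eq_square field_simps)
    also have "\<dots> < 0" using x by (simp add: mult_pos_neg)
    finally show ?thesis .
  qed
  then show ?thesis using that T fT by blast
qed

text \<open>The last clause prepares the isolation argument: every point is strictly inside the disc
  or on the level of \<open>zc\<close>.\<close>

lemma limit_cycle_curve:
  obtains \<gamma> T where "crossing_trajectory X0 Y0 \<gamma>" "T > 0" "\<And>t. \<gamma> (t + T) = \<gamma> t"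
    "range \<gamma> \<inter> S1 = {zc, wc}" "\<And>t. sw (\<gamma> t) \<le> 0 \<and> \<gamma> t \<notin> S1 \<or> HY (\<gamma> t) = HY zc"
proof -
  obtain T1 where T1: "T1 > 0" "flowX T1 zc = wc" "\<And>t. 0 < t \<Longrightarrow> t < T1 \<Longrightarrow> sw (flowX t zc) < 0"
    using X_arc_exists by blast
  obtain T2 where T2: "T2 > 0" "flowY T2 wc = zc" "\<And>t. 0 < t \<Longrightarrow> t < T2 \<Longrightarrow> sw (flowY t wc) > 0"
    using Y_arc_exists[of wc zc] entry_zc exit_wc HY_zc_wc by (metis entry_point_def exit_point_def)
  have s0: "sw zc = 0" "sw wc = 0" using zc_S1 wc_S1 by (simp_all add: S1_def)
  define P where "P = T1 + T2"
  have P: "P > 0" using T1 T2 by (simp add: P_def)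
  define base where "base t = (if t \<le> T1 then flowX t zc else flowY (t - T1) wc)" for t
  define \<gamma> where "\<gamma> t = base (t - of_int \<lfloor>t / P\<rfloor> * P)" for t
  have piece: "\<gamma> t = base (t - of_int n * P)" if "of_int n * P \<le> t" "t < of_int (n + 1) * P" for t n
  proof -
    have "\<lfloor>t / P\<rfloor> = n"
      using that P by (intro floor_unique) (simp_all add: pos_le_divide_eq pos_divide_less_eq)
    then show ?thesis by (simp add: \<gamma>_def)
  qed
  have per: "\<gamma> (t + P) = \<gamma> t" for t
  proof -
    have "(t + P) / P = t / P + 1" using P by (simp add: add_divide_distrib)
    then show ?thesis by (simp add: \<gamma>_def algebra_simps)
  qed
  have X: "\<gamma> t = flowX (t - of_int n * P) zc" if "t \<in> {of_int n * P..of_int n * P + T1}" for t n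
    using piece[of n t] that T2(1) by (simp add: base_def P_def algebra_simps)
  have Y: "\<gamma> t = flowY (t - (of_int n * P + T1)) wc" if "t \<in> {of_int n * P + T1..of_int (n + 1) * P}" for t n
  \<comment> \<open>At the right end the floor has already jumped, so the value is the start of the
    next inner arc; it agrees with the outer arc because that closes up at
    \<open>zc\<close>.\<close>
  proof (cases "t = of_int (n + 1) * P")
    case True
    then have "\<gamma> t = zc" using X[of t "n + 1"] T1(1) by simp
    moreover have "t - (of_int n * P + T1) = T2" by (simp add: True P_def algebra_simps)
    ultimately show ?thesis using T2(2) by simp
  next
    case False
    then have "\<gamma> t = base (t - of_int n * P)" using piece[of n t] that T1(1) by simp
    then show ?thesis
      using that T1(2) by (cases "t = of_int n * P + T1") (auto simp: base_def algebra_simps)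
  qed
  define \<tau> :: "int \<Rightarrow> real" where "\<tau> i = of_int (i div 2) * P + (if even i then 0 else T1)" for i
  define \<kappa> :: "int \<Rightarrow> side" where "\<kappa> i = (if even i then Inside else Outside)" for i
  have even: "\<tau> (2 * n) = of_int n * P" and odd: "\<tau> (2 * n + 1) = of_int n * P + T1" for n
    by (simp_all add: \<tau>_def)
  have even2: "\<tau> (2 * n + 1 + 1) = of_int (n + 1) * P" for n
    using even[of "n + 1"] by (simp add: algebra_simps)
  have parity: "(\<exists>n. i = 2 * n) \<or> (\<exists>n. i = 2 * n + 1)" for i :: int
    by presburger
  have sub: "subdivision \<tau>"
  proof (rule subdivision_of_steps)
    show "min T1 T2 > 0" using T1 T2 by simp
    show "\<tau> i + min T1 T2 \<le> \<tau> (i + 1)" for i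
      using parity[of i] even odd even2 by (auto simp: P_def algebra_simps)
  qed
  have swX: "sw (flowX t zc) \<le> 0" if "0 \<le> t" "t \<le> T1" for t
    using T1(2) T1(3)[of t] s0 that by (cases "t = 0 \<or> t = T1") auto
  have swY: "sw (flowY t wc) \<ge> 0" if "0 \<le> t" "t \<le> T2" for t
    using T2(2) T2(3)[of t] s0 that by (cases "t = 0 \<or> t = T2") auto
  have arcs: "side_arc X0 Y0 (\<kappa> i) \<gamma> (\<tau> i) (\<tau> (i + 1))" for i
    using parity[of i]
  proof (elim disjE exE)
    fix n assume i: "i = 2 * n"
    have "side_arc X0 Y0 Inside \<gamma> (of_int n * P) (of_int n * P + T1)"
      by (rule side_arc_Inside_flowX[OF X]) (auto intro: swX)
    then show ?thesis unfolding i even odd by (simp add: \<kappa>_def)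
  next
    fix n assume i: "i = 2 * n + 1"
    have "side_arc X0 Y0 Outside \<gamma> (of_int n * P + T1) (of_int (n + 1) * P)"
      by (rule side_arc_Outside_flowY[OF Y]) (auto intro!: swY simp: P_def algebra_simps)
    then show ?thesis unfolding i odd even2 by (simp add: \<kappa>_def)
  qed
  have "\<gamma> (\<tau> i) \<in> {zc, wc}" for i
    using parity[of i]
  proof (elim disjE exE)
    fix n assume i: "i = 2 * n"
    show ?thesis unfolding i even using X[of "of_int n * P" n] T1(1) by simp
  next
    fix n assume i: "i = 2 * n + 1"
    show ?thesis unfolding i odd using X[of "of_int n * P + T1" n] T1(1,2) by simp
  qed
  then have "\<gamma> (\<tau> (i + 1)) \<in> crossing_region X0 Y0" for i
    using entry_zc exit_wc by (metis crossing_region_iff insertE singletonD)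
  then have ct: "crossing_trajectory X0 Y0 \<gamma>"
    unfolding crossing_trajectory_def using sub arcs by blast
  have cases: "\<gamma> t = zc \<or> \<gamma> t = wc \<or> sw (\<gamma> t) < 0 \<or> (sw (\<gamma> t) > 0 \<and> HY (\<gamma> t) = HY zc)" for t
  proof -
    define n where "n = \<lfloor>t / P\<rfloor>"
    have n: "of_int n * P \<le> t" "t < of_int (n + 1) * P"
      using P floor_divide_lower[of P t] floor_divide_upper[of P t] by (simp_all add: n_def)
    show ?thesis
    proof (cases "t \<le> of_int n * P + T1")
      case True
      then have eq: "\<gamma> t = flowX (t - of_int n * P) zc" using X[of t n] n by simp
      show ?thesis
        using T1(2) T1(3)[of "t - of_int n * P"] n True unfolding eq
        by (cases "t = of_int n * P \<or> t = of_int n * P + T1") auto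
    next
      case False
      then have eq: "\<gamma> t = flowY (t - (of_int n * P + T1)) wc" using Y[of t n] n by simp
      then have "sw (\<gamma> t) > 0"
        using T2(3)[of "t - (of_int n * P + T1)"] n False by (simp add: P_def algebra_simps)
      then show ?thesis by (simp add: eq HY_zc_wc)
    qed
  qed
  have "\<gamma> 0 = zc" "\<gamma> T1 = wc" using X[of 0 0] X[of T1 0] T1 by simp_all
  then have "range \<gamma> \<inter> S1 = {zc, wc}"
    using cases zc_S1 wc_S1 by (auto simp: S1_def) (metis less_irrefl rangeI)+
  moreover have "sw (\<gamma> t) \<le> 0 \<and> \<gamma> t \<notin> S1 \<or> HY (\<gamma> t) = HY zc" for t
    using cases[of t] HY_zc_wc by (auto simp: S1_def)
  ultimately show ?thesis using that[OF ct P per] by blast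
qed

section \<open>Isolation of the closed curve\<close>

lemma crossing_periodic_orbit_transversal:
  assumes "crossing_trajectory X0 Y0 \<gamma>" "range \<gamma> \<inter> S1 \<subseteq> crossing_region X0 Y0"
  shows "transversal \<gamma>"
  using assms crossing_trajectory_imp_filippov_trajectory by (auto simp: transversal_def)

lemma nonzero_pos_everywhere:
  fixes f :: "real \<Rightarrow> real"
  assumes "continuous_on UNIV f" "\<And>t. f t \<noteq> 0" "f a > 0"
  shows "f b > 0"
proof (rule ccontr)
  assume "\<not> f b > 0"
  then have fb: "f b \<le> 0" by simp
  have "\<exists>x. f x = 0"
  proof (cases "a \<le> b")
    case True
    have "\<exists>x. a \<le> x \<and> x \<le> b \<and> f x = 0"
      using fb assms(3) True by (intro IVT2' continuous_on_subset[OF assms(1)]) auto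
    then show ?thesis by blast
  next
    case False
    have "\<exists>x. b \<le> x \<and> x \<le> a \<and> f x = 0"
      using fb assms(3) False by (intro IVT' continuous_on_subset[OF assms(1)]) auto
    then show ?thesis by blast
  qed
  then show False using assms(2) by blast
qed

lemma periodic_off_circle:
  assumes "filippov_trajectory X0 Y0 \<gamma>" "closed_curve \<gamma>" "range \<gamma> \<inter> S1 = {}"
  shows "sw (\<gamma> t) > 0" "range \<gamma> = range (\<lambda>t. flowY t (\<gamma> 0))"
proof -
  obtain T where T: "T > 0" "\<And>t. \<gamma> (t + T) = \<gamma> t" using assms(2) by (auto simp: closed_curve_def)
  have nz: "sw (\<gamma> t) \<noteq> 0" for t using assms(3) by (auto simp: S1_def)
  obtain a where "sw (\<gamma> a) \<ge> 0" using periodic_not_inside[OF assms(1,2)] by blast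
  then have "sw (\<gamma> a) > 0" using nz[of a] by simp
  then have pos: "sw (\<gamma> t) > 0" for t
    by (rule nonzero_pos_everywhere[OF filippov_sw_continuous[OF assms(1)] nz])
  then show "sw (\<gamma> t) > 0" .
  have flow: "\<gamma> t = flowY t (\<gamma> 0)" if "t \<ge> 0" for t
    using outside_arc[OF assms(1), of 0 t t] pos that by simp
  show "range \<gamma> = range (\<lambda>t. flowY t (\<gamma> 0))"
  proof (intro set_eqI iffI)
    fix z assume "z \<in> range \<gamma>"
    then obtain t where "z = \<gamma> t" by blast
    then obtain s where "s > 0" "z = \<gamma> s" using periodic_shift[of T \<gamma>, OF T] by metis
    then show "z \<in> range (\<lambda>t. flowY t (\<gamma> 0))" using flow[of s] by auto
  next
    fix z assume "z \<in> range (\<lambda>t. flowY t (\<gamma> 0))"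
    then obtain t where t: "z = flowY t (\<gamma> 0)" by blast
    have "pi / 12 > (0::real)" by simp
    then obtain s where "s > 0" "z = flowY s (\<gamma> 0)"
      using periodic_shift[of "pi / 12" "\<lambda>t. flowY t (\<gamma> 0)" 0 t] flowY_period t by metis
    then show "z \<in> range \<gamma>" using flow[of s] by (metis less_imp_le rangeI)
  qed
qed

text \<open>The bounds are the values of \<open>HY\<close> at (0, 1) and (0, -1).\<close>

lemma circle_meets_HY_level:
  assumes "-44 < l" "l < 70"
  obtains q where "q \<in> S1" "HY q = l"
proof -
  define f where "f t = HY (vector [cos t, sin t])" for t
  have "\<exists>t. - pi/2 \<le> t \<and> t \<le> pi/2 \<and> f t = l"
  proof (rule IVT2')
    show "f (pi/2) \<le> l" "l \<le> f (- pi/2)" using assms by (simp_all add: f_def HY_def)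
    show "continuous_on {- pi/2..pi/2} f" unfolding f_def HY_def vector_2 by (intro continuous_intros)
  qed simp
  then obtain t where "f t = l" by blast
  then show ?thesis
    by (intro that[of "vector [cos t, sin t]"]) (simp_all add: f_def S1_def sw_def)
qed

lemma limit_cycle_isolated:
  assumes "crossing_trajectory X0 Y0 \<gamma>" "T > 0" "\<And>t. \<gamma> (t + T) = \<gamma> t"
    "range \<gamma> \<inter> S1 = {zc, wc}" "\<And>t. sw (\<gamma> t) \<le> 0 \<and> \<gamma> t \<notin> S1 \<or> HY (\<gamma> t) = HY zc"
  shows "crossing_limit_cycle X0 Y0 (range \<gamma>)"
proof -
  have zw: "zc \<in> range \<gamma>" "wc \<in> range \<gamma>" using assms(4) by blast+
  have cr: "range \<gamma> \<inter> S1 \<subseteq> crossing_region X0 Y0"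
    using assms(4) entry_zc exit_wc by (auto simp: crossing_region_iff)
  have "\<exists>s t. \<gamma> s \<noteq> \<gamma> t" using zw zc_neq_wc by (metis imageE)
  then have cc: "closed_curve \<gamma>" using assms(2,3) by (auto simp: closed_curve_def)
  have tr: "transversal \<gamma>" by (rule crossing_periodic_orbit_transversal[OF assms(1) cr])
  \<comment> \<open>Removing the circle points outside the crossing region forces every competitor
    to be transversal, so neither sliding nor grazing remains.\<close>
  define A where "A = {z. sw z \<noteq> 0} \<union> {z. lie_sw X0 z * lie_sw Y0 z > 0}"
  \<comment> \<open>Outside and on the circle only levels that meet the circle are kept: an orbit of
    \<open>Y0\<close> fills its level, so none avoiding the circle fits into this set.\<close>
  define B where "B = {z. sw z < 0} \<union> ({z. -44 < HY z} \<inter> {z. HY z < 70})"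
  have lvl: "-44 < HY zc" "HY zc < 70"
    using dc_pos dc_less dc_sq by (simp_all add: HY_def zc_nth power2_eq_square field_simps)
  have c: "continuous_on UNIV sw" "continuous_on UNIV HY"
    "continuous_on UNIV (lie_sw X0)" "continuous_on UNIV (lie_sw Y0)"
    unfolding sw_def[abs_def] HY_def[abs_def] lie_X0[abs_def] lie_Y0[abs_def] gg_def
    by (intro continuous_intros)+
  have "open A" unfolding A_def
    by (intro open_Un open_Collect_neq open_Collect_less continuous_intros c)
  moreover have "open B" unfolding B_def
    by (intro open_Un open_Int open_Collect_less continuous_intros c)
  ultimately have op: "open (A \<inter> B)" by blast
  have sub: "range \<gamma> \<subseteq> A \<inter> B"
  proof
    fix z assume z: "z \<in> range \<gamma>"
    have "z \<in> A" using cr z by (auto simp: A_def S1_def crossing_region_def)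
    moreover have "sw z < 0 \<or> HY z = HY zc"
      using assms(5) z by (force simp: S1_def)
    then have "z \<in> B" using lvl by (auto simp: B_def)
    ultimately show "z \<in> A \<inter> B" by blast
  qed
  have unique: "\<Gamma>' = range \<gamma>" if "periodic_orbit X0 Y0 \<Gamma>'" "\<Gamma>' \<subseteq> A \<inter> B" for \<Gamma>'
  proof -
    obtain \<eta> where \<eta>: "filippov_trajectory X0 Y0 \<eta>" "closed_curve \<eta>" "\<Gamma>' = range \<eta>"
      using \<open>periodic_orbit X0 Y0 \<Gamma>'\<close> by (auto simp: periodic_orbit_def)
    obtain U where U: "U > 0" "\<And>t. \<eta> (t + U) = \<eta> t" using \<eta>(2) by (auto simp: closed_curve_def)
    have in_A: "\<eta> t \<in> A" and in_B: "\<eta> t \<in> B" for t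
      using that(2) \<eta>(3) by auto
    have tr': "transversal \<eta>"
      using \<eta>(1) in_A by (auto simp: transversal_def A_def S1_def crossing_region_def)
    show ?thesis
    proof (cases "range \<eta> \<inter> S1 = {}")
      case True
      have pos: "sw (\<eta> 0) > 0" by (rule periodic_off_circle(1)[OF \<eta>(1,2) True])
      then have "-44 < HY (\<eta> 0)" "HY (\<eta> 0) < 70" using in_B[of 0] by (auto simp: B_def)
      then obtain q where q: "q \<in> S1" "HY (\<eta> 0) = HY q" using circle_meets_HY_level by metis
      obtain t where "flowY t (\<eta> 0) = q" using flowY_transitive[OF q(2)] by blast
      then have "q \<in> range \<eta>" unfolding periodic_off_circle(2)[OF \<eta>(1,2) True] by blast
      then show ?thesis using True q(1) by blast
    next
      case False
      then obtain t0 where "\<eta> t0 \<in> S1" by blast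
      then obtain t where "\<eta> t = zc" using periodic_through_zc[of \<eta> U, OF tr' U] by blast
      moreover obtain s where "\<gamma> s = zc" using zw(1) by (metis imageE)
      ultimately show ?thesis
        unfolding \<eta>(3) using periodic_range_eq[of \<eta> \<gamma> U T t s] tr tr' U assms(2,3) by simp
    qed
  qed
  have "crossing_periodic_orbit X0 Y0 (range \<gamma>)"
    unfolding crossing_periodic_orbit_def using assms(1) cc cr by blast
  then show ?thesis
    unfolding crossing_limit_cycle_def using op sub unique by blast
qed

section \<open>Periodic orbits of the center outside the disc\<close>

lemma flowY_half_period: "flowY (t + pi / 24) z = vector [5/8, 37/8] - flowY t z"
  by (simp add: plane_eq_iff flowY_nth distrib_left)

lemma outer_orbit_periodic:
  assumes "\<And>t. sw (flowY t z) > 0" "z \<noteq> vector [5/16, 37/16]"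
  shows "periodic_orbit X0 Y0 (range (\<lambda>t. flowY t z))"
proof -
  have "subdivision (of_int :: int \<Rightarrow> real)" by (rule subdivision_of_steps[of 1]) auto
  moreover have "Y0 (flowY t z) \<in> filippov X0 Y0 (flowY t z)" for t
    using assms(1)[of t] by (simp add: filippov_def)
  ultimately have "filippov_trajectory X0 Y0 (\<lambda>t. flowY t z)"
    unfolding filippov_trajectory_def using flowY_derivative by blast
  moreover have "closed_curve (\<lambda>t. flowY t z)"
    unfolding closed_curve_def
  proof (intro conjI)
    show "\<exists>T>0. \<forall>t. flowY (t + T) z = flowY t z"
      using flowY_period by (intro exI[of _ "pi / 12"]) simp
    have "flowY (0 + pi / 24) z \<noteq> flowY 0 z"
      using assms(2) unfolding flowY_half_period by (auto simp: plane_eq_iff)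
    then show "\<exists>s t. flowY s z \<noteq> flowY t z" by blast
  qed
  ultimately show ?thesis by (auto simp: periodic_orbit_def)
qed

lemma flowY_dilation:
  "flowY t (vector [5/16, 37/16] + r *\<^sub>R (z - vector [5/16, 37/16]))
     = vector [5/16, 37/16] + r *\<^sub>R (flowY t z - vector [5/16, 37/16])"
  by (simp add: plane_eq_iff flowY_nth algebra_simps)

lemma outer_orbit_not_isolated:
  assumes pos: "\<And>t. sw (flowY t z) > 0" and ne: "z \<noteq> vector [5/16, 37/16]"
    and U: "open U" "range (\<lambda>t. flowY t z) \<subseteq> U"
  shows "\<exists>\<Gamma>'. periodic_orbit X0 Y0 \<Gamma>' \<and> \<Gamma>' \<subseteq> U \<and> \<Gamma>' \<noteq> range (\<lambda>t. flowY t z)"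
proof -
  define c :: plane where "c = vector [5/16, 37/16]"
  define K where "K = (\<lambda>t. flowY t z) ` {0..pi / 12}"
  have comp: "compact K" unfolding K_def by (intro compact_continuous_image continuous_flowY compact_Icc)
  have rK: "flowY t z \<in> K" for t
  proof -
    define n where "n = \<lfloor>t / (pi / 12)\<rfloor>"
    have "flowY (t + of_int (- n) * (pi / 12)) z = flowY t z"
      using periodic_int[of "\<lambda>t. flowY t z" "pi / 12"] flowY_period by blast
    moreover have "t + of_int (- n) * (pi / 12) \<in> {0..pi / 12}"
      using floor_divide_lower[of "pi / 12" t] floor_divide_upper[of "pi / 12" t]
      by (simp add: n_def algebra_simps)
    ultimately show ?thesis unfolding K_def by (metis image_eqI)
  qed
  have "open {z. sw z > 0}"
    unfolding sw_def by (intro open_Collect_less continuous_intros)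
  then have "open (U \<inter> {z. sw z > 0})" using U(1) by blast
  moreover have "K \<subseteq> U \<inter> {z. sw z > 0}" using U(2) pos by (auto simp: K_def)
  ultimately obtain e where e: "e > 0" "(\<Union>x\<in>K. ball x e) \<subseteq> U \<inter> {z. sw z > 0}"
    using compact_subset_open_imp_ball_epsilon_subset[OF comp] by metis
  obtain M where M: "\<And>x. x \<in> K \<Longrightarrow> norm x \<le> M"
    using compact_imp_bounded[OF comp] by (auto simp: bounded_iff)
  define N where "N = \<bar>M\<bar> + norm c + 1"
  have N: "N > 0" unfolding N_def by (intro add_nonneg_pos) auto
  have xN: "norm (x - c) < N" if "x \<in> K" for x
    using norm_triangle_ineq4[of x c] M[OF that] by (simp add: N_def)
  \<comment> \<open>The dilation moves a point x by (e / N) |x - c|, which is less than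
    \<open>e\<close> on the whole orbit.\<close>
  define r where "r = 1 + e / N"
  have r: "r > 1" using e(1) N by (simp add: r_def)
  define z' where "z' = c + r *\<^sub>R (z - c)"
  have fl: "flowY t z' = c + r *\<^sub>R (flowY t z - c)" for t
    unfolding z'_def c_def by (rule flowY_dilation)
  have "dist (flowY t z) (flowY t z') < e" for t
  proof -
    have "flowY t z' - flowY t z = (e / N) *\<^sub>R (flowY t z - c)"
      by (simp add: fl r_def algebra_simps)
    then have "dist (flowY t z) (flowY t z') = e / N * norm (flowY t z - c)"
      using e(1) N by (subst dist_commute) (simp add: dist_norm)
    also have "\<dots> < e / N * N" using e(1) N xN[OF rK[of t]] by (intro mult_strict_left_mono) auto
    finally show ?thesis using N by simp
  qed
  then have in': "flowY t z' \<in> U \<inter> {z. sw z > 0}" for t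
    using e(2) rK[of t] by (meson UN_I mem_ball subsetD)
  have ne': "z' \<noteq> c" using ne r by (simp add: z'_def c_def)
  have "periodic_orbit X0 Y0 (range (\<lambda>t. flowY t z'))"
    by (rule outer_orbit_periodic) (use in' ne' in \<open>auto simp: c_def\<close>)
  moreover have "range (\<lambda>t. flowY t z') \<subseteq> U" using in' by auto
  moreover have "range (\<lambda>t. flowY t z') \<noteq> range (\<lambda>t. flowY t z)"
  proof
    assume "range (\<lambda>t. flowY t z') = range (\<lambda>t. flowY t z)"
    then have "flowY 0 z' \<in> range (\<lambda>t. flowY t z)" by blast
    then obtain t where "z' = flowY t z" by auto
    then have eq: "HY z' = HY z" by simp
    define a b where "a = z$1 - 5/16" and "b = z$2 - 37/16"
    have z': "z'$1 - 5/16 = r * a" "z'$2 - 37/16 = r * b"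
      by (simp_all add: z'_def c_def a_def b_def)
    define q where "q = 13 * a\<^sup>2 - 10 * a * b + 13 * b\<^sup>2"
    \<comment> \<open>The definite quadratic form is multiplied by \<open>r\<^sup>2 > 1\<close>, so
      the dilated orbit has another level unless it is the center.\<close>
    have "13 * (r * a)\<^sup>2 - 10 * (r * a) * (r * b) + 13 * (r * b)\<^sup>2 = q"
      using eq HY_center[of z] HY_center[of z'] unfolding z' by (simp add: q_def a_def b_def)
    moreover have "13 * (r * a)\<^sup>2 - 10 * (r * a) * (r * b) + 13 * (r * b)\<^sup>2 = r\<^sup>2 * q"
      by (simp add: q_def power2_eq_square algebra_simps)
    moreover have "r\<^sup>2 > 1" using r by simp
    ultimately have "q = 0" by simp
    moreover have "q = 5 * (a - b)\<^sup>2 + (8 * a\<^sup>2 + 8 * b\<^sup>2)"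
      by (simp add: q_def power2_eq_square algebra_simps)
    ultimately have "8 * a\<^sup>2 + 8 * b\<^sup>2 \<le> 0" using zero_le_power2[of "a - b"] by linarith
    then have "a = 0 \<and> b = 0" using sum_power2_le_zero_iff[of a b] by simp
    then show False using ne by (simp add: plane_eq_iff a_def b_def)
  qed
  ultimately show ?thesis by blast
qed

lemma limit_cycle_unique:
  assumes "crossing_limit_cycle X0 Y0 \<Gamma>" "crossing_limit_cycle X0 Y0 \<Delta>"
  shows "\<Gamma> = \<Delta>"
proof -
  have hits: "\<exists>\<gamma> T t. transversal \<gamma> \<and> T > 0 \<and> (\<forall>t. \<gamma> (t + T) = \<gamma> t) \<and> \<gamma> t = zc \<and> \<Gamma> = range \<gamma>"
    if lc: "crossing_limit_cycle X0 Y0 \<Gamma>" for \<Gamma>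
  proof -
    obtain \<gamma> where \<gamma>: "crossing_trajectory X0 Y0 \<gamma>" "closed_curve \<gamma>" "\<Gamma> = range \<gamma>"
      and cr: "\<Gamma> \<inter> S1 \<subseteq> crossing_region X0 Y0"
      using lc by (auto simp: crossing_limit_cycle_def crossing_periodic_orbit_def)
    obtain U where U: "open U" "\<Gamma> \<subseteq> U" "\<And>\<Gamma>'. periodic_orbit X0 Y0 \<Gamma>' \<Longrightarrow> \<Gamma>' \<subseteq> U \<Longrightarrow> \<Gamma>' = \<Gamma>"
      using lc unfolding crossing_limit_cycle_def by blast
    have tr: "transversal \<gamma>"
      using crossing_periodic_orbit_transversal[OF \<gamma>(1)] cr \<gamma>(3) by blast
    note fil = transversal_filippov[OF tr]
    obtain T where T: "T > 0" "\<And>t. \<gamma> (t + T) = \<gamma> t" using \<gamma>(2) by (auto simp: closed_curve_def)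
    have "range \<gamma> \<inter> S1 \<noteq> {}"
    proof
      assume off: "range \<gamma> \<inter> S1 = {}"
      note pos = periodic_off_circle(1)[OF fil \<gamma>(2) off] and r = periodic_off_circle(2)[OF fil \<gamma>(2) off]
      have pos': "sw (flowY t (\<gamma> 0)) > 0" for t
      proof -
        have "flowY t (\<gamma> 0) \<in> range \<gamma>" unfolding r by blast
        then show ?thesis using pos by auto
      qed
      have "\<gamma> 0 \<noteq> vector [5/16, 37/16]"
      proof
        assume "\<gamma> 0 = vector [5/16, 37/16]"
        then have "\<gamma> 0 $ 1 = 5/16" "\<gamma> 0 $ 2 = 37/16" by simp_all
        then have "flowY t (\<gamma> 0) = \<gamma> 0" for t by (simp only: plane_eq_iff flowY_nth) simp
        then have "range \<gamma> = {\<gamma> 0}" using r by auto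
        then show False using \<gamma>(2) unfolding closed_curve_def by (metis rangeI singletonD)
      qed
      then show False
        using outer_orbit_not_isolated[of "\<gamma> 0" U] pos' U \<gamma>(3) unfolding r by metis
    qed
    then obtain t0 where "\<gamma> t0 \<in> S1" by blast
    then obtain t where "\<gamma> t = zc" using periodic_through_zc[of \<gamma> T, OF tr T] by blast
    then show ?thesis using tr T \<gamma>(3) by blast
  qed
  obtain \<gamma> T t where 1: "transversal \<gamma>" "T > 0" "\<And>t. \<gamma> (t + T) = \<gamma> t" "\<gamma> t = zc" "\<Gamma> = range \<gamma>"
    using hits[OF assms(1)] by blast
  obtain \<eta> U s where 2: "transversal \<eta>" "U > 0" "\<And>t. \<eta> (t + U) = \<eta> t" "\<eta> s = zc" "\<Delta> = range \<eta>"
    using hits[OF assms(2)] by blast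
  show ?thesis using periodic_range_eq[of \<gamma> \<eta> T U t s] 1 2 by simp
qed

lemma limit_cycle:
  shows "\<exists>!\<Gamma>. crossing_limit_cycle X0 Y0 \<Gamma>"
    and "crossing_limit_cycle X0 Y0 \<Gamma> \<Longrightarrow> card (\<Gamma> \<inter> S1) = 2"
proof -
  obtain \<gamma> T where \<gamma>: "crossing_trajectory X0 Y0 \<gamma>" "T > 0" "\<And>t. \<gamma> (t + T) = \<gamma> t"
    "range \<gamma> \<inter> S1 = {zc, wc}" "\<And>t. sw (\<gamma> t) \<le> 0 \<and> \<gamma> t \<notin> S1 \<or> HY (\<gamma> t) = HY zc"
    using limit_cycle_curve by blast
  have lc: "crossing_limit_cycle X0 Y0 (range \<gamma>)" by (rule limit_cycle_isolated[OF \<gamma>])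
  then show "\<exists>!\<Gamma>. crossing_limit_cycle X0 Y0 \<Gamma>" using limit_cycle_unique by blast
  assume "crossing_limit_cycle X0 Y0 \<Gamma>"
  then have "\<Gamma> = range \<gamma>" using lc limit_cycle_unique by blast
  then show "card (\<Gamma> \<inter> S1) = 2" using \<gamma>(4) zc_neq_wc by simp
qed

section \<open>The homoclinic orbit\<close>

text \<open>The upper point of the circle on the unstable line \<open>vv = 0\<close>;
  \<open>zl\<close> is the one on the stable line \<open>uu = 0\<close>.\<close>

definition zr :: plane where "zr = vector [3/5, 4/5]"
definition zl :: plane where "zl = vector [- 4/5, 3/5]"

lemma zr_nth: "zr $ 1 = 3/5" "zr $ 2 = 4/5"
  and zl_nth: "zl $ 1 = - 4/5" "zl $ 2 = 3/5"
  by (simp_all add: zr_def zl_def)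

lemma uu_zr: "uu zr = 8/5" and vv_zr: "vv zr = 0"
  and uu_zl: "uu zl = 0" and vv_zl: "vv zl = - 6/5"
  by (simp_all add: uu_def vv_def zr_nth zl_nth)

lemma exit_zr: "exit_point zr"
  by (simp add: exit_point_def S1_def sw_def gg_def zr_nth power2_eq_square)

lemma entry_zl: "entry_point zl"
  by (simp add: entry_point_def S1_def sw_def gg_def zl_nth power2_eq_square)

lemma HY_zr_zl: "HY zr = HY zl"
  by (simp add: HY_def zr_nth zl_nth power2_eq_square)

lemma zr_S1: "zr \<in> S1" and zl_S1: "zl \<in> S1"
  using exit_zr entry_zl by (simp_all add: exit_point_def entry_point_def)

lemma zr_neq_zl: "zr \<noteq> zl"
  by (simp add: plane_eq_iff zr_nth zl_nth)

lemma sw_p0: "sw p0 < 0"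
  by (simp add: sw_def power2_eq_square)

text \<open>Along the separatrix \<open>sw\<close> is quadratic in \<open>exp t\<close>, with roots
  1 and -3/4.\<close>

lemma sw_flowX_zr:
  assumes "t < 0"
  shows "sw (flowX t zr) < 0"
proof -
  have "sw (flowX t zr) = 32/25 * ((exp t - 1) * (exp t + 3/4))"
    by (simp add: sw_def flowX_nth uu_zr vv_zr power2_eq_square field_simps)
  also have "(exp t - 1) * (exp t + 3/4) < 0"
    using assms by (intro mult_neg_pos add_pos_pos) auto
  finally show ?thesis by simp
qed

lemma sw_flowX_zl:
  assumes "t > 0"
  shows "sw (flowX t zl) < 0"
proof -
  have "sw (flowX t zl) = 18/25 * ((exp (- t) - 1) * (exp (- t) + 4/3))"
    by (simp add: sw_def flowX_nth uu_zl vv_zl power2_eq_square field_simps)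
  also have "(exp (- t) - 1) * (exp (- t) + 4/3) < 0"
    using assms by (intro mult_neg_pos add_pos_pos) auto
  finally show ?thesis by simp
qed

lemma flowX_zl_at_top: "((\<lambda>t. flowX t zl) \<longlongrightarrow> p0) at_top"
proof (rule vec_tendstoI)
  have e: "((\<lambda>t::real. exp (- t)) \<longlongrightarrow> 0) at_top"
    by (rule filterlim_compose[OF exp_at_bot filterlim_uminus_at_bot_at_top])
  have "((\<lambda>t::real. - 3/5 * exp (- t) - 1/5) \<longlongrightarrow> - 3/5 * 0 - 1/5) at_top"
    "((\<lambda>t::real. 3/5 * exp (- t)) \<longlongrightarrow> 3/5 * 0) at_top"
    by (intro tendsto_diff tendsto_mult tendsto_const e)+
  then have "((\<lambda>t. flowX t zl $ 1) \<longlongrightarrow> p0 $ 1) at_top" "((\<lambda>t. flowX t zl $ 2) \<longlongrightarrow> p0 $ 2) at_top"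
    by (simp_all add: flowX_nth uu_zl vv_zl)
  then show "((\<lambda>t. flowX t zl $ i) \<longlongrightarrow> p0 $ i) at_top" for i
    using exhaust_2[of i] by auto
qed

lemma flowX_zr_at_bot: "((\<lambda>t. flowX t zr) \<longlongrightarrow> p0) at_bot"
proof (rule vec_tendstoI)
  have "((\<lambda>t::real. 4/5 * exp t - 1/5) \<longlongrightarrow> 4/5 * 0 - 1/5) at_bot"
    "((\<lambda>t::real. 4/5 * exp t) \<longlongrightarrow> 4/5 * 0) at_bot"
    by (intro tendsto_diff tendsto_mult tendsto_const exp_at_bot)+
  then have "((\<lambda>t. flowX t zr $ 1) \<longlongrightarrow> p0 $ 1) at_bot" "((\<lambda>t. flowX t zr $ 2) \<longlongrightarrow> p0 $ 2) at_bot"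
    by (simp_all add: flowX_nth uu_zr vv_zr)
  then show "((\<lambda>t. flowX t zr $ i) \<longlongrightarrow> p0 $ i) at_bot" for i
    using exhaust_2[of i] by auto
qed

lemma homoclinic_orbit_exists: "\<exists>\<Lambda>. homoclinic_orbit X0 Y0 p0 \<Lambda>"
proof -
  obtain T where T: "T > 0" "flowY T zr = zl" "\<And>t. 0 < t \<Longrightarrow> t < T \<Longrightarrow> sw (flowY t zr) > 0"
    using Y_arc_exists[of zr zl] entry_zl exit_zr HY_zr_zl by (metis entry_point_def exit_point_def)
  have s0: "sw zr = 0" "sw zl = 0" using zr_S1 zl_S1 by (simp_all add: S1_def)
  define \<gamma> where "\<gamma> t = (if t \<le> 0 then flowX t zr else if t \<le> T then flowY t zr else flowX (t - T) zl)" for t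
  \<comment> \<open>Equally spaced breaks cut the two infinite inner arcs into pieces; genuine
    switches occur only at the ends of piece 0, the single outer arc.\<close>
  define \<tau> :: "int \<Rightarrow> real" where "\<tau> i = of_int i * T" for i
  define \<kappa> :: "int \<Rightarrow> side" where "\<kappa> i = (if i = 0 then Outside else Inside)" for i
  have sub: "subdivision \<tau>"
    using T(1) by (intro subdivision_of_steps[of T]) (auto simp: \<tau>_def algebra_simps)
  have swr: "sw (flowX t zr) \<le> 0" if "t \<le> 0" for t
    using sw_flowX_zr[of t] s0 that by (cases "t = 0") auto
  have swl: "sw (flowX t zl) \<le> 0" if "t \<ge> 0" for t
    using sw_flowX_zl[of t] s0 that by (cases "t = 0") auto
  have swY: "sw (flowY t zr) \<ge> 0" if "0 \<le> t" "t \<le> T" for t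
    using T(2) T(3)[of t] s0 that by (cases "t = 0 \<or> t = T") auto
  have arcs: "side_arc X0 Y0 (\<kappa> i) \<gamma> (\<tau> i) (\<tau> (i + 1))" for i
  proof -
    consider "i < 0" | "i = 0" | "i > 0" by linarith
    then show ?thesis
    proof cases
      case 1
      then have "of_int (i + 1) * T \<le> 0" using T(1) by (intro mult_nonpos_nonneg) auto
      then have "side_arc X0 Y0 Inside \<gamma> (\<tau> i) (\<tau> (i + 1))"
        by (intro side_arc_Inside_flowX[of _ _ _ 0 zr]) (auto simp: \<tau>_def \<gamma>_def intro!: swr)
      then show ?thesis using 1 by (simp add: \<kappa>_def)
    next
      case 2
      have "side_arc X0 Y0 Outside \<gamma> 0 T"
        by (intro side_arc_Outside_flowY[of _ _ _ 0 zr]) (auto simp: \<gamma>_def intro!: swY)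
      then show ?thesis using 2 by (simp add: \<kappa>_def \<tau>_def)
    next
      case 3
      then have ge: "of_int i * T \<ge> T" using T(1) by simp
      have "side_arc X0 Y0 Inside \<gamma> (\<tau> i) (\<tau> (i + 1))"
      proof (rule side_arc_Inside_flowX[of _ _ _ T zl])
        fix t assume "t \<in> {\<tau> i..\<tau> (i + 1)}"
        then have t: "t \<ge> T" using ge by (simp add: \<tau>_def)
        show "\<gamma> t = flowX (t - T) zl" using t T(1,2) by (cases "t = T") (auto simp: \<gamma>_def)
        show "sw (flowX (t - T) zl) \<le> 0" using t by (intro swl) simp
      qed
      then show ?thesis using 3 by (simp add: \<kappa>_def)
    qed
  qed
  have "\<gamma> (\<tau> (i + 1)) \<in> crossing_region X0 Y0" if "\<kappa> i \<noteq> \<kappa> (i + 1)" for i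
  proof -
    have "i = 0 \<or> i = - 1" using that by (auto simp: \<kappa>_def split: if_splits)
    then have "\<gamma> (\<tau> (i + 1)) = zr \<or> \<gamma> (\<tau> (i + 1)) = zl"
      using T(1,2) by (auto simp: \<tau>_def \<gamma>_def)
    then show ?thesis using exit_zr entry_zl by (auto simp: crossing_region_iff)
  qed
  then have ct: "crossing_trajectory X0 Y0 \<gamma>"
    unfolding crossing_trajectory_def using sub arcs by blast
  have "((\<lambda>t. flowX (- T + t) zl) \<longlongrightarrow> p0) at_top"
    by (rule filterlim_compose[OF flowX_zl_at_top])
       (rule filterlim_tendsto_add_at_top[OF tendsto_const filterlim_ident])
  moreover have "\<forall>\<^sub>F t in at_top. flowX (- T + t) zl = \<gamma> t"
    using eventually_gt_at_top[of T] by eventually_elim (use T(1) in \<open>simp add: \<gamma>_def\<close>)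
  ultimately have top: "(\<gamma> \<longlongrightarrow> p0) at_top" by (rule Lim_transform_eventually)
  have "\<forall>\<^sub>F t in at_bot. flowX t zr = \<gamma> t"
    using eventually_le_at_bot[of 0] by eventually_elim (simp add: \<gamma>_def)
  then have bot: "(\<gamma> \<longlongrightarrow> p0) at_bot" by (rule Lim_transform_eventually[OF flowX_zr_at_bot])
  have "\<gamma> 0 \<noteq> \<gamma> T" using T(1,2) zr_neq_zl by (simp add: \<gamma>_def)
  then have "homoclinic_orbit X0 Y0 p0 (range \<gamma>)"
    unfolding homoclinic_orbit_def using X0_p0 sw_p0 ct top bot by (auto intro: less_imp_le)
  then show ?thesis by blast
qed

section \<open>Uniqueness of the homoclinic orbit\<close>

lemma tendsto_sw:
  assumes "(\<gamma> \<longlongrightarrow> p) F"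
  shows "((\<lambda>t. sw (\<gamma> t)) \<longlongrightarrow> sw p) F"
  unfolding sw_def by (intro tendsto_intros tendsto_vec_nth assms)

text \<open>The absolute value of \<open>uu\<close> does not decrease along an inner arc, so it can
  tend to 0 only from 0.\<close>

lemma tendsto_saddle_imp_stable:
  assumes "filippov_trajectory X0 Y0 \<gamma>" "(\<gamma> \<longlongrightarrow> p0) at_top" "\<And>s. s > a \<Longrightarrow> sw (\<gamma> s) < 0"
  shows "uu (\<gamma> a) = 0"
proof -
  have "((\<lambda>t. \<bar>uu (\<gamma> t)\<bar>) \<longlongrightarrow> \<bar>uu p0\<bar>) at_top"
    unfolding uu_def by (intro tendsto_intros tendsto_vec_nth assms(2))
  moreover have "\<forall>\<^sub>F t in at_top. \<bar>uu (\<gamma> a)\<bar> \<le> \<bar>uu (\<gamma> t)\<bar>"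
    using eventually_ge_at_top[of a]
  proof eventually_elim
    case (elim t)
    have "\<gamma> t = flowX (t - a) (\<gamma> a)"
      by (rule inside_arc[OF assms(1) elim order_refl]) (use assms(3) in auto)
    then have "\<bar>uu (\<gamma> t)\<bar> = \<bar>uu (\<gamma> a)\<bar> * exp (t - a)" by (simp add: abs_mult)
    then show ?case using elim by (simp add: mult_le_cancel_left1)
  qed
  ultimately have "\<bar>uu (\<gamma> a)\<bar> \<le> \<bar>uu p0\<bar>" by (intro tendsto_lowerbound) auto
  then show ?thesis by simp
qed

lemma tendsto_saddle_imp_unstable:
  assumes "filippov_trajectory X0 Y0 \<gamma>" "(\<gamma> \<longlongrightarrow> p0) at_bot" "\<And>s. s < a \<Longrightarrow> sw (\<gamma> s) < 0"
  shows "vv (\<gamma> a) = 0"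
proof -
  have "((\<lambda>t. \<bar>vv (\<gamma> t)\<bar>) \<longlongrightarrow> \<bar>vv p0\<bar>) at_bot"
    unfolding vv_def by (intro tendsto_intros tendsto_vec_nth assms(2))
  moreover have "\<forall>\<^sub>F t in at_bot. \<bar>vv (\<gamma> a)\<bar> \<le> \<bar>vv (\<gamma> t)\<bar>"
    using eventually_le_at_bot[of a]
  proof eventually_elim
    case (elim t)
    have "\<gamma> a = flowX (a - t) (\<gamma> t)"
      by (rule inside_arc[OF assms(1) elim order_refl]) (use assms(3) in auto)
    then have "\<bar>vv (\<gamma> a)\<bar> = \<bar>vv (\<gamma> t)\<bar> * exp (- (a - t))" by (metis abs_exp_cancel abs_mult vv_flowX)
    then show ?case using elim by (simp add: mult_left_le)
  qed
  ultimately have "\<bar>vv (\<gamma> a)\<bar> \<le> \<bar>vv p0\<bar>" by (intro tendsto_lowerbound) auto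
  then show ?thesis by simp
qed

lemma last_time_nonneg:
  fixes f :: "real \<Rightarrow> real"
  assumes "continuous_on UNIV f" "f t \<ge> 0" "\<And>s. s > u \<Longrightarrow> f s < 0"
  obtains a where "f a = 0" "\<And>s. s > a \<Longrightarrow> f s < 0"
proof -
  define S where "S = f -` {0..}"
  have "closed S" unfolding S_def using assms(1) by (intro closed_vimage) auto
  moreover have "x \<le> u" if "x \<in> S" for x
    using assms(3)[of x] that by (cases "x \<le> u") (auto simp: S_def)
  then have bdd: "bdd_above S" by (rule bdd_aboveI)
  moreover have "S \<noteq> {}" using assms(2) by (auto simp: S_def)
  ultimately have mem: "Sup S \<in> S" using closed_contains_Sup by blast
  define a where "a = Sup S"
  have neg: "f s < 0" if "s > a" for s
    using cSup_upper[OF _ bdd, of s] that by (force simp: a_def S_def)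
  \<comment> \<open>The supremum belongs to the closed set, so the value there is nonnegative; as a
    limit of negative values from the right it is also nonpositive.\<close>
  have "f a \<le> 0"
  proof -
    have "isCont f a" using assms(1) continuous_on_eq_continuous_at by blast
    then have "(f \<longlongrightarrow> f a) (at_right a)" by (simp add: filterlim_at_split isCont_def)
    moreover have "\<forall>\<^sub>F s in at_right a. f s \<le> 0"
      unfolding eventually_at_right_field using neg by (intro exI[of _ "a + 1"]) (auto intro: less_imp_le)
    ultimately show ?thesis by (intro tendsto_upperbound) auto
  qed
  then show ?thesis using that neg mem by (force simp: a_def S_def)
qed

lemma stable_line_S1:
  assumes "z \<in> S1" "uu z = 0"
  shows "z = zl \<or> z = vector [3/5, - 4/5]"
proof -
  have "(z$1 - 3/5) * (z$1 + 4/5) = 0"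
    using sw_uu_vv[of z] assms by (simp add: S1_def power2_eq_square field_simps)
  then have "z$1 = 3/5 \<or> z$1 = - 4/5" by auto
  moreover have "z$2 = - z$1 - 1/5" using assms(2) by (simp add: uu_def)
  ultimately show ?thesis by (auto simp: plane_eq_iff zl_nth)
qed

lemma flowX_inverse: "w = flowX t z \<Longrightarrow> z = flowX (- t) w"
  by (simp add: plane_eq_iff_uu_vv mult.assoc mult_exp_exp)

text \<open>At (3/5, -4/5) \<open>X0\<close> points inward and \<open>Y0\<close> outward, so a
  Filippov trajectory could slide there and then follow the stable line. The switching condition of
  crossing trajectories excludes this.\<close>

lemma crossing_trajectory_stable_entry:
  assumes "crossing_trajectory X0 Y0 \<gamma>" "\<gamma> a \<in> S1" "uu (\<gamma> a) = 0" "\<And>s. s > a \<Longrightarrow> sw (\<gamma> s) < 0"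
  shows "\<gamma> a = zl"
proof -
  obtain e l r where e: "e > 0" and l: "side_arc X0 Y0 l \<gamma> (a - e) a"
    and r: "side_arc X0 Y0 r \<gamma> a (a + e)" and lr: "l \<noteq> r \<Longrightarrow> \<gamma> a \<in> crossing_region X0 Y0"
    using crossing_trajectory_local[OF assms(1)] by blast
  have alt: "\<gamma> a = zl \<or> \<gamma> a = vector [3/5, - 4/5]"
    by (rule stable_line_S1[OF assms(2,3)])
  then have lie: "lie_sw X0 (\<gamma> a) < 0"
    by (auto simp: lie_X0 zl_nth)
  \<comment> \<open>\<open>X0\<close> points inward at this point, so an inner arc ending here would
    have come from outside the disc.\<close>
  have "l = Outside"
  proof (cases l)
    case Inside
    have der: "(\<gamma> has_vector_derivative X0 (\<gamma> a)) (at a within {a - e..a})"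
      using l e by (simp add: Inside)
    obtain d where d: "d > 0" "\<forall>s. 0 < s \<and> s < d \<longrightarrow> sw (\<gamma> (a - s)) > sw (\<gamma> a)"
      using sw_decreasing_left[OF der e] lie by (auto simp: lie_sw_def)
    obtain s where "0 < s" "s < d" "s < e" using d(1) e dense[of 0 "min d e"] by auto
    then have "sw (\<gamma> (a - s)) > 0" "sw (\<gamma> (a - s)) \<le> 0"
      using d(2) assms(2) l by (auto simp: Inside S1_def)
    then show ?thesis by simp
  qed
  moreover have "r = Inside"
  proof (cases r)
    case Outside
    then have "sw (\<gamma> (a + e)) \<ge> 0" using r e by simp
    then show ?thesis using assms(4)[of "a + e"] e by simp
  qed
  ultimately have "\<gamma> a \<in> crossing_region X0 Y0" using lr by simp
  moreover have "\<not> entry_point (vector [3/5, - 4/5])" "\<not> exit_point (vector [3/5, - 4/5])"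
    by (simp_all add: entry_point_def exit_point_def gg_def power2_eq_square)
  ultimately show ?thesis using alt by (auto simp: crossing_region_iff)
qed

lemma crossing_trajectory_outward:
  assumes "crossing_trajectory X0 Y0 \<gamma>" "\<gamma> b \<in> S1" "b < a" "\<And>s. b < s \<Longrightarrow> s < a \<Longrightarrow> sw (\<gamma> s) > 0"
  shows "gg (\<gamma> b) \<le> 0"
proof (rule ccontr)
  assume "\<not> gg (\<gamma> b) \<le> 0"
  then have lie: "lie_sw Y0 (\<gamma> b) < 0" by (simp add: lie_Y0)
  obtain e r where e: "e > 0" and r: "side_arc X0 Y0 r \<gamma> b (b + e)"
    using crossing_trajectory_local[OF assms(1)] by blast
  show False
  proof (cases r)
    case Inside
    obtain s where s: "0 < s" "s < e" "s < a - b" using e assms(3) dense[of 0 "min e (a - b)"] by auto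
    then have "sw (\<gamma> (b + s)) \<le> 0" using r by (simp add: Inside)
    then show False using assms(4)[of "b + s"] s by simp
  next
    case Outside
    have der: "(\<gamma> has_vector_derivative Y0 (\<gamma> b)) (at b within {b..b + e})"
      using r e by (simp add: Outside)
    obtain d where d: "d > 0" "\<forall>s. 0 < s \<and> s < d \<longrightarrow> sw (\<gamma> (b + s)) < sw (\<gamma> b)"
      using sw_decreasing_right[OF der e] lie by (auto simp: lie_sw_def)
    obtain s where s: "0 < s" "s < d" "s < a - b" using d(1) assms(3) dense[of 0 "min d (a - b)"] by auto
    then show False using d(2) assms(2) assms(4)[of "b + s"] by (force simp: S1_def)
  qed
qed

text \<open>The trajectory is reconstructed backwards. Its last contact is on the stable line, hence
  \<open>zl\<close>; the outer arc before it starts on the same level of \<open>HY\<close>, hence at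
  \<open>zr\<close>; before that it follows the unstable separatrix, which never meets the circle
  again in backward time.\<close>

lemma homoclinic_structure:
  assumes "homoclinic_orbit X0 Y0 p0 \<Lambda>"
  obtains \<gamma> b where "\<Lambda> = range \<gamma>" "transversal \<gamma>" "\<gamma> b = zr" "\<And>s. s \<le> 0 \<Longrightarrow> \<gamma> (b + s) = flowX s zr"
    "range \<gamma> \<inter> S1 = {zr, zl}"
proof -
  obtain \<gamma> where ct: "crossing_trajectory X0 Y0 \<gamma>" and nc: "\<exists>s t. \<gamma> s \<noteq> \<gamma> t"
    and top: "(\<gamma> \<longlongrightarrow> p0) at_top" and bot: "(\<gamma> \<longlongrightarrow> p0) at_bot" and \<Lambda>: "\<Lambda> = range \<gamma>"
    using assms by (auto simp: homoclinic_orbit_def)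
  note fil = crossing_trajectory_imp_filippov_trajectory[OF ct]
  have cont: "continuous_on UNIV (\<lambda>t. sw (\<gamma> t))" by (rule filippov_sw_continuous[OF fil])
  obtain t1 where t1: "\<And>t. t > t1 \<Longrightarrow> sw (\<gamma> t) < 0"
    using order_tendstoD(2)[OF tendsto_sw[OF top] sw_p0] by (auto simp: eventually_at_top_dense)
  obtain t0 where t0: "\<And>t. t < t0 \<Longrightarrow> sw (\<gamma> t) < 0"
    using order_tendstoD(2)[OF tendsto_sw[OF bot] sw_p0] by (auto simp: eventually_at_bot_dense)
  have "\<exists>t. sw (\<gamma> t) \<ge> 0"
  proof (rule ccontr)
    assume "\<not> (\<exists>t. sw (\<gamma> t) \<ge> 0)"
    \<comment> \<open>A trajectory that stays inside would lie on both invariant lines at all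
      times.\<close>
    then have "\<gamma> t = p0" for t
      using tendsto_saddle_imp_stable[OF fil top, of t] tendsto_saddle_imp_unstable[OF fil bot, of t]
      by (simp add: plane_eq_iff_uu_vv not_le)
    then show False using nc by simp
  qed
  then obtain a where a: "sw (\<gamma> a) = 0" "\<And>s. s > a \<Longrightarrow> sw (\<gamma> s) < 0"
    using last_time_nonneg[OF cont] t1 by blast
  have aS: "\<gamma> a \<in> S1" using a(1) by (simp add: S1_def)
  have za: "\<gamma> a = zl"
    by (rule crossing_trajectory_stable_entry[OF ct aS tendsto_saddle_imp_stable[OF fil top a(2)] a(2)])
  obtain d where d: "d > 0" "\<forall>s. 0 < s \<and> s < d \<longrightarrow> sw (\<gamma> (a - s)) > 0"
    using filippov_entry_point[OF fil, of a] entry_zl za by auto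
  have "min t0 a - 1 < t0" by linarith
  then have u: "min t0 a - 1 < a" "sw (\<gamma> (min t0 a - 1)) \<le> 0" using t0 by (auto intro: less_imp_le)
  obtain b where b: "b < a" "sw (\<gamma> b) = 0" "\<And>s. b < s \<Longrightarrow> s < a \<Longrightarrow> sw (\<gamma> s) > 0"
    by (rule previous_zero[OF cont d(1) _ u]) (use d(2) in auto)
  have bS: "\<gamma> b \<in> S1" using b(2) by (simp add: S1_def)
  have "\<gamma> a = flowY (a - b) (\<gamma> b)" by (rule outside_arc[OF fil _ order_refl]) (use b in auto)
  then have "HY (\<gamma> b) = HY zr" using za HY_zr_zl by (metis HY_flowY)
  moreover have "gg (\<gamma> b) \<le> 0" by (rule crossing_trajectory_outward[OF ct bS b(1,3)])
  then have "\<not> gg (\<gamma> b) * gg zr < 0" using exit_zr by (auto simp: exit_point_def mult_less_0_iff)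
  ultimately have zb: "\<gamma> b = zr" using HY_level_circle[OF bS zr_S1] by blast
  obtain d' where d': "d' > 0" "\<forall>s. 0 < s \<and> s < d' \<longrightarrow> sw (\<gamma> (b - s)) < 0"
    using filippov_exit_point[OF fil, of b] exit_zr zb by auto
  have before: "sw (\<gamma> s) < 0" if sb: "s < b" for s
  proof (rule ccontr)
    assume "\<not> sw (\<gamma> s) < 0"
    then have s: "- sw (\<gamma> s) \<le> 0" by simp
    have c: "continuous_on UNIV (\<lambda>t. - sw (\<gamma> t))" using cont by (rule continuous_on_minus)
    obtain b' where b': "b' < b" "- sw (\<gamma> b') = 0" "\<And>s. b' < s \<Longrightarrow> s < b \<Longrightarrow> - sw (\<gamma> s) > 0"
      by (rule previous_zero[OF c d'(1) _ sb s]) (use d'(2) in auto)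
    have "\<gamma> b = flowX (b - b') (\<gamma> b')" by (rule inside_arc[OF fil _ order_refl]) (use b' in auto)
    then have "\<gamma> b' = flowX (- (b - b')) zr" using flowX_inverse zb by metis
    then show False using sw_flowX_zr[of "- (b - b')"] b'(1,2) by simp
  qed
  have flow: "\<gamma> (b + s) = flowX s zr" if "s \<le> 0" for s
  proof -
    have "\<gamma> b = flowX (b - (b + s)) (\<gamma> (b + s))"
      by (rule inside_arc[OF fil _ order_refl]) (use before that in auto)
    then show ?thesis using flowX_inverse[of "\<gamma> b" "- s"] zb by simp
  qed
  have zeros: "t = a \<or> t = b" if "\<gamma> t \<in> S1" for t
    using a(2)[of t] b(3)[of t] before[of t] that by (force simp: S1_def)
  have "transversal \<gamma>"
    unfolding transversal_def
  proof (intro conjI allI impI)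
    fix t assume "\<gamma> t \<in> S1"
    then show "\<gamma> t \<in> crossing_region X0 Y0"
      using zeros[of t] za zb entry_zl exit_zr by (auto simp: crossing_region_iff)
  qed (rule fil)
  moreover have "range \<gamma> \<inter> S1 = {zr, zl}"
    using zeros za zb zr_S1 zl_S1 by (auto intro: rangeI) (metis rangeI)+
  ultimately show ?thesis using that \<Lambda> zb flow by blast
qed

lemma homoclinic_orbit_unique:
  assumes "homoclinic_orbit X0 Y0 p0 \<Lambda>" "homoclinic_orbit X0 Y0 p0 \<Lambda>'"
  shows "\<Lambda> = \<Lambda>'"
proof -
  obtain \<gamma> b where 1: "\<Lambda> = range \<gamma>" "transversal \<gamma>" "\<gamma> b = zr" "\<And>s. s \<le> 0 \<Longrightarrow> \<gamma> (b + s) = flowX s zr"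
    using homoclinic_structure[OF assms(1)] by metis
  obtain \<eta> c where 2: "\<Lambda>' = range \<eta>" "transversal \<eta>" "\<eta> c = zr" "\<And>s. s \<le> 0 \<Longrightarrow> \<eta> (c + s) = flowX s zr"
    using homoclinic_structure[OF assms(2)] by metis
  \<comment> \<open>\<open>forward_unique\<close> covers only later times; for earlier ones both
    curves are the explicit separatrix.\<close>
  have eq: "\<gamma> (b + s) = \<eta> (c + s)" for s
    using forward_unique[OF 1(2) 2(2), of b c s] 1(3,4) 2(3,4) by (cases "s \<le> 0") auto
  have "\<gamma> t \<in> range \<eta>" for t using eq[of "t - b"] by auto
  moreover have "\<eta> t \<in> range \<gamma>" for t using eq[of "t - c"] by (metis add.commute diff_add_cancel rangeI)
  ultimately show ?thesis using 1(1) 2(1) by auto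
qed

theorem corollary15:
  shows "\<exists>X Y p. (X, Y) \<in> X_S1_2 \<and> X p = 0 \<and>
    (\<exists>!\<Gamma>. crossing_limit_cycle X Y \<Gamma>) \<and>
    (\<forall>\<Gamma>. crossing_limit_cycle X Y \<Gamma> \<longrightarrow> card (\<Gamma> \<inter> S1) = 2) \<and>
    (\<exists>!\<Lambda>. homoclinic_orbit X Y p \<Lambda>) \<and>
    (\<forall>\<Lambda>. homoclinic_orbit X Y p \<Lambda> \<longrightarrow> card ((\<Lambda> - {p}) \<inter> S1) = 2)"
proof (intro exI conjI allI impI)
  show "(X0, Y0) \<in> X_S1_2" by (rule X0_Y0_mem)
  show "X0 p0 = 0" by (rule X0_p0)
  show "\<exists>!\<Gamma>. crossing_limit_cycle X0 Y0 \<Gamma>" by (rule limit_cycle(1))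
  show "card (\<Gamma> \<inter> S1) = 2" if "crossing_limit_cycle X0 Y0 \<Gamma>" for \<Gamma>
    using that by (rule limit_cycle(2))
  show "\<exists>!\<Lambda>. homoclinic_orbit X0 Y0 p0 \<Lambda>"
    using homoclinic_orbit_exists homoclinic_orbit_unique by blast
  show "card ((\<Lambda> - {p0}) \<inter> S1) = 2" if hom: "homoclinic_orbit X0 Y0 p0 \<Lambda>" for \<Lambda>
  proof -
    have "\<Lambda> \<inter> S1 = {zr, zl}" using homoclinic_structure[OF hom] by metis
    moreover have "p0 \<notin> S1" using sw_p0 by (simp add: S1_def)
    ultimately have "(\<Lambda> - {p0}) \<inter> S1 = {zr, zl}" by blast
    then show ?thesis using zr_neq_zl by simp
  qed
qed

end
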